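(* Let $K$ be any field. There exists a 9-dimensional 3-solvable (more precisely, center-by-metabelian) Lie algebra over $K$ with nonzero reduced Koszul map $\bar\eta:H_3(\mathfrak{g})\to\mathrm{Kill}(\mathfrak{g})$. If $K$ has characteristic zero, then $9$ is the smallest possible dimension for such an example.
   Context: The derived series is $D^0\mathfrak{g}=\mathfrak{g}$, $D^{i+1}\mathfrak{g}=[D^i\mathfrak{g},D^i\mathfrak{g}]$; $\mathfrak{g}$ is 3-solvable if $D^3\mathfrak{g}=\{0\}$, and center-by-metabelian (also printed "central-by-metabelian") if $[\mathfrak{g},D^2\mathfrak{g}]=\{0\}$. Tensor, exterior and symmetric powers are over $K$. $H_*(\mathfrak{g})$ is the homology of the Chevalley–Eilenberg complex $\Lambda^*\mathfrak{g}$ with $\partial_n(x_1\wedge\dots\wedge x_n)=\sum_{i<j}(-1)^{i+j}[x_i,x_j]\wedge x_1\wedge\dots\wedge\hat{x_i}\wedge\dots\wedge\hat{x_j}\wedge\dots\wedge x_n$, and $Z_3(\mathfrak{g})=\ker\partial_3$. Writing $x\odot y$ for the product in the symmetric square $S^2\mathfrak{g}$, the Killing module $\mathrm{Kill}(\mathfrak{g})$ is the cokernel of $\mathfrak{g}^{\otimes 3}\to S^2\mathfrak{g}$, $x\otimes y\otimes z\mapsto [x,y]\odot z-x\odot[y,z]$. The Koszul map $\eta:\Lambda^3\mathfrak{g}\to\mathrm{Kill}(\mathfrak{g})$ sends $x\wedge y\wedge z$ to the class of $x\odot[y,z]$; it vanishes on 3-boundaries, and the reduced Koszul map $\bar\eta$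 is induced by restricting $\eta$ to $Z_3(\mathfrak{g})$. *)

theory Defs
  imports
    "HOL-Analysis.Analysis"
    "HOL-Library.Poly_Mapping"
    "HOL-Library.Set_Algebras"
    "HOL-Library.Multiset"
begin

section \<open>Free vector spaces and quotients\<close>

text \<open>The free \<open>'k\<close>-vector space on \<open>'a\<close> is the type \<open>'a \<Rightarrow>\<^sub>0 'k\<close> of finitely supported functions.\<close>

definition free_scale :: "'k::field \<Rightarrow> ('a \<Rightarrow>\<^sub>0 'k) \<Rightarrow> ('a \<Rightarrow>\<^sub>0 'k)" where
  "free_scale c f = Poly_Mapping.map ((*) c) f"

lemma lookup_free_scale:
  "Poly_Mapping.lookup (free_scale c f) a = c * Poly_Mapping.lookup f a"
  by (simp add: free_scale_def Poly_Mapping.map.rep_eq when_def)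

interpretation free: vector_space "free_scale :: 'k::field \<Rightarrow> ('a \<Rightarrow>\<^sub>0 'k) \<Rightarrow> ('a \<Rightarrow>\<^sub>0 'k)"
  by unfold_locales
    (auto intro!: poly_mapping_eqI simp: lookup_free_scale lookup_add algebra_simps)

definition gen :: "'a \<Rightarrow> ('a \<Rightarrow>\<^sub>0 'k::field)" where
  "gen a = Poly_Mapping.single a 1"

definition free_extend :: "('a \<Rightarrow> ('b \<Rightarrow>\<^sub>0 'k)) \<Rightarrow> ('a \<Rightarrow>\<^sub>0 'k::field) \<Rightarrow> ('b \<Rightarrow>\<^sub>0 'k)" where
  "free_extend \<phi> f =
     (\<Sum>a\<in>Poly_Mapping.keys f. free_scale (Poly_Mapping.lookup f a) (\<phi> a))"

text \<open>A quotient \<open>V / R\<close> is the set of cosets \<open>v +o R\<close> with \<open>v \<in> V\<close>. As \<open>+\<close> on sets is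
  elementwise addition, the sum of two cosets is their sum as sets, the zero vector of \<open>V / R\<close> is
  \<open>R\<close> itself, and the construction can be iterated.\<close>

definition quot_space :: "'v::plus set \<Rightarrow> 'v set \<Rightarrow> 'v set set" where
  "quot_space V R = (\<lambda>v. v +o R) ` V"

text \<open>The map on cosets induced by a map \<open>\<phi>\<close> that is constant on each coset.\<close>

definition induced :: "('v \<Rightarrow> 'w) \<Rightarrow> 'v set \<Rightarrow> 'w" where
  "induced \<phi> C = the_elem (\<phi> ` C)"

section \<open>Lie algebras\<close>

locale lie_algebra = vector_space scale
  for scale :: "'k::field \<Rightarrow> 'g::ab_group_add \<Rightarrow> 'g" +
  fixes bracket :: "'g \<Rightarrow> 'g \<Rightarrow> 'g"
  assumes linear_left: "Vector_Spaces.linear scale scale (\<lambda>x. bracket x y)"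
    and linear_right: "Vector_Spaces.linear scale scale (\<lambda>y. bracket x y)"
    and alternating: "bracket x x = 0"
    and jacobi: "bracket x (bracket y z) + bracket y (bracket z x) + bracket z (bracket x y) = 0"
begin

definition bracket_span :: "'g set \<Rightarrow> 'g set \<Rightarrow> 'g set" where
  "bracket_span A B = span {bracket x y | x y. x \<in> A \<and> y \<in> B}"

primrec derived :: "nat \<Rightarrow> 'g set" where
  "derived 0 = UNIV"
| "derived (Suc i) = bracket_span (derived i) (derived i)"

definition three_solvable :: bool where
  "three_solvable \<longleftrightarrow> derived 3 = {0}"

definition center_by_metabelian :: bool where
  "center_by_metabelian \<longleftrightarrow> bracket_span UNIV (derived 2) = {0}"

definition finite_dim :: bool where
  "finite_dim \<longleftrightarrow> (\<exists>B. finite_dimensional_vector_space scale B)"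

subsection \<open>Tensor, exterior and symmetric powers\<close>

text \<open>The \<open>n\<close>-th powers are quotients of the free vector space on lists of length \<open>n\<close>; the
  classes of the generator of \<open>[x\<^sub>1, \<dots>, x\<^sub>n]\<close> are \<open>x\<^sub>1 \<otimes> \<dots> \<otimes> x\<^sub>n\<close>, \<open>x\<^sub>1 \<and> \<dots> \<and> x\<^sub>n\<close> and
  \<open>x\<^sub>1 \<odot> \<dots> \<odot> x\<^sub>n\<close>.\<close>

definition free_lists :: "nat \<Rightarrow> ('g list \<Rightarrow>\<^sub>0 'k) set" where
  "free_lists n = {f. Poly_Mapping.keys f \<subseteq> {xs. length xs = n}}"

definition multilinear_gens :: "nat \<Rightarrow> ('g list \<Rightarrow>\<^sub>0 'k) set" where
  "multilinear_gens n =
     {gen (us @ (x + y) # vs) - gen (us @ x # vs) - gen (us @ y # vs) | us x y vs.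
        length us + 1 + length vs = n} \<union>
     {gen (us @ scale c x # vs) - free_scale c (gen (us @ x # vs)) | us c x vs.
        length us + 1 + length vs = n}"

definition tensor_rel :: "nat \<Rightarrow> ('g list \<Rightarrow>\<^sub>0 'k) set" where
  "tensor_rel n = free.span (multilinear_gens n)"

definition ext_rel :: "nat \<Rightarrow> ('g list \<Rightarrow>\<^sub>0 'k) set" where
  "ext_rel n = free.span (multilinear_gens n \<union> {gen xs | xs. length xs = n \<and> \<not> distinct xs})"

definition sym_rel :: "nat \<Rightarrow> ('g list \<Rightarrow>\<^sub>0 'k) set" where
  "sym_rel n = free.span (multilinear_gens n \<union>
     {gen xs - gen ys | xs ys. length xs = n \<and> length ys = n \<and> mset xs = mset ys})"

definition tensor_power :: "nat \<Rightarrow> ('g list \<Rightarrow>\<^sub>0 'k) set set" where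
  "tensor_power n = quot_space (free_lists n) (tensor_rel n)"

definition ext_power :: "nat \<Rightarrow> ('g list \<Rightarrow>\<^sub>0 'k) set set" where
  "ext_power n = quot_space (free_lists n) (ext_rel n)"

definition sym_power :: "nat \<Rightarrow> ('g list \<Rightarrow>\<^sub>0 'k) set set" where
  "sym_power n = quot_space (free_lists n) (sym_rel n)"

subsection \<open>Chevalley--Eilenberg homology\<close>

text \<open>Positions are counted from 0 here; this does not affect the sign \<open>(-1)\<^sup>i\<^sup>+\<^sup>j\<close>.\<close>

definition boundary_gen :: "'g list \<Rightarrow> ('g list \<Rightarrow>\<^sub>0 'k)" where
  "boundary_gen xs =
     (\<Sum>j<length xs. \<Sum>i<j.
        free_scale ((-1) ^ (i + j)) (gen (bracket (xs ! i) (xs ! j) # nths xs (- {i, j}))))"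

definition boundary :: "nat \<Rightarrow> ('g list \<Rightarrow>\<^sub>0 'k) set \<Rightarrow> ('g list \<Rightarrow>\<^sub>0 'k) set" where
  "boundary n = induced (\<lambda>f. free_extend boundary_gen f +o ext_rel (n - 1))"

definition cycles :: "nat \<Rightarrow> ('g list \<Rightarrow>\<^sub>0 'k) set set" where
  "cycles n = {w \<in> ext_power n. boundary n w = ext_rel (n - 1)}"

definition boundaries :: "nat \<Rightarrow> ('g list \<Rightarrow>\<^sub>0 'k) set set" where
  "boundaries n = boundary (n + 1) ` ext_power (n + 1)"

definition homology :: "nat \<Rightarrow> ('g list \<Rightarrow>\<^sub>0 'k) set set set" where
  "homology n = quot_space (cycles n) (boundaries n)"

subsection \<open>The Killing module and the Koszul map\<close>

fun killing_gen :: "'g list \<Rightarrow> ('g list \<Rightarrow>\<^sub>0 'k)" where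
  "killing_gen [x, y, z] = gen [bracket x y, z] - gen [x, bracket y z]"
| "killing_gen _ = 0"

definition killing_map :: "('g list \<Rightarrow>\<^sub>0 'k) set \<Rightarrow> ('g list \<Rightarrow>\<^sub>0 'k) set" where
  "killing_map = induced (\<lambda>f. free_extend killing_gen f +o sym_rel 2)"

definition killing_rel :: "('g list \<Rightarrow>\<^sub>0 'k) set set" where
  "killing_rel = killing_map ` tensor_power 3"

definition killing_module :: "('g list \<Rightarrow>\<^sub>0 'k) set set set" where
  "killing_module = quot_space (sym_power 2) killing_rel"

fun koszul_gen :: "'g list \<Rightarrow> ('g list \<Rightarrow>\<^sub>0 'k)" where
  "koszul_gen [x, y, z] = gen [x, bracket y z]"
| "koszul_gen _ = 0"

definition koszul :: "('g list \<Rightarrow>\<^sub>0 'k) set \<Rightarrow> ('g list \<Rightarrow>\<^sub>0 'k) set set" where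
  "koszul = induced (\<lambda>f. (free_extend koszul_gen f +o sym_rel 2) +o killing_rel)"

definition reduced_koszul :: "('g list \<Rightarrow>\<^sub>0 'k) set set \<Rightarrow> ('g list \<Rightarrow>\<^sub>0 'k) set set" where
  "reduced_koszul = induced koszul"

text \<open>The coset \<open>killing_rel\<close> is the zero vector of \<open>killing_module\<close>.\<close>

definition reduced_koszul_nonzero :: bool where
  "reduced_koszul_nonzero \<longleftrightarrow> (\<exists>h \<in> homology 3. reduced_koszul h \<noteq> killing_rel)"

end

end

theory Submission
  imports Defs
begin

text \<open>
  By duality, the reduced Koszul map is nonzero iff some invariant symmetric bilinear form \<open>B\<close> has a
  trilinear form \<open>\<omega>(x, y, z) = B([x, y], z)\<close> that is not the coboundary of an alternating bilinear form.
  For the nine-dimensional example, \<open>\<omega> = u\<^sup>* e\<^sub>1\<^sup>* f\<^sub>1\<^sup>* + v\<^sup>* e\<^sub>2\<^sup>* f\<^sub>2\<^sup>* + u\<^sup>* v\<^sup>* b\<^sup>*\<close>, and it takes the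
  value \<open>-1\<close> on the cycle \<open>u \<and> v \<and> b - u \<and> e\<^sub>1 \<and> f\<^sub>1 - v \<and> e\<^sub>2 \<and> f\<^sub>2\<close>.

  For the lower bound one may divide by the radical and assume that \<open>B\<close> is nondegenerate. Then
  \<open>\<omega>\<close> is a coboundary iff it is tangent to its orbit under the orthogonal group of \<open>B\<close>, that is, lies
  in the span of the forms \<open>a\<^sup>\<flat> \<and> \<iota>\<^sub>b\<omega> - b\<^sup>\<flat> \<and> \<iota>\<^sub>a\<omega>\<close>. Let \<open>Z\<close> be the center, \<open>A = Z\<^sup>\<bottom>\<close> the derived algebra
  and \<open>r\<close> the dimension of the isotropic space \<open>A \<inter> Z\<close>. Splitting off \<open>r\<close> hyperbolic planes leaves a complement of
  \<open>A \<inter> Z\<close> in \<open>A\<close> of dimension at most \<open>8 - 2 r\<close>, small enough to put \<open>\<omega>\<close> into a normal form on which the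
  tangent condition is solved by hand.
\<close>

section \<open>Linear functionals\<close>

text \<open>Homology and the Killing module are iterated sets of cosets; testing them by linear
  forms removes every quotient and leaves identities between multilinear forms. In the lower bound
  let \<open>q\<close> be the complement of A \<inter> Z in A, of dimension at most 8 - 2r. For r =
  0 and r = 4 the derived algebra is central, which already makes \<omega> a coboundary. As the
  second derived algebra is abelian, the restriction of \<omega> to A is zero or decomposable for r
  = 1 and zero for r = 2 and r = 3; what remains is the action on \<open>q\<close> of the r vectors
  dual to the isotropic center. For r = 2 an obstruction produces a vector of \<open>q\<close> on
  which both act trivially. Modulo it \<open>q\<close> has dimension at most three, where two
  alternating forms share a linear factor. The example has r = 2 and dim q = 5: u and v act on the
  separate planes of e_1, f_1 and of e_2, f_2, so one more dimension permits forms without a common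
  factor. The field may lack eigenvalues and square roots, so every normal form is reached by linear
  algebra in which only 2 and 3 are inverted.\<close>

definition functional :: "('k::field \<Rightarrow> 'v::ab_group_add \<Rightarrow> 'v) \<Rightarrow> ('v \<Rightarrow> 'k) \<Rightarrow> bool" where
  "functional sc \<phi> \<longleftrightarrow>
     (\<forall>x y. \<phi> (x + y) = \<phi> x + \<phi> y) \<and> (\<forall>c x. \<phi> (sc c x) = c * \<phi> x)"

lemma functional_add: "functional sc \<phi> \<Longrightarrow> \<phi> (x + y) = \<phi> x + \<phi> y"
  unfolding functional_def by blast

lemma functional_scale: "functional sc \<phi> \<Longrightarrow> \<phi> (sc c x) = c * \<phi> x"
  unfolding functional_def by blast

lemma functional_zero: "functional sc \<phi> \<Longrightarrow> \<phi> 0 = 0"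
proof -
  assume \<phi>: "functional sc \<phi>"
  have "\<phi> 0 + \<phi> 0 = \<phi> 0 + 0"
    by (subst functional_add[OF \<phi>, symmetric]) simp
  then show ?thesis
    by (rule add_left_imp_eq)
qed

lemma functional_uminus: "functional sc \<phi> \<Longrightarrow> \<phi> (- x) = - \<phi> x"
proof -
  assume \<phi>: "functional sc \<phi>"
  have "\<phi> (- x) + \<phi> x = 0"
    by (subst functional_add[OF \<phi>, symmetric]) (simp add: functional_zero[OF \<phi>])
  then show ?thesis
    by (simp only: eq_neg_iff_add_eq_0)
qed

lemma functional_diff:
  assumes "functional sc \<phi>"
  shows "\<phi> (x - y) = \<phi> x - \<phi> y"
  using functional_add[OF assms, of x "- y"] functional_uminus[OF assms, of y]
  by (simp only: diff_conv_add_uminus)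

lemma functional_sum:
  assumes "functional sc \<phi>"
  shows "\<phi> (sum f A) = (\<Sum>a\<in>A. \<phi> (f a))"
  by (induction A rule: infinite_finite_induct)
    (simp_all add: functional_zero[OF assms] functional_add[OF assms])

lemmas functional_simps =
  functional_add functional_scale functional_zero functional_uminus functional_diff functional_sum

context vector_space
begin

lemma functional_vanishes_on_span:
  assumes "functional scale \<phi>" "\<And>x. x \<in> S \<Longrightarrow> \<phi> x = 0" "x \<in> span S"
  shows "\<phi> x = 0"
  using assms(3) by (induction rule: span_induct_alt) (simp_all add: assms(2) functional_simps[OF assms(1)])

text \<open>A basis of S stays independent after adjoining x, so a linear form may be prescribed as
  0 on it and 1 at x. This works in infinite dimension, as the free spaces on lists require.\<close>

lemma separating_functional:
  assumes "subspace S" "x \<notin> S"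
  obtains \<phi> where "functional scale \<phi>" "\<And>s. s \<in> S \<Longrightarrow> \<phi> s = 0" "\<phi> x = 1"
proof -
  interpret K: vector_space "(*) :: 'a \<Rightarrow> 'a \<Rightarrow> 'a"
    by unfold_locales (auto simp: algebra_simps)
  interpret vector_space_pair scale "(*) :: 'a \<Rightarrow> 'a \<Rightarrow> 'a" ..
  obtain B where B: "B \<subseteq> S" "independent B" "S \<subseteq> span B"
    using maximal_independent_subset[of S] by auto
  have "span B = S"
    using B assms(1) span_minimal by blast
  then have "independent (insert x B)" "x \<notin> B"
    using B assms(2) by (auto simp: independent_insert)
  then obtain \<phi> where \<phi>: "Vector_Spaces.linear scale (*) \<phi>"
      "\<forall>y\<in>insert x B. \<phi> y = (if y = x then 1 else 0)"
    using linear_independent_extend[of "insert x B" "\<lambda>y. if y = x then 1 else 0"] by auto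
  have f: "functional scale \<phi>"
    using \<phi>(1) by (auto simp: functional_def Vector_Spaces.linear_iff)
  have 0: "\<phi> s = 0" if "s \<in> S" for s
  proof (rule functional_vanishes_on_span[OF f])
    show "s \<in> span B"
      using that B(3) by blast
  qed (use \<phi>(2) \<open>x \<notin> B\<close> in auto)
  show thesis
    by (rule that[OF f 0]) (use \<phi>(2) in auto)
qed

text \<open>Relations are tested through this equivalence, which turns statements about cosets into
  identities between forms.\<close>

lemma mem_subspace_iff_functional:
  assumes "subspace S"
  shows "x \<in> S \<longleftrightarrow> (\<forall>\<phi>. functional scale \<phi> \<longrightarrow> (\<forall>s\<in>S. \<phi> s = 0) \<longrightarrow> \<phi> x = 0)"
  by (metis assms separating_functional zero_neq_one)

end

section \<open>Free vector spaces and cosets\<close>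

lemma free_extend_superset:
  assumes "finite A" "Poly_Mapping.keys f \<subseteq> A"
  shows "free_extend \<psi> f = (\<Sum>a\<in>A. free_scale (Poly_Mapping.lookup f a) (\<psi> a))"
  unfolding free_extend_def
  by (rule sum.mono_neutral_left) (use assms in \<open>auto simp: in_keys_iff\<close>)

lemma free_extend_add: "free_extend \<psi> (f + g) = free_extend \<psi> f + free_extend \<psi> g"
proof -
  let ?A = "Poly_Mapping.keys f \<union> Poly_Mapping.keys g"
  have "Poly_Mapping.keys (f + g) \<subseteq> ?A"
    by (rule Poly_Mapping.keys_add)
  then show ?thesis
    by (simp add: free_extend_superset[of ?A] lookup_add free.scale_left_distrib sum.distrib)
qed

lemma free_extend_scale: "free_extend \<psi> (free_scale c f) = free_scale c (free_extend \<psi> f)"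
proof -
  have "Poly_Mapping.keys (free_scale c f) \<subseteq> Poly_Mapping.keys f"
    by (auto simp: in_keys_iff lookup_free_scale)
  then show ?thesis
    by (simp add: free_extend_superset[of "Poly_Mapping.keys f"] lookup_free_scale free.scale_sum_right)
qed

lemma free_extend_gen [simp]: "free_extend \<psi> (gen a) = \<psi> a"
  by (simp add: free_extend_def gen_def)

lemma functional_free_extend: "functional free_scale \<phi> \<Longrightarrow> functional free_scale (\<lambda>f. \<phi> (free_extend \<psi> f))"
  by (auto simp: functional_def free_extend_add free_extend_scale)

lemma free_extend_zero [simp]: "free_extend \<psi> 0 = 0"
  by (simp add: free_extend_def)

lemma free_extend_uminus: "free_extend \<psi> (- f) = - free_extend \<psi> f"
  using free_extend_scale[of \<psi> "- 1" f] by simp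

lemma free_extend_diff: "free_extend \<psi> (f - g) = free_extend \<psi> f - free_extend \<psi> g"
  using free_extend_add[of \<psi> f "- g"] by (simp add: free_extend_uminus)

lemma free_expand: "f = (\<Sum>a\<in>Poly_Mapping.keys f. free_scale (Poly_Mapping.lookup f a) (gen a))"
proof (rule poly_mapping_eqI)
  fix k
  have "(\<Sum>a\<in>Poly_Mapping.keys f. Poly_Mapping.lookup f a * (1 when a = k)) = Poly_Mapping.lookup f k"
    by (simp add: when_def in_keys_iff if_distrib sum.delta' cong: if_cong)
  then show "Poly_Mapping.lookup f k =
      Poly_Mapping.lookup (\<Sum>a\<in>Poly_Mapping.keys f. free_scale (Poly_Mapping.lookup f a) (gen a)) k"
    by (simp add: lookup_sum lookup_free_scale gen_def lookup_single)
qed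

lemma coset_eq_iff:
  assumes "free.subspace R"
  shows "a +o R = b +o R \<longleftrightarrow> a - b \<in> R"
proof
  assume "a +o R = b +o R"
  moreover have "a \<in> a +o R"
    using free.subspace_0[OF assms] by (metis add.right_neutral set_plus_intro2)
  ultimately show "a - b \<in> R"
    using set_plus_imp_minus by blast
next
  assume ab: "a - b \<in> R"
  then have ba: "b - a \<in> R"
    using free.subspace_neg[OF assms ab] by simp
  have "x \<in> a +o R \<longleftrightarrow> x \<in> b +o R" for x
  proof -
    have "x - a \<in> R \<longleftrightarrow> x - b \<in> R"
      using free.subspace_add[OF assms _ ab, of "x - a"] free.subspace_add[OF assms _ ba, of "x - b"]
      by auto
    then show ?thesis
      using set_minus_imp_plus[of x a R] set_plus_imp_minus[of x a R]
        set_minus_imp_plus[of x b R] set_plus_imp_minus[of x b R] by blast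
  qed
  then show "a +o R = b +o R"
    by blast
qed

lemma subspace_plus_self: "free.subspace R \<Longrightarrow> R + R = R"
proof (intro equalityI subsetI)
  fix x assume R: "free.subspace R"
  show "x \<in> R" if "x \<in> R + R"
    using that free.subspace_add[OF R] by (auto elim!: set_plus_elim)
  show "x \<in> R + R" if "x \<in> R"
    using set_plus_intro[OF that free.subspace_0[OF R]] by simp
qed

lemma coset_plus_coset: "free.subspace R \<Longrightarrow> (a +o R) + (b +o R) = (a + b) +o R"
  by (simp add: set_plus_rearrange subspace_plus_self)

text \<open>Constancy on the coset makes the image a singleton, the case in which
  \<open>the_elem\<close> returns the common value.\<close>

lemma induced_eq:
  assumes "x \<in> C" "\<And>y. y \<in> C \<Longrightarrow> \<phi> y = \<phi> x"
  shows "induced \<phi> C = \<phi> x"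
proof -
  have "\<phi> ` C = {\<phi> x}"
    using assms by blast
  then show ?thesis
    by (simp add: induced_def)
qed

section \<open>Exterior and symmetric powers through functionals\<close>

context lie_algebra
begin

lemma bracket_add_left: "bracket (x + y) z = bracket x z + bracket y z"
  using linear_left[of z] unfolding Vector_Spaces.linear_iff by blast

lemma bracket_add_right: "bracket z (x + y) = bracket z x + bracket z y"
  using linear_right[of z] unfolding Vector_Spaces.linear_iff by blast

lemma bracket_scale_left: "bracket (scale c x) z = scale c (bracket x z)"
  using linear_left[of z] unfolding Vector_Spaces.linear_iff by blast

lemma bracket_scale_right: "bracket z (scale c x) = scale c (bracket z x)"
  using linear_right[of z] unfolding Vector_Spaces.linear_iff by blast

lemma bracket_zero_left [simp]: "bracket 0 z = 0"
  using bracket_add_left[of 0 0 z] by simp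

lemma bracket_zero_right [simp]: "bracket z 0 = 0"
  using bracket_add_right[of z 0 0] by simp

lemma bracket_skew: "bracket y x = - bracket x y"
proof -
  have "bracket x y + bracket y x = 0"
    using alternating[of "x + y"] alternating[of x] alternating[of y]
    by (simp add: bracket_add_left bracket_add_right add.commute)
  then show ?thesis
    by (rule minus_unique[symmetric])
qed

lemma bracket_uminus_left: "bracket (- x) z = - bracket x z"
  by (rule minus_unique[symmetric]) (simp flip: bracket_add_left)

lemma bracket_uminus_right: "bracket z (- x) = - bracket z x"
  by (rule minus_unique[symmetric]) (simp flip: bracket_add_right)

lemma bracket_diff_left: "bracket (x - y) z = bracket x z - bracket y z"
  using bracket_add_left[of x "- y" z] by (simp add: bracket_uminus_left)

lemma bracket_diff_right: "bracket z (x - y) = bracket z x - bracket z y"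
  using bracket_add_right[of z x "- y"] by (simp add: bracket_uminus_right)

lemmas bracket_simps =
  bracket_add_left bracket_add_right bracket_scale_left bracket_scale_right
  bracket_uminus_left bracket_uminus_right bracket_diff_left bracket_diff_right

lemma jacobi_right: "bracket (bracket x y) z = bracket x (bracket y z) - bracket y (bracket x z)"
proof -
  have "bracket (bracket x y) z = - bracket z (bracket x y)"
    by (rule bracket_skew)
  also have "\<dots> = bracket x (bracket y z) + bracket y (bracket z x)"
    using jacobi[of x y z] by (intro minus_unique) (simp only: ac_simps)
  also have "bracket y (bracket z x) = - bracket y (bracket x z)"
    by (subst bracket_skew[of z x]) (rule bracket_uminus_right)
  finally show ?thesis
    by simp
qed

section \<open>Multilinear, alternating and symmetric forms as linear forms on the free
  space\<close>

lemma subspace_tensor_rel [simp]: "free.subspace (tensor_rel n)"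
  and subspace_ext_rel [simp]: "free.subspace (ext_rel n)"
  and subspace_sym_rel [simp]: "free.subspace (sym_rel n)"
  by (simp_all add: tensor_rel_def ext_rel_def sym_rel_def free.subspace_span)

definition multilinear_functional :: "nat \<Rightarrow> (('g list \<Rightarrow>\<^sub>0 'k) \<Rightarrow> 'k) \<Rightarrow> bool" where
  "multilinear_functional n \<phi> \<longleftrightarrow> functional free_scale \<phi> \<and> (\<forall>f\<in>multilinear_gens n. \<phi> f = 0)"

lemma multilinear_functionalI:
  assumes "functional free_scale \<phi>"
    and "\<And>us x y vs. length us + 1 + length vs = n \<Longrightarrow>
      \<phi> (gen (us @ (x + y) # vs)) = \<phi> (gen (us @ x # vs)) + \<phi> (gen (us @ y # vs))"
    and "\<And>us c x vs. length us + 1 + length vs = n \<Longrightarrow>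
      \<phi> (gen (us @ scale c x # vs)) = c * \<phi> (gen (us @ x # vs))"
  shows "multilinear_functional n \<phi>"
  unfolding multilinear_functional_def multilinear_gens_def
  using assms by (auto simp: functional_simps[OF assms(1)])

lemma multilinear_functional_add:
  assumes "multilinear_functional n \<phi>" "length us + 1 + length vs = n"
  shows "\<phi> (gen (us @ (x + y) # vs)) = \<phi> (gen (us @ x # vs)) + \<phi> (gen (us @ y # vs))"
proof -
  have f: "functional free_scale \<phi>"
    using assms by (simp add: multilinear_functional_def)
  have "gen (us @ (x + y) # vs) - gen (us @ x # vs) - gen (us @ y # vs) \<in> multilinear_gens n"
    using assms(2) unfolding multilinear_gens_def by blast
  then have "\<phi> (gen (us @ (x + y) # vs) - gen (us @ x # vs) - gen (us @ y # vs)) = 0"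
    using assms(1) unfolding multilinear_functional_def by blast
  then show ?thesis
    by (simp add: functional_simps[OF f] diff_eq_eq add.commute)
qed

lemma multilinear_functional_scale:
  assumes "multilinear_functional n \<phi>" "length us + 1 + length vs = n"
  shows "\<phi> (gen (us @ scale c x # vs)) = c * \<phi> (gen (us @ x # vs))"
proof -
  have f: "functional free_scale \<phi>"
    using assms by (simp add: multilinear_functional_def)
  have "gen (us @ scale c x # vs) - free_scale c (gen (us @ x # vs)) \<in> multilinear_gens n"
    using assms(2) unfolding multilinear_gens_def by blast
  then have "\<phi> (gen (us @ scale c x # vs) - free_scale c (gen (us @ x # vs))) = 0"
    using assms(1) unfolding multilinear_functional_def by blast
  then show ?thesis
    by (simp add: functional_simps[OF f])
qed

lemma multilinear_functional_2:
  assumes "multilinear_functional 2 \<phi>"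
  shows "\<phi> (gen [x + y, z]) = \<phi> (gen [x, z]) + \<phi> (gen [y, z])"
    "\<phi> (gen [z, x + y]) = \<phi> (gen [z, x]) + \<phi> (gen [z, y])"
    "\<phi> (gen [scale c x, z]) = c * \<phi> (gen [x, z])"
    "\<phi> (gen [z, scale c x]) = c * \<phi> (gen [z, x])"
  using multilinear_functional_add[OF assms, of "[]" "[z]" x y]
    multilinear_functional_add[OF assms, of "[z]" "[]" x y]
    multilinear_functional_scale[OF assms, of "[]" "[z]" c x]
    multilinear_functional_scale[OF assms, of "[z]" "[]" c x] by simp_all

lemma multilinear_functional_3:
  assumes "multilinear_functional 3 \<phi>"
  shows "\<phi> (gen [x + y, z, w]) = \<phi> (gen [x, z, w]) + \<phi> (gen [y, z, w])"
    "\<phi> (gen [z, x + y, w]) = \<phi> (gen [z, x, w]) + \<phi> (gen [z, y, w])"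
    "\<phi> (gen [z, w, x + y]) = \<phi> (gen [z, w, x]) + \<phi> (gen [z, w, y])"
    "\<phi> (gen [scale c x, z, w]) = c * \<phi> (gen [x, z, w])"
    "\<phi> (gen [z, scale c x, w]) = c * \<phi> (gen [z, x, w])"
    "\<phi> (gen [z, w, scale c x]) = c * \<phi> (gen [z, w, x])"
  using multilinear_functional_add[OF assms, of "[]" "[z, w]" x y]
    multilinear_functional_add[OF assms, of "[z]" "[w]" x y]
    multilinear_functional_add[OF assms, of "[z, w]" "[]" x y]
    multilinear_functional_scale[OF assms, of "[]" "[z, w]" c x]
    multilinear_functional_scale[OF assms, of "[z]" "[w]" c x]
    multilinear_functional_scale[OF assms, of "[z, w]" "[]" c x] by simp_all

lemma length_eq_1_iff: "length xs = 1 \<longleftrightarrow> (\<exists>x. xs = [x])"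
  and length_eq_2_iff: "length xs = 2 \<longleftrightarrow> (\<exists>x y. xs = [x, y])"
  and length_eq_3_iff: "length xs = 3 \<longleftrightarrow> (\<exists>x y z. xs = [x, y, z])"
  and length_eq_4_iff: "length xs = 4 \<longleftrightarrow> (\<exists>x y z w. xs = [x, y, z, w])"
  by (auto simp: numeral_eq_Suc length_Suc_conv)

lemma length_split_3:
  assumes "length us + 1 + length vs = 3"
  obtains (1) a b where "us = []" "vs = [a, b]" | (2) a b where "us = [a]" "vs = [b]"
    | (3) a b where "us = [a, b]" "vs = []"
proof -
  consider "length us = 0" "length vs = 2" | "length us = 1" "length vs = 1"
    | "length us = 2" "length vs = 0"
    using assms by linarith
  then show thesis
    by cases (metis 1 2 3 length_0_conv length_eq_1_iff length_eq_2_iff)+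
qed

lemma length_split_4:
  assumes "length us + 1 + length vs = 4"
  obtains (1) a b c where "us = []" "vs = [a, b, c]" | (2) a b c where "us = [a]" "vs = [b, c]"
    | (3) a b c where "us = [a, b]" "vs = [c]" | (4) a b c where "us = [a, b, c]" "vs = []"
proof -
  consider "length us = 0" "length vs = 3" | "length us = 1" "length vs = 2"
    | "length us = 2" "length vs = 1" | "length us = 3" "length vs = 0"
    using assms by linarith
  then show thesis
    by cases (metis 1 2 3 4 length_0_conv length_eq_1_iff length_eq_2_iff length_eq_3_iff)+
qed

definition ext_functional :: "nat \<Rightarrow> (('g list \<Rightarrow>\<^sub>0 'k) \<Rightarrow> 'k) \<Rightarrow> bool" where
  "ext_functional n \<phi> \<longleftrightarrow>
     multilinear_functional n \<phi> \<and> (\<forall>xs. length xs = n \<longrightarrow> \<not> distinct xs \<longrightarrow> \<phi> (gen xs) = 0)"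

definition sym_functional :: "nat \<Rightarrow> (('g list \<Rightarrow>\<^sub>0 'k) \<Rightarrow> 'k) \<Rightarrow> bool" where
  "sym_functional n \<phi> \<longleftrightarrow>
     multilinear_functional n \<phi> \<and>
     (\<forall>xs ys. length xs = n \<longrightarrow> length ys = n \<longrightarrow> mset xs = mset ys \<longrightarrow> \<phi> (gen xs) = \<phi> (gen ys))"

text \<open>Identifies the alternating forms with the annihilator of the relations, so that
  \<open>ext_rel\<close> can be recovered from them by separation.\<close>

lemma ext_functional_iff:
  "ext_functional n \<phi> \<longleftrightarrow> functional free_scale \<phi> \<and> (\<forall>f\<in>ext_rel n. \<phi> f = 0)"
  (is "?L \<longleftrightarrow> ?R")
proof
  assume L: ?L
  then have f: "functional free_scale \<phi>"
    unfolding ext_functional_def multilinear_functional_def by blast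
  have "\<phi> x = 0" if "x \<in> multilinear_gens n \<union> {gen xs | xs. length xs = n \<and> \<not> distinct xs}" for x
    using that
  proof
    assume "x \<in> multilinear_gens n"
    then show ?thesis
      using L unfolding ext_functional_def multilinear_functional_def by simp
  next
    assume "x \<in> {gen xs | xs. length xs = n \<and> \<not> distinct xs}"
    then obtain xs where "x = gen xs" "length xs = n" "\<not> distinct xs"
      by auto
    then show ?thesis
      using L unfolding ext_functional_def by simp
  qed
  then have "\<phi> x = 0" if "x \<in> ext_rel n" for x
    using free.functional_vanishes_on_span[OF f _ that[unfolded ext_rel_def]] by simp
  with f show ?R
    by simp
next
  assume R: ?R
  have sub: "multilinear_gens n \<union> {gen xs | xs. length xs = n \<and> \<not> distinct xs} \<subseteq> ext_rel n"
    unfolding ext_rel_def by (rule free.span_superset)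
  have "\<phi> (gen xs) = 0" if "length xs = n" "\<not> distinct xs" for xs
  proof -
    have "gen xs \<in> ext_rel n"
      using sub that by auto
    then show ?thesis
      using R by simp
  qed
  moreover have "\<phi> x = 0" if "x \<in> multilinear_gens n" for x
    using R sub that by auto
  ultimately show ?L
    unfolding ext_functional_def multilinear_functional_def using R by simp
qed

lemma sym_functional_iff:
  "sym_functional n \<phi> \<longleftrightarrow> functional free_scale \<phi> \<and> (\<forall>f\<in>sym_rel n. \<phi> f = 0)"
  (is "?L \<longleftrightarrow> ?R")
proof
  assume L: ?L
  then have f: "functional free_scale \<phi>"
    unfolding sym_functional_def multilinear_functional_def by blast
  have "\<phi> x = 0" if "x \<in> multilinear_gens n \<union>
      {gen xs - gen ys | xs ys. length xs = n \<and> length ys = n \<and> mset xs = mset ys}" for x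
    using that
  proof
    assume "x \<in> {gen xs - gen ys | xs ys. length xs = n \<and> length ys = n \<and> mset xs = mset ys}"
    then obtain xs ys where "x = gen xs - gen ys" "length xs = n" "length ys = n" "mset xs = mset ys"
      by blast
    moreover from this have "\<phi> (gen xs) = \<phi> (gen ys)"
      using L unfolding sym_functional_def by blast
    ultimately show ?thesis
      by (simp add: functional_diff[OF f])
  qed (use L in \<open>simp add: sym_functional_def multilinear_functional_def\<close>)
  then have "\<phi> x = 0" if "x \<in> sym_rel n" for x
    using free.functional_vanishes_on_span[OF f _ that[unfolded sym_rel_def]] by simp
  with f show ?R
    by simp
next
  assume R: ?R
  then have f: "functional free_scale \<phi>"
    by blast
  have 1: "\<phi> (gen xs) = \<phi> (gen ys)" if "length xs = n" "length ys = n" "mset xs = mset ys" for xs ys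
  proof -
    have "gen xs - gen ys \<in> sym_rel n"
      unfolding sym_rel_def by (rule free.span_base) (use that in blast)
    then have "\<phi> (gen xs - gen ys) = 0"
      using R by blast
    then show ?thesis
      by (simp add: functional_diff[OF f])
  qed
  have 2: "\<phi> x = 0" if "x \<in> multilinear_gens n" for x
    using R that unfolding sym_rel_def by (simp add: free.span_base)
  show ?L
    unfolding sym_functional_def multilinear_functional_def
    by (intro conjI ballI allI impI f 2 1)
qed

lemma ext_rel_mem_iff: "f \<in> ext_rel n \<longleftrightarrow> (\<forall>\<phi>. ext_functional n \<phi> \<longrightarrow> \<phi> f = 0)"
  by (subst free.mem_subspace_iff_functional[OF subspace_ext_rel]) (auto simp: ext_functional_iff)

lemma ext_functional_multilinear: "ext_functional n \<phi> \<Longrightarrow> multilinear_functional n \<phi>"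
  by (simp add: ext_functional_def)

lemma ext_functional_functional: "ext_functional n \<phi> \<Longrightarrow> functional free_scale \<phi>"
  by (simp add: ext_functional_def multilinear_functional_def)

lemma ext_functional_repeated:
  "ext_functional n \<phi> \<Longrightarrow> length xs = n \<Longrightarrow> \<not> distinct xs \<Longrightarrow> \<phi> (gen xs) = 0"
  by (simp add: ext_functional_def)

lemma ext_functional_2_skew:
  assumes "ext_functional 2 \<phi>"
  shows "\<phi> (gen [y, x]) = - \<phi> (gen [x, y])"
proof -
  note rep = ext_functional_repeated[OF assms]
  have "\<phi> (gen [x, y]) + \<phi> (gen [y, x]) = 0"
    using rep[of "[x + y, x + y]"] rep[of "[x, x]"] rep[of "[y, y]"]
    by (simp add: multilinear_functional_2[OF ext_functional_multilinear[OF assms]] add.commute)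
  then show ?thesis
    by (rule minus_unique[symmetric])
qed

lemma ext_functional_3_skew:
  assumes "ext_functional 3 \<phi>"
  shows "\<phi> (gen [y, x, z]) = - \<phi> (gen [x, y, z])" "\<phi> (gen [x, z, y]) = - \<phi> (gen [x, y, z])"
proof -
  note rep = ext_functional_repeated[OF assms]
  note ml = multilinear_functional_3[OF ext_functional_multilinear[OF assms]]
  have "\<phi> (gen [x, y, z]) + \<phi> (gen [y, x, z]) = 0"
    using rep[of "[x + y, x + y, z]"] rep[of "[x, x, z]"] rep[of "[y, y, z]"] by (simp add: ml add.commute)
  then show "\<phi> (gen [y, x, z]) = - \<phi> (gen [x, y, z])"
    by (rule minus_unique[symmetric])
  have "\<phi> (gen [x, y, z]) + \<phi> (gen [x, z, y]) = 0"
    using rep[of "[x, y + z, y + z]"] rep[of "[x, y, y]"] rep[of "[x, z, z]"] by (simp add: ml add.commute)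
  then show "\<phi> (gen [x, z, y]) = - \<phi> (gen [x, y, z])"
    by (rule minus_unique[symmetric])
qed

section \<open>Boundaries in degrees three and four\<close>

lemma boundary_gen_3:
  "boundary_gen [x, y, z] = - gen [bracket x y, z] + gen [bracket x z, y] - gen [bracket y z, x]"
  by (simp add: boundary_gen_def eval_nat_numeral) (simp add: nths_Cons)

lemma boundary_gen_4:
  "boundary_gen [x, y, z, w] =
     - gen [bracket x y, z, w] + gen [bracket x z, y, w] - gen [bracket y z, x, w]
     - gen [bracket x w, y, z] + gen [bracket y w, x, z] - gen [bracket z w, x, y]"
  by (simp add: boundary_gen_def eval_nat_numeral) (simp add: nths_Cons)

end

text \<open>Scalar counterpart of \<open>free_extend\<close>; it turns a form given on lists into a
  linear form on the free space.\<close>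

definition lin_ext :: "('a \<Rightarrow> 'k::field) \<Rightarrow> ('a \<Rightarrow>\<^sub>0 'k) \<Rightarrow> 'k" where
  "lin_ext T f = (\<Sum>a\<in>Poly_Mapping.keys f. Poly_Mapping.lookup f a * T a)"

lemma lin_ext_superset:
  assumes "finite A" "Poly_Mapping.keys f \<subseteq> A"
  shows "lin_ext T f = (\<Sum>a\<in>A. Poly_Mapping.lookup f a * T a)"
  unfolding lin_ext_def
  by (rule sum.mono_neutral_left) (use assms in \<open>auto simp: in_keys_iff\<close>)

lemma functional_lin_ext:
  fixes T :: "'a \<Rightarrow> 'k::field"
  shows "functional free_scale (lin_ext T)"
  unfolding functional_def
proof (intro conjI allI)
  fix f g :: "'a \<Rightarrow>\<^sub>0 'k" and c :: 'k
  let ?A = "Poly_Mapping.keys f \<union> Poly_Mapping.keys g"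
  have "Poly_Mapping.keys (f + g) \<subseteq> ?A"
    by (rule Poly_Mapping.keys_add)
  then show "lin_ext T (f + g) = lin_ext T f + lin_ext T g"
    by (simp add: lin_ext_superset[of ?A] lookup_add distrib_right sum.distrib)
  have "Poly_Mapping.keys (free_scale c f) \<subseteq> Poly_Mapping.keys f"
    by (auto simp: in_keys_iff lookup_free_scale)
  then show "lin_ext T (free_scale c f) = c * lin_ext T f"
    by (simp add: lin_ext_superset[of "Poly_Mapping.keys f"] lookup_free_scale sum_distrib_left mult.assoc)
qed

lemma lin_ext_gen [simp]: "lin_ext T (gen a) = T a"
  by (simp add: lin_ext_def gen_def)

lemma functional_eq_on_keys:
  assumes \<phi>: "functional free_scale \<phi>" and \<psi>: "functional free_scale \<psi>"
    and eq: "\<And>a. a \<in> Poly_Mapping.keys f \<Longrightarrow> \<phi> (gen a) = \<psi> (gen a)"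
  shows "\<phi> f = \<psi> f"
proof -
  let ?e = "\<Sum>a\<in>Poly_Mapping.keys f. free_scale (Poly_Mapping.lookup f a) (gen a)"
  have "\<phi> ?e = \<psi> ?e"
    by (simp add: functional_sum[OF \<phi>] functional_sum[OF \<psi>] functional_scale[OF \<phi>] functional_scale[OF \<psi>] eq)
  then show ?thesis
    by (simp flip: free_expand)
qed

lemma functional_zero_fun: "functional sc (\<lambda>_. 0)"
  by (simp add: functional_def)

definition bilinear_form :: "('k::field \<Rightarrow> 'v::ab_group_add \<Rightarrow> 'v) \<Rightarrow> ('v \<Rightarrow> 'v \<Rightarrow> 'k) \<Rightarrow> bool" where
  "bilinear_form sc B \<longleftrightarrow> (\<forall>y. functional sc (\<lambda>x. B x y)) \<and> (\<forall>x. functional sc (B x))"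

lemma bilinear_formD:
  assumes "bilinear_form sc B"
  shows "B (x + y) z = B x z + B y z" "B z (x + y) = B z x + B z y"
    "B (sc c x) z = c * B x z" "B z (sc c x) = c * B z x"
    "B 0 z = 0" "B z 0 = 0" "B (- x) z = - B x z" "B z (- x) = - B z x"
    "B (x - y) z = B x z - B y z" "B z (x - y) = B z x - B z y"
proof -
  have l: "functional sc (\<lambda>x. B x z)" and r: "functional sc (B z)" for z
    using assms by (auto simp: bilinear_form_def)
  show "B (x + y) z = B x z + B y z" "B z (x + y) = B z x + B z y"
    "B (sc c x) z = c * B x z" "B z (sc c x) = c * B z x"
    "B 0 z = 0" "B z 0 = 0" "B (- x) z = - B x z" "B z (- x) = - B z x"
    "B (x - y) z = B x z - B y z" "B z (x - y) = B z x - B z y"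
    using functional_simps(1-5)[OF l] functional_simps(1-5)[OF r] by simp_all
qed

context lie_algebra
begin

text \<open>Dual to the fact that the boundary descends to exterior powers. If two entries agree,
  one term contains their bracket, which is zero, and the other two cancel by skewness.\<close>

lemma functional_comp_boundary:
  assumes "ext_functional 2 \<phi>"
  shows "ext_functional 3 (\<lambda>f. \<phi> (free_extend boundary_gen f))"
proof -
  note f = ext_functional_functional[OF assms]
  note ml = multilinear_functional_2[OF ext_functional_multilinear[OF assms]]
  have g: "\<phi> (free_extend boundary_gen (gen [x, y, z])) =
      - \<phi> (gen [bracket x y, z]) + \<phi> (gen [bracket x z, y]) - \<phi> (gen [bracket y z, x])" for x y z
    by (simp add: boundary_gen_3 functional_add[OF f] functional_diff[OF f] functional_uminus[OF f])
  have "\<phi> (free_extend boundary_gen (gen xs)) = 0" if len: "length xs = 3" and rep: "\<not> distinct xs" for xs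
  proof -
    obtain x y z where xs: "xs = [x, y, z]"
      using len unfolding length_eq_3_iff by blast
    have 0: "\<phi> (gen [0, w]) = 0" for w
      using ml(3)[of 0 0 w] by simp
    have sk: "\<phi> (gen [bracket b a, c]) = - \<phi> (gen [bracket a b, c])" for a b c
      using ml(3)[of "-1" "bracket a b" c] bracket_skew[of b a] by simp
    consider "x = y" | "x = z" | "y = z"
      using rep xs by auto
    then show ?thesis
      unfolding xs g by cases (simp_all add: alternating 0 sk[of z x y] sk[of y z])
  qed
  moreover have "multilinear_functional 3 (\<lambda>f. \<phi> (free_extend boundary_gen f))"
  proof (rule multilinear_functionalI[OF functional_free_extend[OF f]])
    fix us vs :: "'g list" and c x y
    assume "length us + 1 + length vs = 3"
    then show "\<phi> (free_extend boundary_gen (gen (us @ (x + y) # vs))) =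
      \<phi> (free_extend boundary_gen (gen (us @ x # vs))) + \<phi> (free_extend boundary_gen (gen (us @ y # vs)))"
      and "\<phi> (free_extend boundary_gen (gen (us @ scale c x # vs))) =
        c * \<phi> (free_extend boundary_gen (gen (us @ x # vs)))"
      by (cases rule: length_split_3;
          simp only: append.simps g ml bracket_simps; simp add: algebra_simps)+
  qed
  ultimately show ?thesis
    unfolding ext_functional_def by blast
qed

text \<open>With two equal entries, one of the six terms contains their bracket, one repeats an
  entry, and the other four cancel in pairs.\<close>

lemma functional_comp_boundary_4:
  assumes "ext_functional 3 \<phi>"
  shows "ext_functional 4 (\<lambda>f. \<phi> (free_extend boundary_gen f))"
proof -
  note f = ext_functional_functional[OF assms]
  note ml = multilinear_functional_3[OF ext_functional_multilinear[OF assms]]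
  note alt = ext_functional_repeated[OF assms]
  have g: "\<phi> (free_extend boundary_gen (gen [x, y, z, w])) =
      - \<phi> (gen [bracket x y, z, w]) + \<phi> (gen [bracket x z, y, w]) - \<phi> (gen [bracket y z, x, w])
     - \<phi> (gen [bracket x w, y, z]) + \<phi> (gen [bracket y w, x, z]) - \<phi> (gen [bracket z w, x, y])"
    for x y z w
    by (simp add: boundary_gen_4 functional_add[OF f] functional_diff[OF f] functional_uminus[OF f])
  have "\<phi> (free_extend boundary_gen (gen xs)) = 0" if len: "length xs = 4" and rep: "\<not> distinct xs" for xs
  proof -
    obtain x y z w where xs: "xs = [x, y, z, w]"
      using len unfolding length_eq_4_iff by blast
    have 0: "\<phi> (gen [0, a, b]) = 0" for a b
      using ml(4)[of 0 0 a b] by simp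
    have sk: "\<phi> (gen [bracket b a, c, d]) = - \<phi> (gen [bracket a b, c, d])" for a b c d
      using ml(4)[of "-1" "bracket a b" c d] bracket_skew[of b a] by simp
    have sw: "\<phi> (gen [c, a, b]) = - \<phi> (gen [c, b, a])" for a b c
      using ext_functional_3_skew(2)[OF assms] .
    have rr: "\<phi> (gen [c, a, a]) = 0" for a c
      by (rule alt) auto
    consider "x = y" | "x = z" | "x = w" | "y = z" | "y = w" | "z = w"
      using rep xs by auto
    then show ?thesis
    proof cases
      case 1 then show ?thesis unfolding xs g by (simp add: alternating 0 rr)
    next
      case 2 then show ?thesis unfolding xs g
        by (simp add: alternating 0 rr sk[where a = y and b = z] sw[where a = y and b = z] sw[where a = z and b = w])
    next
      case 3 then show ?thesis unfolding xs g
        by (simp add: alternating 0 rr sk[where a = y and b = w] sk[where a = z and b = w] sw[where a = z and b = w] sw[where a = y and b = w])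
    next
      case 4 then show ?thesis unfolding xs g by (simp add: alternating 0 rr)
    next
      case 5 then show ?thesis unfolding xs g
        by (simp add: alternating 0 rr sk[where a = z and b = w] sw[where a = z and b = w] sw[where a = x and b = w])
    next
      case 6 then show ?thesis unfolding xs g by (simp add: alternating 0 rr)
    qed
  qed
  moreover have "multilinear_functional 4 (\<lambda>f. \<phi> (free_extend boundary_gen f))"
  proof (rule multilinear_functionalI[OF functional_free_extend[OF f]])
    fix us vs :: "'g list" and c x y
    assume "length us + 1 + length vs = 4"
    then show "\<phi> (free_extend boundary_gen (gen (us @ (x + y) # vs))) =
      \<phi> (free_extend boundary_gen (gen (us @ x # vs))) + \<phi> (free_extend boundary_gen (gen (us @ y # vs)))"
      and "\<phi> (free_extend boundary_gen (gen (us @ scale c x # vs))) =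
        c * \<phi> (free_extend boundary_gen (gen (us @ x # vs)))"
      by (cases rule: length_split_4;
          simp only: append.simps g ml bracket_simps; simp add: algebra_simps)+
  qed
  ultimately show ?thesis
    unfolding ext_functional_def by blast
qed

lemma boundary_ext_rel_3: "f \<in> ext_rel 3 \<Longrightarrow> free_extend boundary_gen f \<in> ext_rel 2"
  unfolding ext_rel_mem_iff using functional_comp_boundary by blast

lemma boundary_ext_rel_4: "f \<in> ext_rel 4 \<Longrightarrow> free_extend boundary_gen f \<in> ext_rel 3"
  unfolding ext_rel_mem_iff using functional_comp_boundary_4 by blast

end

section \<open>The reduced Koszul map through invariant forms\<close>

context lie_algebra
begin

text \<open>The linear forms on the Killing module, that is, the invariant symmetric bilinear
  forms.\<close>

definition killing_functional :: "(('g list \<Rightarrow>\<^sub>0 'k) \<Rightarrow> 'k) \<Rightarrow> bool" where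
  "killing_functional \<phi> \<longleftrightarrow>
     sym_functional 2 \<phi> \<and> (\<forall>x y z. \<phi> (gen [bracket x y, z]) = \<phi> (gen [x, bracket y z]))"

text \<open>The zero class of the Killing module pulled back to the free space on lists. The
  divisions by \<open>sym_rel 2\<close> and by \<open>killing_rel\<close> are merged into one
  subspace, to which separation by linear forms applies.\<close>

definition killing_zero :: "('g list \<Rightarrow>\<^sub>0 'k) set" where
  "killing_zero = {g. \<exists>f\<in>free_lists 3. g - free_extend killing_gen f \<in> sym_rel 2}"

lemma subspace_free_lists: "free.subspace (free_lists n)"
proof (rule free.subspaceI)
  show "f + g \<in> free_lists n" if "f \<in> free_lists n" "g \<in> free_lists n" for f g
    using that Poly_Mapping.keys_add[of f g] unfolding free_lists_def by blast
  show "free_scale c f \<in> free_lists n" if "f \<in> free_lists n" for c f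
    using that by (auto simp: free_lists_def in_keys_iff lookup_free_scale)
qed (simp add: free_lists_def)

lemma gen_free_lists: "length xs = n \<Longrightarrow> gen xs \<in> free_lists n"
  by (simp add: free_lists_def gen_def)

lemma subspace_killing_zero: "free.subspace killing_zero"
proof (rule free.subspaceI)
  show "0 \<in> killing_zero"
    unfolding killing_zero_def
    using free.subspace_0[OF subspace_free_lists] free.subspace_0[OF subspace_sym_rel] by force
next
  fix f g assume "f \<in> killing_zero" "g \<in> killing_zero"
  then obtain f' g' where "f' \<in> free_lists 3" "f - free_extend killing_gen f' \<in> sym_rel 2"
    "g' \<in> free_lists 3" "g - free_extend killing_gen g' \<in> sym_rel 2"
    unfolding killing_zero_def by blast
  then have "f' + g' \<in> free_lists 3"
    "(f - free_extend killing_gen f') + (g - free_extend killing_gen g') \<in> sym_rel 2"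
    by (simp_all add: free.subspace_add[OF subspace_free_lists] free.subspace_add[OF subspace_sym_rel])
  then show "f + g \<in> killing_zero"
    unfolding killing_zero_def by (auto simp: free_extend_add algebra_simps intro!: bexI[of _ "f' + g'"])
next
  fix c f assume "f \<in> killing_zero"
  then obtain f' where "f' \<in> free_lists 3" "f - free_extend killing_gen f' \<in> sym_rel 2"
    unfolding killing_zero_def by blast
  then have "free_scale c f' \<in> free_lists 3" "free_scale c (f - free_extend killing_gen f') \<in> sym_rel 2"
    by (simp_all add: free.subspace_scale[OF subspace_free_lists] free.subspace_scale[OF subspace_sym_rel])
  then show "free_scale c f \<in> killing_zero"
    unfolding killing_zero_def
    by (auto simp: free_extend_scale free.scale_right_diff_distrib intro!: bexI[of _ "free_scale c f'"])
qed

lemma killing_functional_iff: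
  "killing_functional \<phi> \<longleftrightarrow> functional free_scale \<phi> \<and> (\<forall>f\<in>killing_zero. \<phi> f = 0)"
  (is "?L \<longleftrightarrow> ?R")
proof
  assume L: ?L
  then have s: "functional free_scale \<phi>" "\<And>f. f \<in> sym_rel 2 \<Longrightarrow> \<phi> f = 0"
    by (auto simp: killing_functional_def sym_functional_iff)
  have "\<phi> (free_extend killing_gen f) = 0" if "f \<in> free_lists 3" for f
  proof (rule functional_eq_on_keys[OF functional_free_extend[OF s(1)] functional_zero_fun])
    fix xs assume "xs \<in> Poly_Mapping.keys f"
    then have "length xs = 3"
      using that by (auto simp: free_lists_def)
    then obtain x y z where "xs = [x, y, z]"
      unfolding length_eq_3_iff by blast
    then show "\<phi> (free_extend killing_gen (gen xs)) = 0"
      using L by (simp add: functional_diff[OF s(1)] killing_functional_def)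
  qed
  then have "\<phi> g = 0" if "g \<in> killing_zero" for g
    using that s(2) by (fastforce simp: killing_zero_def functional_diff[OF s(1)])
  with s(1) show ?R
    by blast
next
  assume R: ?R
  have "f \<in> killing_zero" if "f \<in> sym_rel 2" for f
    unfolding killing_zero_def using free.subspace_0[OF subspace_free_lists] that by force
  then have "sym_functional 2 \<phi>"
    using R by (simp add: sym_functional_iff)
  moreover have "\<phi> (gen [bracket x y, z]) = \<phi> (gen [x, bracket y z])" for x y z
  proof -
    have "gen [bracket x y, z] - gen [x, bracket y z] \<in> killing_zero"
      unfolding killing_zero_def
      using gen_free_lists[of "[x, y, z]" 3] free.subspace_0[OF subspace_sym_rel]
      by (auto intro!: bexI[of _ "gen [x, y, z]"])
    then have "\<phi> (gen [bracket x y, z] - gen [x, bracket y z]) = 0"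
      using R by blast
    then show ?thesis
      using R by (metis eq_iff_diff_eq_0 functional_diff)
  qed
  ultimately show ?L
    by (simp add: killing_functional_def)
qed

lemma killing_zero_mem_iff: "f \<in> killing_zero \<longleftrightarrow> (\<forall>\<phi>. killing_functional \<phi> \<longrightarrow> \<phi> f = 0)"
  by (subst free.mem_subspace_iff_functional[OF subspace_killing_zero]) (auto simp: killing_functional_iff)

lemma killing_functional_functional: "killing_functional \<phi> \<Longrightarrow> functional free_scale \<phi>"
  by (simp add: killing_functional_iff)

lemma killing_functional_multilinear: "killing_functional \<phi> \<Longrightarrow> multilinear_functional 2 \<phi>"
  by (simp add: killing_functional_def sym_functional_def)

lemma killing_functional_sym: "killing_functional \<phi> \<Longrightarrow> \<phi> (gen [x, y]) = \<phi> (gen [y, x])"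
  unfolding killing_functional_def sym_functional_def
  by (auto simp: add_mset_commute)

lemma killing_functional_invariant:
  "killing_functional \<phi> \<Longrightarrow> \<phi> (gen [bracket x y, z]) = \<phi> (gen [x, bracket y z])"
  by (simp add: killing_functional_def)

text \<open>Invariance rewrites \<phi>(x, [x, y]) as \<phi>([x, x], y) = 0, which makes the
  trilinear form \<phi>(x, [y, z]) alternating.\<close>

lemma killing_comp_koszul:
  assumes "killing_functional \<phi>"
  shows "ext_functional 3 (\<lambda>f. \<phi> (free_extend koszul_gen f))"
proof -
  note f = killing_functional_functional[OF assms]
  note ml = multilinear_functional_2[OF killing_functional_multilinear[OF assms]]
  note inv = killing_functional_invariant[OF assms]
  have g: "\<phi> (free_extend koszul_gen (gen [x, y, z])) = \<phi> (gen [x, bracket y z])" for x y z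
    by simp
  have 0: "\<phi> (gen [0, w]) = 0" "\<phi> (gen [w, 0]) = 0" for w
    using ml(3)[of 0 0 w] ml(4)[of w 0 0] by simp_all
  have "\<phi> (free_extend koszul_gen (gen xs)) = 0" if len: "length xs = 3" and rep: "\<not> distinct xs" for xs
  proof -
    obtain x y z where xs: "xs = [x, y, z]"
      using len unfolding length_eq_3_iff by blast
    have 1: "\<phi> (gen [x, bracket x y]) = 0" for x y
      by (simp flip: inv add: alternating 0)
    consider "x = y" | "x = z" | "y = z"
      using rep xs by auto
    then show ?thesis
      unfolding xs g
    proof cases
      case 2
      then show "\<phi> (gen [x, bracket y z]) = 0"
        using 1[of x y] ml(4)[of x "-1" "bracket x y"] bracket_skew[of y x] by simp
    qed (simp_all add: alternating 0 1)
  qed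
  moreover have "multilinear_functional 3 (\<lambda>f. \<phi> (free_extend koszul_gen f))"
  proof (rule multilinear_functionalI[OF functional_free_extend[OF f]])
    fix us vs :: "'g list" and c x y
    assume "length us + 1 + length vs = 3"
    then show "\<phi> (free_extend koszul_gen (gen (us @ (x + y) # vs))) =
      \<phi> (free_extend koszul_gen (gen (us @ x # vs))) + \<phi> (free_extend koszul_gen (gen (us @ y # vs)))"
      and "\<phi> (free_extend koszul_gen (gen (us @ scale c x # vs))) =
        c * \<phi> (free_extend koszul_gen (gen (us @ x # vs)))"
      by (cases rule: length_split_3; simp only: append.simps g ml bracket_simps)+
  qed
  ultimately show ?thesis
    unfolding ext_functional_def by blast
qed

lemma koszul_ext_rel: "f \<in> ext_rel 3 \<Longrightarrow> free_extend koszul_gen f \<in> killing_zero"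
  unfolding ext_rel_mem_iff killing_zero_mem_iff using killing_comp_koszul by blast

text \<open>Symmetry pairs the six boundary terms and leaves -2 times a sum of three; invariance
  rewrites that sum as the pairing of x with the Jacobi sum of y, z, w.\<close>

lemma koszul_boundary:
  assumes "f \<in> free_lists 4"
  shows "free_extend koszul_gen (free_extend boundary_gen f) \<in> killing_zero"
  unfolding killing_zero_mem_iff
proof (intro allI impI)
  fix \<phi> assume \<phi>: "killing_functional \<phi>"
  note f = killing_functional_functional[OF \<phi>]
  note ml = multilinear_functional_2[OF killing_functional_multilinear[OF \<phi>]]
  note inv = killing_functional_invariant[OF \<phi>]
  show "\<phi> (free_extend koszul_gen (free_extend boundary_gen f)) = 0"
  proof (rule functional_eq_on_keys[OF functional_free_extend[OF functional_free_extend[OF f]] functional_zero_fun])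
    fix xs assume "xs \<in> Poly_Mapping.keys f"
    then have "length xs = 4"
      using assms by (auto simp: free_lists_def)
    then obtain x y z w where xs: "xs = [x, y, z, w]"
      unfolding length_eq_4_iff by blast
    let ?B = "\<lambda>x y. \<phi> (gen [x, y])"
    have sy: "?B x y = ?B y x" for x y
      by (rule killing_functional_sym[OF \<phi>])
    have add: "?B a (b + c) = ?B a b + ?B a c" for a b c
      by (rule ml)
    have "?B x (bracket y (bracket z w) + bracket z (bracket w y) + bracket w (bracket y z)) = 0"
      using ml(4)[of x 0 0] by (simp add: jacobi)
    then have j: "?B (bracket x y) (bracket z w) + ?B (bracket x z) (bracket w y)
        + ?B (bracket x w) (bracket y z) = 0"
      by (simp add: add inv)
    have n: "?B a (bracket w y) = - ?B a (bracket y w)" for a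
      using ml(4)[of a "-1" "bracket y w"] bracket_skew[of w y] by simp
    have "\<phi> (free_extend koszul_gen (free_extend boundary_gen (gen xs))) =
      - 2 * (?B (bracket x y) (bracket z w) - ?B (bracket x z) (bracket y w)
        + ?B (bracket x w) (bracket y z))"
      unfolding xs free_extend_gen boundary_gen_4
      by (simp add: free_extend_add free_extend_diff free_extend_uminus
          functional_add[OF f] functional_diff[OF f] functional_uminus[OF f]
          sy[of "bracket y z" "bracket x w"] sy[of "bracket y w" "bracket x z"]
          sy[of "bracket z w" "bracket x y"] algebra_simps)
    also have "\<dots> = 0"
      using j by (simp add: n)
    finally show "\<phi> (free_extend koszul_gen (free_extend boundary_gen (gen xs))) = 0" .
  qed
qed

section \<open>Evaluation of the Killing and Koszul maps on cosets\<close>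

lemma killing_map_coset: "killing_map (f +o tensor_rel 3) = free_extend killing_gen f +o sym_rel 2"
proof -
  have *: "free_extend killing_gen g \<in> sym_rel 2" if "g \<in> tensor_rel 3" for g
  proof (subst free.mem_subspace_iff_functional[OF subspace_sym_rel], intro allI impI)
    fix \<phi> assume \<phi>: "functional free_scale \<phi>" "\<forall>s\<in>sym_rel 2. \<phi> s = 0"
    then have "sym_functional 2 \<phi>"
      by (simp add: sym_functional_iff)
    then have "multilinear_functional 2 \<phi>"
      by (simp add: sym_functional_def)
    note ml = multilinear_functional_2[OF this]
    have k: "\<phi> (free_extend killing_gen (gen [x, y, z])) =
        \<phi> (gen [bracket x y, z]) - \<phi> (gen [x, bracket y z])" for x y z
      by (simp add: functional_diff[OF \<phi>(1)])
    have "multilinear_functional 3 (\<lambda>f. \<phi> (free_extend killing_gen f))"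
    proof (rule multilinear_functionalI[OF functional_free_extend[OF \<phi>(1)]])
      fix us vs :: "'g list" and c x y
      assume "length us + 1 + length vs = 3"
      then show "\<phi> (free_extend killing_gen (gen (us @ (x + y) # vs))) =
        \<phi> (free_extend killing_gen (gen (us @ x # vs))) + \<phi> (free_extend killing_gen (gen (us @ y # vs)))"
        and "\<phi> (free_extend killing_gen (gen (us @ scale c x # vs))) =
          c * \<phi> (free_extend killing_gen (gen (us @ x # vs)))"
        by (cases rule: length_split_3; simp only: append.simps k ml bracket_simps; simp add: algebra_simps)+
    qed
    then show "\<phi> (free_extend killing_gen g) = 0"
      using free.functional_vanishes_on_span[of "\<lambda>f. \<phi> (free_extend killing_gen f)" "multilinear_gens 3" g] that
      by (simp add: multilinear_functional_def tensor_rel_def)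
  qed
  show ?thesis
    unfolding killing_map_def
  proof (rule induced_eq[of f])
    show "f \<in> f +o tensor_rel 3"
      using set_plus_intro2[OF free.subspace_0[OF subspace_tensor_rel], of f] by simp
    fix g assume "g \<in> f +o tensor_rel 3"
    then have "g - f \<in> tensor_rel 3"
      by (rule set_plus_imp_minus)
    then show "free_extend killing_gen g +o sym_rel 2 = free_extend killing_gen f +o sym_rel 2"
      using *[of "g - f"] by (simp add: coset_eq_iff free_extend_diff)
  qed
qed

lemma killing_rel_eq: "killing_rel = (\<lambda>f. free_extend killing_gen f +o sym_rel 2) ` free_lists 3"
  unfolding killing_rel_def tensor_power_def quot_space_def image_image killing_map_coset ..

lemma mem_elt_set_plus_iff: "C \<in> a +o S \<longleftrightarrow> (\<exists>b\<in>S. C = a + b)"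
  by (simp add: elt_set_plus_def)

lemma mem_coset_killing_rel:
  "C \<in> (g +o sym_rel 2) +o killing_rel \<longleftrightarrow>
     (\<exists>f\<in>free_lists 3. C = (g + free_extend killing_gen f) +o sym_rel 2)"
  unfolding mem_elt_set_plus_iff[of C] by (simp add: killing_rel_eq coset_plus_coset)

lemma coset_killing_rel_eq:
  assumes "g - h \<in> killing_zero"
  shows "(g +o sym_rel 2) +o killing_rel \<subseteq> (h +o sym_rel 2) +o killing_rel"
proof
  fix C assume "C \<in> (g +o sym_rel 2) +o killing_rel"
  then obtain f where f: "f \<in> free_lists 3" "C = (g + free_extend killing_gen f) +o sym_rel 2"
    by (auto simp: mem_coset_killing_rel)
  obtain e where e: "e \<in> free_lists 3" "g - h - free_extend killing_gen e \<in> sym_rel 2"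
    using assms by (auto simp: killing_zero_def)
  have "C = (h + free_extend killing_gen (e + f)) +o sym_rel 2"
    unfolding f(2) coset_eq_iff[OF subspace_sym_rel] using e(2) by (simp add: free_extend_add algebra_simps)
  then show "C \<in> (h +o sym_rel 2) +o killing_rel"
    unfolding mem_coset_killing_rel using e(1) f(1) free.subspace_add[OF subspace_free_lists] by blast
qed

lemma coset_killing_rel_iff:
  "(g +o sym_rel 2) +o killing_rel = (h +o sym_rel 2) +o killing_rel \<longleftrightarrow> g - h \<in> killing_zero"
proof
  assume "(g +o sym_rel 2) +o killing_rel = (h +o sym_rel 2) +o killing_rel"
  moreover have "g +o sym_rel 2 \<in> (g +o sym_rel 2) +o killing_rel"
    unfolding mem_coset_killing_rel
    by (rule bexI[of _ 0]) (simp_all add: free.subspace_0[OF subspace_free_lists])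
  ultimately have "g +o sym_rel 2 \<in> (h +o sym_rel 2) +o killing_rel"
    by simp
  then obtain f where "f \<in> free_lists 3" "g +o sym_rel 2 = (h + free_extend killing_gen f) +o sym_rel 2"
    by (auto simp: mem_coset_killing_rel)
  then show "g - h \<in> killing_zero"
    by (auto simp: coset_eq_iff killing_zero_def diff_diff_eq)
next
  assume gh: "g - h \<in> killing_zero"
  then have "h - g \<in> killing_zero"
    using free.subspace_neg[OF subspace_killing_zero gh] by simp
  with gh show "(g +o sym_rel 2) +o killing_rel = (h +o sym_rel 2) +o killing_rel"
    using coset_killing_rel_eq by blast
qed

lemma coset_zero_killing_rel: "sym_rel 2 +o killing_rel = killing_rel"
  using mem_coset_killing_rel[of _ 0] by (auto simp: killing_rel_eq)

lemma mem_coset_self: "free.subspace R \<Longrightarrow> f \<in> f +o R"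
  using set_plus_intro2[OF free.subspace_0, of R f] by simp

lemma koszul_coset: "koszul (f +o ext_rel 3) = (free_extend koszul_gen f +o sym_rel 2) +o killing_rel"
  unfolding koszul_def
proof (rule induced_eq[of f])
  fix g assume "g \<in> f +o ext_rel 3"
  then show "(free_extend koszul_gen g +o sym_rel 2) +o killing_rel =
      (free_extend koszul_gen f +o sym_rel 2) +o killing_rel"
    using koszul_ext_rel[OF set_plus_imp_minus] by (auto simp: coset_killing_rel_iff free_extend_diff)
qed (simp add: mem_coset_self)

lemma boundary_coset:
  assumes "\<And>g. g \<in> ext_rel n \<Longrightarrow> free_extend boundary_gen g \<in> ext_rel (n - 1)"
  shows "boundary n (f +o ext_rel n) = free_extend boundary_gen f +o ext_rel (n - 1)"
  unfolding boundary_def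
proof (rule induced_eq[of f])
  fix g assume "g \<in> f +o ext_rel n"
  then show "free_extend boundary_gen g +o ext_rel (n - 1) = free_extend boundary_gen f +o ext_rel (n - 1)"
    using assms[OF set_plus_imp_minus] by (auto simp: coset_eq_iff free_extend_diff)
qed (simp add: mem_coset_self)

text \<open>Adding a 3-boundary changes the Koszul image by an element of
  \<open>killing_zero\<close>, so the Koszul map is constant on a homology class.\<close>

lemma reduced_koszul_coset:
  "reduced_koszul ((f +o ext_rel 3) +o boundaries 3) =
     (free_extend koszul_gen f +o sym_rel 2) +o killing_rel"
proof -
  have b: "boundaries 3 = (\<lambda>g. free_extend boundary_gen g +o ext_rel 3) ` free_lists 4"
    unfolding boundaries_def ext_power_def quot_space_def image_image
    using boundary_coset[of 4] boundary_ext_rel_4 by simp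
  have "koszul C = koszul (f +o ext_rel 3)" if C: "C \<in> (f +o ext_rel 3) +o boundaries 3" for C
  proof -
    obtain g where g: "g \<in> free_lists 4" "C = (f + free_extend boundary_gen g) +o ext_rel 3"
      using C unfolding mem_elt_set_plus_iff[of C] by (auto simp: b coset_plus_coset)
    then show ?thesis
      using koszul_boundary[OF g(1)] by (simp add: koszul_coset coset_killing_rel_iff free_extend_add)
  qed
  moreover have "f +o ext_rel 3 \<in> (f +o ext_rel 3) +o boundaries 3"
  proof -
    have "free_extend boundary_gen 0 +o ext_rel 3 \<in> boundaries 3"
      unfolding b by (rule imageI) (simp add: free.subspace_0[OF subspace_free_lists])
    from set_plus_intro2[OF this, of "f +o ext_rel 3"] show ?thesis
      using coset_plus_coset[OF subspace_ext_rel[of 3], where a = f and b = 0] by simp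
  qed
  ultimately show ?thesis
    unfolding reduced_koszul_def by (subst induced_eq) (auto simp: koszul_coset)
qed

text \<open>Removes all layers of cosets: both directions of the duality work with a chain in the
  free space.\<close>

lemma reduced_koszul_nonzero_iff:
  "reduced_koszul_nonzero \<longleftrightarrow> (\<exists>f\<in>free_lists 3.
     free_extend boundary_gen f \<in> ext_rel 2 \<and> free_extend koszul_gen f \<notin> killing_zero)"
proof -
  have "boundary 3 (f +o ext_rel 3) = ext_rel 2 \<longleftrightarrow> free_extend boundary_gen f \<in> ext_rel 2" for f
    using boundary_coset[of 3 f] boundary_ext_rel_3 coset_eq_iff[OF subspace_ext_rel, of "free_extend boundary_gen f" 2 0]
    by simp
  then have c: "cycles 3 = (\<lambda>f. f +o ext_rel 3) ` {f \<in> free_lists 3. free_extend boundary_gen f \<in> ext_rel 2}"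
    unfolding cycles_def ext_power_def quot_space_def by auto
  have "(free_extend koszul_gen f +o sym_rel 2) +o killing_rel \<noteq> killing_rel \<longleftrightarrow>
      free_extend koszul_gen f \<notin> killing_zero" for f
    using coset_killing_rel_iff[of "free_extend koszul_gen f" 0] by (simp add: coset_zero_killing_rel)
  then show ?thesis
    unfolding reduced_koszul_nonzero_def homology_def quot_space_def c
    by (auto simp: reduced_koszul_coset)
qed

definition invariant_form :: "('g \<Rightarrow> 'g \<Rightarrow> 'k) \<Rightarrow> bool" where
  "invariant_form B \<longleftrightarrow> bilinear_form scale B \<and> (\<forall>x y. B x y = B y x) \<and>
     (\<forall>x y z. B (bracket x y) z = B x (bracket y z))"

text \<open>Up to sign the condition says that \<open>\<eta>\<close> is the Chevalley-Eilenberg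
  differential of \<alpha>, arranged as a cyclic sum.\<close>

definition coboundary :: "('g \<Rightarrow> 'g \<Rightarrow> 'g \<Rightarrow> 'k) \<Rightarrow> bool" where
  "coboundary \<eta> \<longleftrightarrow> (\<exists>\<alpha>. bilinear_form scale \<alpha> \<and> (\<forall>x. \<alpha> x x = 0) \<and>
     (\<forall>x y z. \<eta> x y z = \<alpha> (bracket x y) z + \<alpha> (bracket y z) x + \<alpha> (bracket z x) y))"

lemma multilinear_functional_lin_ext:
  assumes B: "bilinear_form scale B"
  shows "multilinear_functional 2 (lin_ext (\<lambda>xs. B (xs ! 0) (xs ! 1)))"
proof (rule multilinear_functionalI[OF functional_lin_ext])
  fix us vs :: "'g list" and c x y
  assume "length us + 1 + length vs = 2"
  then consider a where "us = []" "vs = [a]" | a where "us = [a]" "vs = []"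
    by (cases us) (auto simp: length_Suc_conv)
  then show "lin_ext (\<lambda>xs. B (xs ! 0) (xs ! 1)) (gen (us @ (x + y) # vs)) =
    lin_ext (\<lambda>xs. B (xs ! 0) (xs ! 1)) (gen (us @ x # vs)) + lin_ext (\<lambda>xs. B (xs ! 0) (xs ! 1)) (gen (us @ y # vs))"
    and "lin_ext (\<lambda>xs. B (xs ! 0) (xs ! 1)) (gen (us @ scale c x # vs)) =
        c * lin_ext (\<lambda>xs. B (xs ! 0) (xs ! 1)) (gen (us @ x # vs))"
    by (cases; simp add: bilinear_formD[OF B])+
qed

lemma killing_functional_lin_ext:
  assumes "invariant_form B"
  shows "killing_functional (lin_ext (\<lambda>xs. B (xs ! 0) (xs ! 1)))"
proof -
  have B: "bilinear_form scale B" and sy: "\<And>x y. B x y = B y x"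
    and inv: "\<And>x y z. B (bracket x y) z = B x (bracket y z)"
    using assms unfolding invariant_form_def by blast+
  let ?A = "lin_ext (\<lambda>xs. B (xs ! 0) (xs ! 1))"
  have 1: "?A (gen xs) = ?A (gen ys)"
    if l: "length xs = 2" "length ys = 2" and m: "mset xs = mset ys" for xs ys
  proof -
    obtain a b c d where "xs = [a, b]" "ys = [c, d]"
      using l unfolding length_eq_2_iff by blast
    then show ?thesis
      using m sy[of a b] by (auto simp: add_eq_conv_ex)
  qed
  have 2: "?A (gen [bracket x y, z]) = ?A (gen [x, bracket y z])" for x y z
    by (simp add: inv)
  show ?thesis
    unfolding killing_functional_def sym_functional_def
    by (intro conjI allI impI multilinear_functional_lin_ext B 1 2)
qed

text \<open>If \<alpha> is a primitive, the value of B on the Koszul image of a chain is minus the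
  value of \<alpha> on its boundary, hence zero for a cycle. A form that separates the image of a
  cycle from zero therefore has no primitive.\<close>

lemma reduced_koszul_nonzeroD:
  assumes reduced_koszul_nonzero
  obtains B where "invariant_form B" "\<not> coboundary (\<lambda>x y z. B (bracket x y) z)"
proof -
  obtain f where f: "f \<in> free_lists 3" "free_extend boundary_gen f \<in> ext_rel 2"
      "free_extend koszul_gen f \<notin> killing_zero"
    using assms by (auto simp: reduced_koszul_nonzero_iff)
  obtain \<phi> where \<phi>: "killing_functional \<phi>" "\<phi> (free_extend koszul_gen f) \<noteq> 0"
    using f(3) unfolding killing_zero_mem_iff by blast
  note ml = multilinear_functional_2[OF killing_functional_multilinear[OF \<phi>(1)]]
  define B where "B = (\<lambda>x y. \<phi> (gen [x, y]))"
  have B: "invariant_form B"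
    unfolding invariant_form_def bilinear_form_def functional_def B_def
    using killing_functional_sym[OF \<phi>(1)] killing_functional_invariant[OF \<phi>(1)]
    by (intro conjI allI) (assumption | rule ml)+
  moreover have "\<not> coboundary (\<lambda>x y z. B (bracket x y) z)"
  proof
    assume "coboundary (\<lambda>x y z. B (bracket x y) z)"
    then obtain \<alpha> where \<alpha>: "bilinear_form scale \<alpha>" "\<And>x. \<alpha> x x = 0"
        "\<And>x y z. B (bracket x y) z = \<alpha> (bracket x y) z + \<alpha> (bracket y z) x + \<alpha> (bracket z x) y"
      unfolding coboundary_def by blast
    define A where "A = lin_ext (\<lambda>xs. \<alpha> (xs ! 0) (xs ! 1))"
    have fA: "functional free_scale A" and A: "A (gen [x, y]) = \<alpha> x y" for x y
      by (simp_all add: A_def functional_lin_ext)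
    have "ext_functional 2 A"
      unfolding ext_functional_def using multilinear_functional_lin_ext[OF \<alpha>(1)]
      by (auto simp: length_eq_2_iff \<alpha>(2) A_def)
    then have "A (free_extend boundary_gen f) = 0"
      using f(2) by (simp add: ext_functional_iff)
    moreover have "\<phi> (free_extend koszul_gen f) = A (- free_extend boundary_gen f)"
      unfolding free_extend_uminus[symmetric]
    proof -
      have 1: "functional free_scale (\<lambda>f. A (free_extend (\<lambda>a. - boundary_gen a) f))"
        by (rule functional_free_extend[OF fA])
      have "\<phi> (free_extend koszul_gen f) = A (free_extend (\<lambda>a. - boundary_gen a) f)"
      proof (rule functional_eq_on_keys[OF functional_free_extend[OF killing_functional_functional[OF \<phi>(1)]] 1])
        fix xs assume "xs \<in> Poly_Mapping.keys f"
        then have "length xs = 3"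
          using f(1) by (auto simp: free_lists_def)
        then obtain x y z where xs: "xs = [x, y, z]"
          unfolding length_eq_3_iff by blast
        have "B x (bracket y z) = \<alpha> (bracket x y) z + \<alpha> (bracket y z) x - \<alpha> (bracket x z) y"
          using \<alpha>(3)[of x y z] killing_functional_invariant[OF \<phi>(1), of x y z] bracket_skew[of z x]
          by (simp add: B_def bilinear_formD[OF \<alpha>(1)])
        then show "\<phi> (free_extend koszul_gen (gen xs)) = A (free_extend (\<lambda>a. - boundary_gen a) (gen xs))"
          by (simp add: xs boundary_gen_3 B_def A functional_add[OF fA] functional_diff[OF fA]
              functional_uminus[OF fA])
      qed
      moreover have "free_extend (\<lambda>a. - boundary_gen a) f = free_extend boundary_gen (- f)"
        by (simp add: free_extend_uminus) (simp add: free_extend_def sum_negf)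
      ultimately show "\<phi> (free_extend koszul_gen f) = A (free_extend boundary_gen (- f))"
        by simp
    qed
    ultimately show False
      using \<phi>(2) by (simp add: functional_uminus[OF fA])
  qed
  ultimately show thesis
    by (rule that)
qed

text \<open>The direction for the example: the form is given, and pairing it with one explicit cycle
  exhibits a nonzero class.\<close>

lemma reduced_koszul_nonzeroI:
  assumes "invariant_form B" "f \<in> free_lists 3" "free_extend boundary_gen f \<in> ext_rel 2"
    "lin_ext (\<lambda>xs. B (xs ! 0) (xs ! 1)) (free_extend koszul_gen f) \<noteq> 0"
  shows reduced_koszul_nonzero
  unfolding reduced_koszul_nonzero_iff killing_zero_mem_iff
  using assms killing_functional_lin_ext by blast

end

section \<open>A nine-dimensional example\<close>

text \<open>The coordinates \<open>0, \<dots>, 8\<close> belong to the basis \<open>u, v, e\<^sub>1, f\<^sub>1, e\<^sub>2, f\<^sub>2, b, u\<^sup>*, v\<^sup>*\<close>.\<close>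

definition ex_bracket :: "'k::field ^ 9 \<Rightarrow> 'k ^ 9 \<Rightarrow> 'k ^ 9" where
  "ex_bracket x y = (\<chi> i.
     if i = 2 then x$0 * y$2 - x$2 * y$0
     else if i = 3 then x$3 * y$0 - x$0 * y$3
     else if i = 4 then x$1 * y$4 - x$4 * y$1
     else if i = 5 then x$5 * y$1 - x$1 * y$5
     else if i = 6 then x$0 * y$1 - x$1 * y$0
     else if i = 7 then (x$1 * y$6 - x$6 * y$1) + (x$2 * y$3 - x$3 * y$2)
     else if i = 8 then (x$6 * y$0 - x$0 * y$6) + (x$4 * y$5 - x$5 * y$4)
     else 0)"

text \<open>Pairs u with \<open>u\<^sup>*\<close>, v with \<open>v\<^sup>*\<close>,
  \<open>e\<^sub>i\<close> with \<open>f\<^sub>i\<close>, and b with itself. The bracket above is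
  determined by requiring that \<open>ex_form (ex_bracket x y) z\<close> be the three-form \<omega>
  of the example.\<close>

definition ex_form :: "'k::field ^ 9 \<Rightarrow> 'k ^ 9 \<Rightarrow> 'k" where
  "ex_form x y = x$0 * y$7 + x$7 * y$0 + x$1 * y$8 + x$8 * y$1 +
     x$2 * y$3 + x$3 * y$2 + x$4 * y$5 + x$5 * y$4 + x$6 * y$6"

lemma ex_bracket_nth:
  "ex_bracket x y $ 0 = 0" "ex_bracket x y $ 1 = 0"
  "ex_bracket x y $ 2 = x$0 * y$2 - x$2 * y$0"
  "ex_bracket x y $ 3 = x$3 * y$0 - x$0 * y$3"
  "ex_bracket x y $ 4 = x$1 * y$4 - x$4 * y$1"
  "ex_bracket x y $ 5 = x$5 * y$1 - x$1 * y$5"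
  "ex_bracket x y $ 6 = x$0 * y$1 - x$1 * y$0"
  "ex_bracket x y $ 7 = (x$1 * y$6 - x$6 * y$1) + (x$2 * y$3 - x$3 * y$2)"
  "ex_bracket x y $ 8 = (x$6 * y$0 - x$0 * y$6) + (x$4 * y$5 - x$5 * y$4)"
  by (simp_all add: ex_bracket_def)

lemma ex_bracket_nth_other:
  "\<lbrakk>i \<noteq> 2; i \<noteq> 3; i \<noteq> 4; i \<noteq> 5; i \<noteq> 6; i \<noteq> 7; i \<noteq> 8\<rbrakk> \<Longrightarrow> ex_bracket x y $ i = 0"
  by (simp add: ex_bracket_def)

interpretation ex: lie_algebra "(*s) :: 'k::field \<Rightarrow> 'k ^ 9 \<Rightarrow> 'k ^ 9" ex_bracket
proof unfold_locales
  fix x y z :: "'k ^ 9"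
  show "ex_bracket x x = 0"
    by (simp add: vec_eq_iff ex_bracket_def)
  show "ex_bracket x (ex_bracket y z) + ex_bracket y (ex_bracket z x) + ex_bracket z (ex_bracket x y) = 0"
    (is "?J = 0")
    unfolding vec_eq_iff
  proof
    fix i :: 9
    \<comment> \<open>The last case covers the coordinates of u and v, which vanish in every
      bracket.\<close>
    consider "i = 2" | "i = 3" | "i = 4" | "i = 5" | "i = 6" | "i = 7" | "i = 8"
      | "i \<noteq> 2" "i \<noteq> 3" "i \<noteq> 4" "i \<noteq> 5" "i \<noteq> 6" "i \<noteq> 7" "i \<noteq> 8"
      by blast
    then show "?J $ i = 0 $ i"
      by cases (simp_all add: ex_bracket_nth ex_bracket_nth_other algebra_simps)
  qed
qed (simp_all add: vec_eq_iff ex_bracket_def algebra_simps)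

lemma ex_derived_1: "x \<in> ex.derived 1 \<Longrightarrow> x $ 0 = 0 \<and> x $ 1 = 0"
  unfolding One_nat_def ex.derived.simps ex.bracket_span_def
  by (induction rule: vec.span_induct_alt) (auto simp: ex_bracket_nth)

text \<open>Elements of the derived algebra have no u and v components, and the bracket of two such
  vectors only has \<open>u\<^sup>*\<close> and \<open>v\<^sup>*\<close> components. These
  directions are central.\<close>

lemma ex_derived_2:
  assumes "x \<in> ex.derived 2"
  shows "x $ i = 0 \<or> i = 7 \<or> i = 8"
proof -
  have "x \<in> vec.span {ex_bracket a b | a b. a \<in> ex.derived 1 \<and> b \<in> ex.derived 1}"
    using assms by (simp add: numeral_2_eq_2 ex.bracket_span_def)
  then show ?thesis
  proof (induction rule: vec.span_induct_alt)
    case (step c a b)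
    then obtain p q where "a = ex_bracket p q" "p \<in> ex.derived 1" "q \<in> ex.derived 1"
      by blast
    then have "i \<noteq> 7 \<and> i \<noteq> 8 \<longrightarrow> a $ i = 0"
      using ex_derived_1[of p] ex_derived_1[of q] by (auto simp: ex_bracket_def)
    with step.IH show ?case
      by auto
  qed simp
qed

lemma ex_bracket_derived_2: "y \<in> ex.derived 2 \<Longrightarrow> ex_bracket x y = 0"
  using ex_derived_2[of y 0] ex_derived_2[of y 1] ex_derived_2[of y 2] ex_derived_2[of y 3]
    ex_derived_2[of y 4] ex_derived_2[of y 5] ex_derived_2[of y 6]
  by (simp add: vec_eq_iff ex_bracket_def)

lemma span_eq_zero: "S \<subseteq> {0} \<Longrightarrow> vec.span S = {0}"
  using vec.span_mono[of S "{0}"] vec.span_zero[of S] by auto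

lemma ex_center_by_metabelian:
  "lie_algebra.center_by_metabelian (*s) (ex_bracket :: 'k::field ^ 9 \<Rightarrow> _)"
  unfolding ex.center_by_metabelian_def ex.bracket_span_def
  by (rule span_eq_zero) (auto simp: ex_bracket_derived_2)

lemma ex_three_solvable:
  "lie_algebra.three_solvable (*s) (ex_bracket :: 'k::field ^ 9 \<Rightarrow> _)"
  unfolding ex.three_solvable_def numeral_3_eq_3 ex.derived.simps(2)[of "Suc (Suc 0)"] ex.bracket_span_def
  by (rule span_eq_zero) (auto simp: ex_bracket_derived_2 numeral_2_eq_2)

lemma ex_invariant_form: "ex.invariant_form ex_form"
  unfolding ex.invariant_form_def bilinear_form_def functional_def
  by (simp add: ex_form_def ex_bracket_nth algebra_simps)

lemma ex_brackets:
  "ex_bracket (axis 0 1) (axis 1 1) = axis 6 1"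
  "ex_bracket (axis 0 1) (axis 6 1) = - axis 8 1"
  "ex_bracket (axis 1 1) (axis 6 1) = axis 7 1"
  "ex_bracket (axis 0 1) (axis 2 1) = axis 2 1"
  "ex_bracket (axis 0 1) (axis 3 1) = - axis 3 1"
  "ex_bracket (axis 2 1) (axis 3 1) = axis 7 1"
  "ex_bracket (axis 1 1) (axis 4 1) = axis 4 1"
  "ex_bracket (axis 1 1) (axis 5 1) = - axis 5 1"
  "ex_bracket (axis 4 1) (axis 5 1) = axis 8 1"
  by (auto simp: vec_eq_iff ex_bracket_def axis_def)

lemma ex_reduced_koszul_nonzero:
  "lie_algebra.reduced_koszul_nonzero (*s) (ex_bracket :: 'k::field ^ 9 \<Rightarrow> _)"
proof -
  let ?e = "\<lambda>i. axis i 1 :: 'k ^ 9"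
  \<comment> \<open>The boundary of the first monomial is the sum of -\<open>u\<^sup>*\<close>
    \<and> u and -\<open>v\<^sup>*\<close> \<and> v. These are the boundaries of the other two
    monomials, because the terms in \<open>e\<^sub>i\<close> and \<open>f\<^sub>i\<close>
    cancel.\<close>
  let ?f = "gen [?e 0, ?e 1, ?e 6] - gen [?e 0, ?e 2, ?e 3] - gen [?e 1, ?e 4, ?e 5]
    :: ('k ^ 9) list \<Rightarrow>\<^sub>0 'k"
  have "?f \<in> ex.free_lists 3"
    by (intro free.subspace_diff[OF ex.subspace_free_lists] ex.gen_free_lists) simp_all
  moreover have "free_extend ex.boundary_gen ?f \<in> ex.ext_rel 2"
    unfolding ex.ext_rel_mem_iff
  proof (intro allI impI)
    fix \<phi> :: "(('k ^ 9) list \<Rightarrow>\<^sub>0 'k) \<Rightarrow> 'k"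
    assume \<phi>: "ex.ext_functional 2 \<phi>"
    note f = ex.ext_functional_functional[OF \<phi>]
    note ml = ex.multilinear_functional_2[OF ex.ext_functional_multilinear[OF \<phi>]]
    have n: "\<phi> (gen [- x, y]) = - \<phi> (gen [x, y])" for x y
      using ml(3)[of "- 1" x y] by simp
    have r: "\<phi> (gen [x, x]) = 0" for x
      by (rule ex.ext_functional_repeated[OF \<phi>]) auto
    show "\<phi> (free_extend ex.boundary_gen ?f) = 0"
      by (simp add: free_extend_diff ex.boundary_gen_3 ex_brackets functional_add[OF f]
          functional_diff[OF f] functional_uminus[OF f] n r ex.ext_functional_2_skew[OF \<phi>, of "?e 2" "?e 3"]
          ex.ext_functional_2_skew[OF \<phi>, of "?e 4" "?e 5"])
  qed
  \<comment> \<open>Each of the three monomials has value 1, so the total is 1 - 1 - 1 = -1, which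
    is nonzero in every field.\<close>
  moreover have "lin_ext (\<lambda>xs. ex_form (xs ! 0) (xs ! 1)) (free_extend ex.koszul_gen ?f) \<noteq> 0"
    unfolding free_extend_diff free_extend_gen functional_diff[OF functional_lin_ext]
    by (simp add: ex_brackets) (simp add: ex_form_def axis_def)
  ultimately show ?thesis
    by (rule ex.reduced_koszul_nonzeroI[OF ex_invariant_form])
qed

section \<open>Metric Lie algebras\<close>

locale metric_lie_algebra =
  lie_algebra scale bracket + finite_dimensional_vector_space scale Basis
  for scale :: "'k::field \<Rightarrow> 'g::ab_group_add \<Rightarrow> 'g" and bracket and Basis +
  fixes B :: "'g \<Rightarrow> 'g \<Rightarrow> 'k"
  assumes invariant: "invariant_form B"
    and nondegenerate: "(\<And>y. B x y = 0) \<Longrightarrow> x = 0"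
begin

lemma form_bilinear: "bilinear_form scale B"
  using invariant unfolding invariant_form_def by blast

lemma form_sym: "B x y = B y x"
  using invariant unfolding invariant_form_def by blast

lemma form_invariant: "B (bracket x y) z = B x (bracket y z)"
  using invariant unfolding invariant_form_def by blast

lemmas form_simps = bilinear_formD[OF form_bilinear]

definition \<omega> :: "'g \<Rightarrow> 'g \<Rightarrow> 'g \<Rightarrow> 'k" where
  "\<omega> x y z = B (bracket x y) z"

lemma \<omega>_simps:
  "\<omega> (x + y) a b = \<omega> x a b + \<omega> y a b" "\<omega> a (x + y) b = \<omega> a x b + \<omega> a y b"
  "\<omega> a b (x + y) = \<omega> a b x + \<omega> a b y"
  "\<omega> (x - y) a b = \<omega> x a b - \<omega> y a b" "\<omega> a (x - y) b = \<omega> a x b - \<omega> a y b"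
  "\<omega> a b (x - y) = \<omega> a b x - \<omega> a b y"
  "\<omega> (- x) a b = - \<omega> x a b" "\<omega> a (- x) b = - \<omega> a x b" "\<omega> a b (- x) = - \<omega> a b x"
  "\<omega> (scale c x) a b = c * \<omega> x a b" "\<omega> a (scale c x) b = c * \<omega> a x b"
  "\<omega> a b (scale c x) = c * \<omega> a b x"
  "\<omega> 0 a b = 0" "\<omega> a 0 b = 0" "\<omega> a b 0 = 0"
  by (simp_all add: \<omega>_def bracket_simps form_simps)

lemma \<omega>_alt [simp]: "\<omega> x x y = 0" "\<omega> x y y = 0" "\<omega> x y x = 0"
proof -
  show 1: "\<omega> x x y = 0" for x y
    by (simp add: \<omega>_def alternating form_simps)
  show 2: "\<omega> x y y = 0" for x y
    by (simp add: \<omega>_def form_invariant alternating form_simps)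
  have "\<omega> x y x = - \<omega> y x x"
    by (simp add: \<omega>_def bracket_skew[of x y] form_simps)
  then show "\<omega> x y x = 0"
    by (simp add: 2)
qed

lemma \<omega>_swap12: "\<omega> y x z = - \<omega> x y z"
  by (simp add: \<omega>_def bracket_skew[of y x] form_simps)

lemma \<omega>_cyc: "\<omega> y z x = \<omega> x y z"
  by (metis \<omega>_def form_invariant form_sym)

lemma \<omega>_swap23: "\<omega> x z y = - \<omega> x y z"
  by (metis \<omega>_cyc \<omega>_swap12)

lemma form_bracket: "B x (bracket y z) = \<omega> x y z" "B (bracket y z) x = \<omega> y z x"
  by (simp_all add: \<omega>_def form_invariant)

text \<open>\<open>T\<close> records the values of \<open>B w\<close> on the basis. Nondegeneracy
  makes it injective, finite dimension makes it surjective, and a preimage of the values of \<phi>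
  represents \<phi>.\<close>

lemma functional_representable:
  assumes "functional scale \<phi>"
  obtains w where "\<And>x. \<phi> x = B w x"
proof -
  define T where "T w = (\<Sum>b\<in>Basis. scale (B w b) b)" for w
  interpret vector_space_pair scale scale ..
  have lin: "Vector_Spaces.linear scale scale T"
    unfolding Vector_Spaces.linear_iff T_def
    using vector_space_axioms
    by (simp add: form_simps scale_left_distrib sum.distrib scale_sum_right)
  \<comment> \<open>Coefficients are compared as total functions, so agreement outside
    \<open>Basis\<close> is an assumption; it is met below by padding with 0.\<close>
  have coeff: "f = g" if "(\<Sum>b\<in>Basis. scale (f b) b) = (\<Sum>b\<in>Basis. scale (g b) b)"
    "\<And>b. b \<notin> Basis \<Longrightarrow> f b = g b" for f g
  proof
    fix b
    have "(\<Sum>b\<in>Basis. scale (f b - g b) b) = 0"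
      using that(1) by (simp add: scale_left_diff_distrib sum_subtractf)
    then show "f b = g b"
      using independentD[OF independent_Basis finite_Basis order_refl, of "\<lambda>b. f b - g b" b] that(2)[of b]
      by (cases "b \<in> Basis") auto
  qed
  have eq: "functional scale \<psi> \<Longrightarrow> functional scale \<rho> \<Longrightarrow> (\<And>b. b \<in> Basis \<Longrightarrow> \<psi> b = \<rho> b) \<Longrightarrow> \<psi> x = \<rho> x"
    for \<psi> \<rho> x
    using functional_vanishes_on_span[of "\<lambda>x. \<psi> x - \<rho> x" Basis x] span_Basis
    by (auto simp: functional_def algebra_simps)
  have fB: "functional scale (B w)" for w
    using form_bilinear by (simp add: bilinear_form_def)
  have "inj T"
  proof (rule injI)
    fix v w assume "T v = T w"
    then have "(\<lambda>b. if b \<in> Basis then B v b else 0) = (\<lambda>b. if b \<in> Basis then B w b else 0)"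
      by (intro coeff) (auto simp: T_def cong: if_cong)
    then have vw: "B v b = B w b" if "b \<in> Basis" for b
      using that by (metis (mono_tags))
    have "B v x = B w x" for x
      by (rule eq[OF fB fB vw])
    then have "B (v - w) x = 0" for x
      by (simp add: form_simps)
    then show "v = w"
      using nondegenerate[of "v - w"] by simp
  qed
  then have "surj T"
    using linear_inj_imp_surj[OF lin] by blast
  then obtain w where "T w = (\<Sum>b\<in>Basis. scale (\<phi> b) b)"
    by (metis surjD)
  then have "(\<lambda>b. if b \<in> Basis then B w b else 0) = (\<lambda>b. if b \<in> Basis then \<phi> b else 0)"
    by (intro coeff) (auto simp: T_def cong: if_cong)
  then have "\<phi> b = B w b" if "b \<in> Basis" for b
    using that by (metis (mono_tags))
  then have "\<phi> x = B w x" for x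
    by (rule eq[OF assms fB])
  then show thesis
    by (rule that)
qed

lemma separating_vector:
  assumes "subspace S" "x \<notin> S"
  obtains w where "\<forall>s\<in>S. B w s = 0" "B w x = 1"
proof -
  obtain \<phi> where \<phi>: "functional scale \<phi>" "\<And>s. s \<in> S \<Longrightarrow> \<phi> s = 0" "\<phi> x = 1"
    using separating_functional[OF assms] by metis
  obtain w where "\<And>x. \<phi> x = B w x"
    using functional_representable[OF \<phi>(1)] by metis
  then show thesis
    using that \<phi>(2,3) by metis
qed

section \<open>Derived algebra and center as mutual orthogonals\<close>

definition A :: "'g set" where "A = bracket_span UNIV UNIV"

definition Z :: "'g set" where "Z = {x. \<forall>y. bracket x y = 0}"

lemma subspace_A: "subspace A"
  by (simp add: A_def bracket_span_def)

lemma subspace_Z: "subspace Z"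
  by (auto simp: Z_def bracket_simps intro!: subspaceI)

lemma bracket_mem_A [simp]: "bracket x y \<in> A"
  unfolding A_def bracket_span_def by (rule span_base) blast

lemma mem_Z_iff_\<omega>: "x \<in> Z \<longleftrightarrow> (\<forall>y z. \<omega> x y z = 0)"
  unfolding Z_def \<omega>_def using nondegenerate by (auto simp: form_simps)

lemma \<omega>_central [simp]:
  assumes "z \<in> Z"
  shows "\<omega> z x y = 0" "\<omega> x z y = 0" "\<omega> x y z = 0"
proof -
  show 0: "\<omega> z x y = 0" for x y
    using assms by (simp add: mem_Z_iff_\<omega>)
  then show "\<omega> x z y = 0" "\<omega> x y z = 0"
    using \<omega>_swap12[of x z y] \<omega>_cyc[of x y z] by (simp_all add: 0)
qed

lemma form_Z_A: "z \<in> Z \<Longrightarrow> a \<in> A \<Longrightarrow> B z a = 0"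
proof -
  assume z: "z \<in> Z" and a: "a \<in> A"
  have "functional scale (B z)"
    using form_bilinear by (simp add: bilinear_form_def)
  then show "B z a = 0"
    by (rule functional_vanishes_on_span[OF _ _ a[unfolded A_def bracket_span_def]])
      (use z in \<open>auto simp: form_bracket\<close>)
qed

lemma form_A_Z: "z \<in> Z \<Longrightarrow> a \<in> A \<Longrightarrow> B a z = 0"
  by (simp add: form_sym[of a] form_Z_A)

lemma mem_ZI: "(\<And>a. a \<in> A \<Longrightarrow> B x a = 0) \<Longrightarrow> x \<in> Z"
  by (simp add: mem_Z_iff_\<omega> flip: form_bracket)

text \<open>A vector that separates x from A is orthogonal to A, hence central, and cannot pair to 1
  with x.\<close>

lemma mem_AI:
  assumes "\<And>z. z \<in> Z \<Longrightarrow> B z x = 0"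
  shows "x \<in> A"
proof (rule ccontr)
  assume "x \<notin> A"
  then obtain w where "\<forall>s\<in>A. B w s = 0" "B w x = 1"
    using separating_vector[OF subspace_A] by metis
  then show False
    using assms[of w] mem_ZI[of w] by simp
qed

text \<open>A vector separating x from A + Z is orthogonal to A, hence in Z, and orthogonal to Z,
  hence in A; the assumption says that it pairs to 0 with x.\<close>

lemma mem_A_plus_Z:
  assumes "\<And>z. z \<in> Z \<Longrightarrow> z \<in> A \<Longrightarrow> B z x = 0"
  obtains a where "a \<in> A" "x - a \<in> Z"
proof -
  let ?S = "{a + z | a z. a \<in> A \<and> z \<in> Z}"
  have S: "subspace ?S"
    by (rule subspace_sums[OF subspace_A subspace_Z])
  have "x \<in> ?S"
  proof (rule ccontr)
    assume "x \<notin> ?S"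
    obtain w where w: "\<forall>s\<in>?S. B w s = 0" "B w x = 1"
      by (rule separating_vector[OF S \<open>x \<notin> ?S\<close>])
    have sum: "B w (a + z) = 0" if "a \<in> A" "z \<in> Z" for a z
      using w(1) that by blast
    have "B w a = 0" if "a \<in> A" for a
      using sum[OF that subspace_0[OF subspace_Z]] by simp
    then have "w \<in> Z"
      by (rule mem_ZI)
    have "B w z = 0" if "z \<in> Z" for z
      using sum[OF subspace_0[OF subspace_A] that] by simp
    then have "w \<in> A"
      by (intro mem_AI) (simp add: form_sym[of _ w])
    then show False
      using assms[OF \<open>w \<in> Z\<close>] w(2) by simp
  qed
  then obtain a z where "x = a + z" "a \<in> A" "z \<in> Z"
    by blast
  then show thesis
    using that[of a] by simp
qed

section \<open>Coboundaries from infinitesimal rotations\<close>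

definition wedge :: "('g \<Rightarrow> 'k) \<Rightarrow> ('g \<Rightarrow> 'g \<Rightarrow> 'k) \<Rightarrow> 'g \<Rightarrow> 'g \<Rightarrow> 'g \<Rightarrow> 'k" where
  "wedge \<phi> \<psi> x y z = \<phi> x * \<psi> y z + \<phi> y * \<psi> z x + \<phi> z * \<psi> x y"

lemma coboundary_add:
  assumes "coboundary \<eta>" "coboundary \<theta>"
  shows "coboundary (\<lambda>x y z. \<eta> x y z + \<theta> x y z)"
proof -
  obtain \<alpha> \<beta> where a: "bilinear_form scale \<alpha>" "\<forall>x. \<alpha> x x = 0"
     "\<forall>x y z. \<eta> x y z = \<alpha> (bracket x y) z + \<alpha> (bracket y z) x + \<alpha> (bracket z x) y"
     and b: "bilinear_form scale \<beta>" "\<forall>x. \<beta> x x = 0"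
     "\<forall>x y z. \<theta> x y z = \<beta> (bracket x y) z + \<beta> (bracket y z) x + \<beta> (bracket z x) y"
    using assms unfolding coboundary_def by blast
  show ?thesis
    unfolding coboundary_def
    by (rule exI[of _ "\<lambda>x y. \<alpha> x y + \<beta> x y"])
      (use a b in \<open>auto simp: bilinear_form_def functional_def algebra_simps\<close>)
qed

lemma coboundary_mult:
  assumes "coboundary \<eta>"
  shows "coboundary (\<lambda>x y z. c * \<eta> x y z)"
proof -
  obtain \<alpha> where a: "bilinear_form scale \<alpha>" "\<forall>x. \<alpha> x x = 0"
     "\<forall>x y z. \<eta> x y z = \<alpha> (bracket x y) z + \<alpha> (bracket y z) x + \<alpha> (bracket z x) y"
    using assms unfolding coboundary_def by blast
  show ?thesis
    unfolding coboundary_def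
    by (rule exI[of _ "\<lambda>x y. c * \<alpha> x y"])
      (use a in \<open>auto simp: bilinear_form_def functional_def algebra_simps\<close>)
qed

lemma coboundary_zero: "coboundary (\<lambda>x y z. 0)"
  unfolding coboundary_def
  by (rule exI[of _ "\<lambda>x y. 0"]) (simp add: bilinear_form_def functional_zero_fun)

text \<open>Up to sign, the action on \<open>\<omega>\<close> of the infinitesimal rotation \<open>x \<mapsto> B(a, x) b - B(b, x) a\<close>.\<close>

definition cob :: "'g \<Rightarrow> 'g \<Rightarrow> 'g \<Rightarrow> 'g \<Rightarrow> 'g \<Rightarrow> 'k" where
  "cob a b x y z = wedge (B a) (\<omega> b) x y z - wedge (B b) (\<omega> a) x y z"

lemma coboundary_cob: "coboundary (cob a b)"
  unfolding coboundary_def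
proof (rule exI[of _ "\<lambda>x y. B a y * B b x - B a x * B b y"], intro conjI allI)
  show "bilinear_form scale (\<lambda>x y. B a y * B b x - B a x * B b y)"
    by (simp add: bilinear_form_def functional_def form_simps algebra_simps)
qed (simp_all add: cob_def wedge_def form_bracket)

text \<open>The contraction of \<omega> with a central z vanishes, so one of the two terms of
  \<open>cob z t\<close> survives. These forms serve as corrections in all the explicit
  primitives.\<close>

lemma coboundary_central:
  assumes "z \<in> Z"
  shows "coboundary (wedge (B z) (\<omega> t))"
proof -
  have "cob z t = wedge (B z) (\<omega> t)"
    using assms by (simp add: fun_eq_iff cob_def wedge_def)
  then show ?thesis
    using coboundary_cob[of z t] by simp
qed

text \<open>A form that vanishes on the hyperplane orthogonal to z is divisible by
  \<open>B z\<close>: it equals \<open>wedge (B z) (\<omega> u)\<close> for any u with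
  \<open>B z u = 1\<close>.\<close>

lemma coboundary_\<omega>_decomposable:
  assumes "z \<in> Z" "z \<noteq> 0" "\<And>x y w. B z x = 0 \<Longrightarrow> B z y = 0 \<Longrightarrow> B z w = 0 \<Longrightarrow> \<omega> x y w = 0"
  shows "coboundary \<omega>"
proof -
  obtain v where "B z v \<noteq> 0"
    using assms(2) nondegenerate by blast
  then have "B z (scale (1 / B z v) v) = 1"
    by (simp add: form_simps)
  then obtain u where u: "B z u = 1"
    by blast
  have "\<omega> x y w = wedge (B z) (\<omega> u) x y w" for x y w
  proof -
    let ?p = "\<lambda>x. x - scale (B z x) u"
    have "B z (?p x) = 0" for x
      using u by (simp add: form_simps)
    then have "\<omega> (?p x) (?p y) (?p w) = 0"
      by (intro assms(3))
    then show ?thesis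
      by (simp add: \<omega>_simps wedge_def \<omega>_cyc[of u] \<omega>_cyc[of x y u] algebra_simps)
  qed
  then have "\<omega> = wedge (B z) (\<omega> u)"
    by (simp add: fun_eq_iff)
  then show ?thesis
    using coboundary_central[OF assms(1)] by metis
qed

end

text \<open>On a basis extending one of S, the map kills the vectors from S and fixes the
  others.\<close>

lemma (in vector_space) complement_projection:
  assumes "subspace S"
  obtains p where "\<And>x y. p (x + y) = p x + p y" "\<And>c x. p (scale c x) = scale c (p x)"
    "\<And>s. s \<in> S \<Longrightarrow> p s = 0" "\<And>x. x - p x \<in> S"
proof -
  interpret vector_space_pair scale scale ..
  obtain C where C: "C \<subseteq> S" "independent C" "S \<subseteq> span C"
    using maximal_independent_subset[of S] by auto
  have S: "span C = S"
    using C assms span_minimal by blast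
  let ?D = "extend_basis C"
  obtain p where p: "Vector_Spaces.linear scale scale p"
      "\<forall>x\<in>?D. p x = (if x \<in> C then 0 else x)"
    using linear_independent_extend[OF independent_extend_basis[OF C(2)], of "\<lambda>x. if x \<in> C then 0 else x"]
    by blast
  have add: "p (x + y) = p x + p y" and scale: "p (scale c x) = scale c (p x)" for x y c
    using p(1) unfolding Vector_Spaces.linear_iff by blast+
  have zero: "p 0 = 0"
    using add[of 0 0] by simp
  have CD: "C \<subseteq> ?D"
    by (rule extend_basis_superset[OF C(2)])
  have "p s = 0" if "s \<in> S" for s
    using that unfolding S[symmetric]
  proof (induction rule: span_induct_alt)
    case (step c x y)
    then show ?case
      using p(2) CD by (auto simp: add scale)
  qed (rule zero)
  moreover have "x - p x \<in> S" for x
  proof -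
    have "x \<in> span ?D"
      by (simp add: C(2))
    then show ?thesis
    proof (induction rule: span_induct_alt)
      case base
      then show ?case
        using subspace_0[OF assms] by (simp add: zero)
    next
      case (step c x y)
      have "x - p x \<in> S"
        using step(1) p(2) C(1) subspace_0[OF assms] by (cases "x \<in> C") auto
      then have "scale c (x - p x) + (y - p y) \<in> S"
        using step assms by (simp add: subspace_add subspace_scale)
      moreover have "scale c x + y - p (scale c x + y) = scale c (x - p x) + (y - p y)"
        by (simp add: add scale scale_right_diff_distrib)
      ultimately show ?case
        by metis
    qed
  qed
  ultimately show thesis
    using add scale by (rule_tac that)
qed

text \<open>Solvability enters as an identity between iterated brackets, a form that passes directly
  to the projected bracket in the final reduction.\<close>

locale metric_3solvable = metric_lie_algebra +
  assumes two: "(2::'a) \<noteq> 0" and three: "(3::'a) \<noteq> 0"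
    and solvable: "bracket (bracket (bracket a b) (bracket c d)) (bracket (bracket e f) (bracket g h)) = 0"
begin

text \<open>Let p be a projection along A and \<alpha>(x, y) = B(x, p y) - B(p x, y). As p kills
  brackets and alters vectors only by central ones, \<alpha>([x, y], z) is \<omega>(x, y, z), and
  the cyclic sum is 3 \<omega>.\<close>

lemma coboundary_\<omega>_two_step:
  assumes "A \<subseteq> Z"
  shows "coboundary \<omega>"
proof -
  obtain p where p: "\<And>x y. p (x + y) = p x + p y" "\<And>c x. p (scale c x) = scale c (p x)"
    "\<And>s. s \<in> A \<Longrightarrow> p s = 0" "\<And>x. x - p x \<in> A"
    using complement_projection[OF subspace_A] by blast
  have "\<omega> x y (w - p w) = 0" for x y w
    using assms p(4) by (metis \<omega>_central(3) subsetD)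
  then have e: "\<omega> x y (p w) = \<omega> x y w" for x y w
    by (simp add: \<omega>_simps)
  have "coboundary (\<lambda>x y w. 3 * \<omega> x y w)"
    unfolding coboundary_def
  proof (rule exI[of _ "\<lambda>x y. B x (p y) - B (p x) y"], intro conjI allI)
    show "bilinear_form scale (\<lambda>x y. B x (p y) - B (p x) y)"
      by (simp add: bilinear_form_def functional_def form_simps p algebra_simps)
    show "B x (p x) - B (p x) x = 0" for x
      by (simp add: form_sym)
    show "3 * \<omega> x y z = B (bracket x y) (p z) - B (p (bracket x y)) z +
        (B (bracket y z) (p x) - B (p (bracket y z)) x) + (B (bracket z x) (p y) - B (p (bracket z x)) y)" for x y z
      by (simp add: p(3) form_simps form_bracket e) (simp add: \<omega>_cyc[of y z x] \<omega>_cyc[of x y z])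
  qed
  from coboundary_mult[OF this, of "1/3"] show ?thesis
    using three by simp
qed

text \<open>Nondegeneracy of B on V, stated as the existence of orthogonal projections onto V. Such
  projections are corrected directly when a plane is split off.\<close>

definition nondeg_on :: "'b set \<Rightarrow> bool" where
  "nondeg_on V \<longleftrightarrow> subspace V \<and> (\<forall>x. \<exists>y\<in>V. \<forall>v\<in>V. B (x - y) v = 0)"

lemma subspace_perp: "subspace V \<Longrightarrow> subspace {y \<in> V. B w y = 0}"
  by (auto intro!: subspaceI simp: form_simps subspace_0 subspace_add subspace_scale)

lemma dim_perp_less:
  assumes "subspace V" "v \<in> V" "B w v \<noteq> 0"
  shows "dim {y \<in> V. B w y = 0} < dim V"
proof (rule dim_psubset)
  have "span {y \<in> V. B w y = 0} = {y \<in> V. B w y = 0}" "span V = V"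
    using assms(1) subspace_perp by (auto simp: span_eq_iff)
  moreover have "{y \<in> V. B w y = 0} \<subset> V"
    using assms(2,3) by auto
  ultimately show "span {y \<in> V. B w y = 0} \<subset> span V"
    by (simp only:)
qed

lemma hyperbolic_complement:
  assumes V: "nondeg_on V" and z: "z \<in> V" "z \<noteq> 0" "B z z = 0"
  obtains u where "u \<in> V" "B z u = 1" "B u u = 0"
    "nondeg_on {y \<in> V. B z y = 0 \<and> B u y = 0}" "dim {y \<in> V. B z y = 0 \<and> B u y = 0} + 2 \<le> dim V"
proof -
  have sub: "subspace V"
    using V by (simp add: nondeg_on_def)
  obtain v where v: "B z v \<noteq> 0"
    using z(2) nondegenerate by blast
  obtain v' where v': "v' \<in> V" "\<forall>w\<in>V. B (v - v') w = 0"
    using V unfolding nondeg_on_def by blast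
  then have "B z v' = B z v"
    using z(1) by (simp add: form_simps form_sym[of z])
  define u1 where "u1 = scale (1 / B z v) v'"
  have u1: "u1 \<in> V" "B z u1 = 1"
    using v v'(1) sub \<open>B z v' = B z v\<close> by (auto simp: u1_def form_simps subspace_scale)
  \<comment> \<open>Subtracting half of \<open>B u1 u1\<close> times the isotropic z makes u
    isotropic and keeps its pairing with z.\<close>
  define u where "u = u1 - scale (B u1 u1 / 2) z"
  have u: "u \<in> V" "B z u = 1" "B u u = 0"
    using u1 z sub two by (auto simp: u_def form_simps form_sym[of u1 z] subspace_diff subspace_scale)
  have eq: "{y \<in> V. B z y = 0 \<and> B u y = 0} = {y \<in> {y \<in> V. B z y = 0}. B u y = 0}"
    by auto
  have "dim {y \<in> V. B z y = 0} < dim V"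
    using u by (intro dim_perp_less[OF sub]) auto
  moreover have "dim {y \<in> {y \<in> V. B z y = 0}. B u y = 0} < dim {y \<in> V. B z y = 0}"
    using u z by (intro dim_perp_less[of _ z] subspace_perp sub) (auto simp: form_sym[of u z])
  ultimately have "dim {y \<in> V. B z y = 0 \<and> B u y = 0} + 2 \<le> dim V"
    unfolding eq by linarith
  moreover have "nondeg_on {y \<in> V. B z y = 0 \<and> B u y = 0}"
    unfolding nondeg_on_def
  proof (intro conjI allI)
    show "subspace {y \<in> V. B z y = 0 \<and> B u y = 0}"
      unfolding eq by (intro subspace_perp sub)
    fix x
    obtain y where y: "y \<in> V" "\<forall>v\<in>V. B (x - y) v = 0"
      using V unfolding nondeg_on_def by blast
    let ?y = "y - scale (B z y) u - scale (B u y) z"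
    have "?y \<in> {y \<in> V. B z y = 0 \<and> B u y = 0}"
      using y(1) u z sub by (auto simp: form_simps form_sym[of u z] subspace_diff subspace_scale)
    moreover have "B (x - ?y) v = 0" if "v \<in> V" "B z v = 0" "B u v = 0" for v
      using y(2) that by (simp add: form_simps)
    ultimately show "\<exists>y\<in>{y \<in> V. B z y = 0 \<and> B u y = 0}. \<forall>v\<in>{y \<in> V. B z y = 0 \<and> B u y = 0}. B (x - y) v = 0"
      by blast
  qed
  ultimately show thesis
    using u by (intro that) auto
qed

section \<open>The second derived algebra\<close>

lemma derived_abelian:
  assumes "a \<in> A" "b \<in> A" "c \<in> A" "d \<in> A"
  shows "bracket (bracket a b) (bracket c d) = 0"
proof -
  have 1: "bracket (bracket a (bracket b1 b2)) (bracket (bracket c1 c2) (bracket d1 d2)) = 0"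
    if "a \<in> A" for a b1 b2 c1 c2 d1 d2
    using that unfolding A_def bracket_span_def
    by (induction rule: span_induct_alt) (auto simp: bracket_simps solvable)
  have 2: "bracket (bracket a b) (bracket (bracket c1 c2) (bracket d1 d2)) = 0"
    if "b \<in> A" for b c1 c2 d1 d2
    using that unfolding A_def bracket_span_def
    by (induction rule: span_induct_alt) (auto simp: bracket_simps 1 assms)
  have 3: "bracket (bracket a b) (bracket c (bracket d1 d2)) = 0"
    if "c \<in> A" for c d1 d2
    using that unfolding A_def bracket_span_def
    by (induction rule: span_induct_alt) (auto simp: bracket_simps 2 assms)
  show ?thesis
    using assms(4) unfolding A_def bracket_span_def
    by (induction rule: span_induct_alt) (auto simp: bracket_simps 3 assms)
qed

text \<open>The second derived algebra. By 3-solvability it is abelian, the only way in which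
  solvability is used from here on.\<close>

definition M :: "'b set" where "M = bracket_span A A"

lemma bracket_mem_M: "a \<in> A \<Longrightarrow> b \<in> A \<Longrightarrow> bracket a b \<in> M"
  unfolding M_def bracket_span_def by (rule span_base) blast

lemma subspace_M: "subspace M"
  by (simp add: M_def bracket_span_def)

lemma M_abelian: "m \<in> M \<Longrightarrow> n \<in> M \<Longrightarrow> bracket m n = 0"
proof -
  assume m: "m \<in> M" and n: "n \<in> M"
  have 1: "bracket m (bracket c d) = 0" if "c \<in> A" "d \<in> A" for c d
    using m unfolding M_def bracket_span_def
    by (induction rule: span_induct_alt) (auto simp: bracket_simps derived_abelian that)
  show "bracket m n = 0"
    using n unfolding M_def bracket_span_def
    by (induction rule: span_induct_alt) (auto simp: bracket_simps 1)
qed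

text \<open>Without isotropic center every vector is a sum of vectors of A and Z, so A = [A, A] is
  abelian. As any second argument may also be moved into A modulo the center, brackets with A
  vanish.\<close>

lemma A_subset_Z_if_no_isotropic_center:
  assumes "A \<inter> Z \<subseteq> {0}"
  shows "A \<subseteq> Z"
proof -
  have dec: "\<exists>a'\<in>A. a - a' \<in> Z" for a
    using mem_A_plus_Z[of a] assms form_simps(5) by (metis Int_iff empty_iff insert_iff subset_iff)
  have AM: "x \<in> M" if "x \<in> A" for x
    using that unfolding A_def bracket_span_def
  proof (induction rule: span_induct_alt)
    case (step c x y)
    obtain a b where x: "x = bracket a b"
      using step(1) by blast
    obtain a' b' where a': "a' \<in> A" "a - a' \<in> Z" "b' \<in> A" "b - b' \<in> Z"
      using dec by metis
    have "bracket a b = bracket a' b + bracket (a - a') b"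
      by (simp add: bracket_simps)
    also have "\<dots> = bracket a' b' + bracket a' (b - b')"
      using a'(2) by (simp add: bracket_simps Z_def)
    also have "\<dots> = bracket a' b'"
      using a'(4) bracket_skew[of a' "b - b'"] by (simp add: Z_def)
    finally have "x \<in> M"
      using x a' bracket_mem_M by simp
    then show ?case
      using step(2) subspace_M by (simp add: subspace_add subspace_scale)
  qed (simp add: subspace_M subspace_0)
  have "\<omega> x a b = 0" if x: "x \<in> A" for x a b
  proof -
    obtain a' where a': "a' \<in> A" "a - a' \<in> Z"
      using dec by metis
    have "\<omega> x a b = \<omega> x a' b + \<omega> x (a - a') b"
      by (simp add: \<omega>_simps)
    also have "\<dots> = 0"
      using a' M_abelian[OF AM[OF x] AM[OF a'(1)]] by (simp add: \<omega>_def[of x a'] form_simps)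
    finally show ?thesis .
  qed
  then show ?thesis
    unfolding subset_iff mem_Z_iff_\<omega> by blast
qed

end

section \<open>The three-form on the derived algebra\<close>

context metric_3solvable
begin

text \<open>A model of \<open>A / (A \<inter> Z)\<close> inside \<open>A\<close>; the form \<open>B\<close> is nondegenerate on it.\<close>

definition core :: "'b set \<Rightarrow> bool" where
  "core q \<longleftrightarrow> subspace q \<and> q \<subseteq> A \<and> (\<forall>a\<in>A. \<exists>y\<in>q. a - y \<in> Z) \<and> q \<inter> Z \<subseteq> {0}"

text \<open>The image of the second derived algebra in the model \<open>q\<close> of A modulo A
  \<inter> Z. It inherits commutativity from \<open>M\<close>.\<close>

definition P :: "'b set \<Rightarrow> 'b set" where
  "P q = {x \<in> q. \<exists>m\<in>M. x - m \<in> Z}"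

lemma subspace_P: "subspace q \<Longrightarrow> subspace (P q)"
proof (rule subspaceI)
  assume q: "subspace q"
  show "0 \<in> P q"
    using subspace_0[OF q] subspace_0[OF subspace_M] subspace_0[OF subspace_Z] by (force simp: P_def)
  show "x + y \<in> P q" if "x \<in> P q" "y \<in> P q" for x y
  proof -
    obtain m n where "m \<in> M" "x - m \<in> Z" "n \<in> M" "y - n \<in> Z"
      using \<open>x \<in> P q\<close> \<open>y \<in> P q\<close> by (auto simp: P_def)
    then have "m + n \<in> M" "(x - m) + (y - n) \<in> Z"
      using subspace_M subspace_Z by (simp_all only: subspace_add)
    moreover have "x + y - (m + n) = (x - m) + (y - n)"
      by simp
    ultimately have "\<exists>m\<in>M. x + y - m \<in> Z"
      by metis
    moreover have "x + y \<in> q"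
      using \<open>x \<in> P q\<close> \<open>y \<in> P q\<close> by (auto simp: P_def subspace_add[OF q])
    ultimately show ?thesis
      by (simp add: P_def)
  qed
  show "scale c x \<in> P q" if "x \<in> P q" for c x
  proof -
    obtain m where "m \<in> M" "x - m \<in> Z"
      using \<open>x \<in> P q\<close> by (auto simp: P_def)
    then have "scale c m \<in> M" "scale c x - scale c m \<in> Z"
      using subspace_M subspace_Z by (simp_all add: subspace_scale flip: scale_right_diff_distrib)
    then show ?thesis
      using \<open>x \<in> P q\<close> subspace_scale[OF q] unfolding P_def by blast
  qed
qed

lemma bracket_cong_Z: "x - x' \<in> Z \<Longrightarrow> y - y' \<in> Z \<Longrightarrow> bracket x y = bracket x' y'"
proof -
  assume "x - x' \<in> Z" "y - y' \<in> Z"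
  then have "bracket (x - x') y = 0" "bracket (y - y') x' = 0"
    by (auto simp: Z_def)
  then show "bracket x y = bracket x' y'"
    using bracket_skew[of y x'] bracket_skew[of y' x'] by (simp add: bracket_simps)
qed

lemma \<omega>_cong_Z: "x - x' \<in> Z \<Longrightarrow> y - y' \<in> Z \<Longrightarrow> w - w' \<in> Z \<Longrightarrow> \<omega> x y w = \<omega> x' y' w'"
proof -
  assume "x - x' \<in> Z" "y - y' \<in> Z" "w - w' \<in> Z"
  then have "\<omega> x y w = \<omega> x' y' w" "\<omega> x' y' (w - w') = 0"
    by (simp_all add: \<omega>_def[of x] \<omega>_def[of x' y' w] bracket_cong_Z[of x x' y y'])
  then show ?thesis
    by (simp add: \<omega>_simps)
qed

lemma P_abelian: "x \<in> P q \<Longrightarrow> y \<in> P q \<Longrightarrow> bracket x y = 0"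
  using M_abelian bracket_cong_Z unfolding P_def by fastforce

lemma \<omega>_P: "x \<in> P q \<Longrightarrow> y \<in> P q \<Longrightarrow> \<omega> x y w = 0" "x \<in> P q \<Longrightarrow> y \<in> P q \<Longrightarrow> \<omega> x w y = 0"
  "x \<in> P q \<Longrightarrow> y \<in> P q \<Longrightarrow> \<omega> w x y = 0"
proof -
  show 1: "\<omega> x y w = 0" if "x \<in> P q" "y \<in> P q" for x y w
    using that by (simp add: \<omega>_def P_abelian form_simps)
  show "\<omega> x w y = 0" "\<omega> w x y = 0" if "x \<in> P q" "y \<in> P q"
    using 1[of x y w] that \<omega>_swap23[of x y w] \<omega>_cyc[of x y w] by simp_all
qed

text \<open>By invariance the \<open>p\<^sub>i\<close> are dual to the \<open>a\<^sub>j\<close> under \<open>B\<close>.\<close>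

definition triple :: "'b set \<Rightarrow> 'b \<Rightarrow> 'b \<Rightarrow> 'b \<Rightarrow> 'b \<Rightarrow> 'b \<Rightarrow> 'b \<Rightarrow> bool" where
  "triple q a1 a2 a3 p1 p2 p3 \<longleftrightarrow> {a1, a2, a3, p1, p2, p3} \<subseteq> q \<and> \<omega> a1 a2 a3 = 1 \<and>
     p1 - bracket a2 a3 \<in> Z \<and> p2 - bracket a3 a1 \<in> Z \<and> p3 - bracket a1 a2 \<in> Z"

lemma triple_rotate: "triple q a1 a2 a3 p1 p2 p3 \<Longrightarrow> triple q a2 a3 a1 p2 p3 p1"
  by (auto simp: triple_def \<omega>_cyc[of a2 a3 a1])

lemma triple_exists:
  assumes "core q" "a \<in> A" "b \<in> A" "c \<in> A" "\<omega> a b c \<noteq> 0"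
  obtains a1 a2 a3 p1 p2 p3 where "triple q a1 a2 a3 p1 p2 p3"
proof -
  have q: "subspace q" and dec: "\<And>a. a \<in> A \<Longrightarrow> \<exists>y\<in>q. a - y \<in> Z"
    using assms(1) by (auto simp: core_def)
  obtain a' b' c' where a': "a' \<in> q" "a - a' \<in> Z" "b' \<in> q" "b - b' \<in> Z" "c' \<in> q" "c - c' \<in> Z"
    using dec assms(2-4) by metis
  then have "\<omega> a' b' c' \<noteq> 0"
    using assms(5) \<omega>_cong_Z[OF a'(2,4,6)] by simp
  then have "\<omega> (scale (1 / \<omega> a' b' c') a') b' c' = 1"
    by (simp add: \<omega>_simps)
  then obtain a1 where a1: "a1 \<in> q" "\<omega> a1 b' c' = 1"
    using subspace_scale[OF q a'(1)] by blast
  obtain p1 p2 p3 where p: "p1 \<in> q" "bracket b' c' - p1 \<in> Z" "p2 \<in> q" "bracket c' a1 - p2 \<in> Z"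
      "p3 \<in> q" "bracket a1 b' - p3 \<in> Z"
    using dec[OF bracket_mem_A[of b' c']] dec[OF bracket_mem_A[of c' a1]] dec[OF bracket_mem_A[of a1 b']]
    by blast
  have "x - y \<in> Z" if "y - x \<in> Z" for x y
    using subspace_neg[OF subspace_Z that] by simp
  then have "triple q a1 b' c' p1 p2 p3"
    using a1 a' p by (simp add: triple_def)
  then show thesis
    by (rule that)
qed

section \<open>A triple and its dual vectors\<close>

context
  fixes q a1 a2 a3 p1 p2 p3
  assumes core: "core q" and tr: "triple q a1 a2 a3 p1 p2 p3"
begin

lemma triple_mem: "a1 \<in> q" "a2 \<in> q" "a3 \<in> q" "p1 \<in> q" "p2 \<in> q" "p3 \<in> q"
  "a1 \<in> A" "a2 \<in> A" "a3 \<in> A" "p1 \<in> A" "p2 \<in> A" "p3 \<in> A"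
  using tr core by (auto simp: triple_def core_def)

lemma triple_\<omega>: "\<omega> a1 a2 a3 = 1"
  "\<omega> a2 a3 a1 = 1" "\<omega> a3 a1 a2 = 1" "\<omega> a2 a1 a3 = -1" "\<omega> a1 a3 a2 = -1" "\<omega> a3 a2 a1 = -1"
proof -
  show 1: "\<omega> a1 a2 a3 = 1"
    using tr by (simp add: triple_def)
  show 2: "\<omega> a2 a3 a1 = 1" "\<omega> a3 a1 a2 = 1"
    using 1 \<omega>_cyc[of a2 a3 a1] \<omega>_cyc[of a1 a2 a3] by simp_all
  show "\<omega> a2 a1 a3 = -1" "\<omega> a1 a3 a2 = -1" "\<omega> a3 a2 a1 = -1"
    using 1 2 \<omega>_swap12[of a2 a1 a3] \<omega>_swap12[of a3 a2 a1] \<omega>_swap12[of a1 a3 a2] by simp_all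
qed

lemma triple_form:
  assumes "x \<in> A"
  shows "B p1 x = \<omega> a2 a3 x" "B p2 x = \<omega> a3 a1 x" "B p3 x = \<omega> a1 a2 x"
proof -
  have *: "B p x = \<omega> a b x" if "p - bracket a b \<in> Z" for p a b
    using form_Z_A[OF that assms] by (simp add: form_simps \<omega>_def)
  show "B p1 x = \<omega> a2 a3 x" "B p2 x = \<omega> a3 a1 x" "B p3 x = \<omega> a1 a2 x"
    using tr * unfolding triple_def by blast+
qed

lemma triple_dual:
  "B p1 a1 = 1" "B p1 a2 = 0" "B p1 a3 = 0" "B p2 a1 = 0" "B p2 a2 = 1" "B p2 a3 = 0"
  "B p3 a1 = 0" "B p3 a2 = 0" "B p3 a3 = 1"
  by (simp_all add: triple_form triple_mem triple_\<omega>)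

lemma triple_P: "p1 \<in> P q" "p2 \<in> P q" "p3 \<in> P q"
  using tr triple_mem bracket_mem_M unfolding P_def triple_def by blast+

text \<open>Since \<open>P q\<close> is abelian, contracting with the given combination of the a's
  shows that a1, a2 are independent modulo \<open>P q\<close>; by dimension they span
  \<open>q\<close> together with \<open>P q\<close>. The same contraction removes the a1 and a2
  components of k. For k in \<open>P q\<close> only \<omega>(k, a1, a2) matters, and it equals
  \<open>B p3 k\<close>.\<close>

lemma triple_dim_aux:
  assumes d: "scale c1 a1 + scale c2 a2 + scale c3 a3 \<in> P q" and c3: "c3 \<noteq> 0"
    and dims: "4 \<le> dim (P q)" "dim q \<le> 6"
    and k: "k \<in> q" "B p1 k = 0" "B p2 k = 0" "B p3 k = 0"
    and xy: "x \<in> q" "y \<in> q"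
  shows "\<omega> k x y = 0"
proof -
  let ?d = "scale c1 a1 + scale c2 a2 + scale c3 a3"
  have q: "subspace q"
    using core by (simp add: core_def)
  note P = subspace_P[OF q]
  have spP: "span (P q) = P q"
    using P by (simp add: span_eq_iff)
  have ind: "\<alpha> = 0 \<and> \<beta> = 0" if "scale \<alpha> a1 + scale \<beta> a2 \<in> P q" for \<alpha> \<beta>
  proof -
    have "\<omega> (scale \<alpha> a1 + scale \<beta> a2) ?d a2 = 0" "\<omega> (scale \<alpha> a1 + scale \<beta> a2) ?d a1 = 0"
      using \<omega>_P(1)[OF that d] by blast+
    then show ?thesis
      using c3 by (simp add: \<omega>_simps triple_\<omega>)
  qed
  have "a1 \<notin> span (P q)"
    using ind[of 1 0] by (auto simp: spP)
  moreover have "a2 \<notin> span (insert a1 (P q))"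
  proof
    assume "a2 \<in> span (insert a1 (P q))"
    then obtain c where "a2 - scale c a1 \<in> P q"
      by (auto simp: span_breakdown_eq spP)
    then show False
      using ind[of "- c" 1] by (simp add: add.commute)
  qed
  ultimately have "dim (insert a2 (insert a1 (P q))) = dim (P q) + 2"
    by (simp add: dim_insert)
  moreover have sub: "insert a2 (insert a1 (P q)) \<subseteq> q"
    using triple_mem by (auto simp: P_def)
  ultimately have "span (insert a2 (insert a1 (P q))) = q"
    using dims by (intro subspace_dim_equal subspace_span q span_minimal) (simp_all only: dim_span)
  then have dec: "\<exists>c1 c2 p. p \<in> P q \<and> x = scale c1 a1 + scale c2 a2 + p" if "x \<in> q" for x
  proof -
    have "x \<in> span (insert a2 (insert a1 (P q)))"
      using that \<open>span _ = q\<close> by simp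
    then obtain c2 c1 where "x - scale c2 a2 - scale c1 a1 \<in> P q"
      by (auto simp: span_breakdown_eq spP)
    moreover have "x = scale c1 a1 + scale c2 a2 + (x - scale c2 a2 - scale c1 a1)"
      by simp
    ultimately show ?thesis
      by blast
  qed
  have kA: "k \<in> A"
    using k(1) core by (auto simp: core_def)
  obtain k1 k2 p where p: "p \<in> P q" "k = scale k1 a1 + scale k2 a2 + p"
    using dec[OF k(1)] by blast
  have k0: "\<omega> a2 a3 k = 0" "\<omega> a3 a1 k = 0" "\<omega> a1 a2 k = 0"
    using k kA by (simp_all add: triple_form)
  then have k0': "\<omega> a2 a1 k = 0" "\<omega> a1 a3 k = 0"
    using \<omega>_swap12[of a2 a1 k] \<omega>_swap12[of a1 a3 k] by simp_all
  have "\<omega> a2 ?d k = 0" "\<omega> a1 ?d k = 0"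
    by (simp_all only: \<omega>_simps k0 k0' \<omega>_alt) simp_all
  moreover have "\<omega> a2 ?d p = 0" "\<omega> a1 ?d p = 0"
    using \<omega>_P(3)[OF d p(1)] by blast+
  ultimately have "k1 * c3 = 0" "k2 * c3 = 0"
    unfolding p(2) by (simp_all add: \<omega>_simps triple_\<omega>)
  then have "k = p"
    using p(2) c3 by simp
  obtain x1 x2 r where r: "r \<in> P q" "x = scale x1 a1 + scale x2 a2 + r"
    using dec[OF xy(1)] by blast
  obtain y1 y2 s where s: "s \<in> P q" "y = scale y1 a1 + scale y2 a2 + s"
    using dec[OF xy(2)] by blast
  have "\<omega> k a1 a2 = 0" "\<omega> k a2 a1 = 0"
    using k0(3) k0'(1) \<omega>_cyc[of a1 a2 k] \<omega>_cyc[of a2 a1 k] \<omega>_cyc[of k a1 a2] \<omega>_cyc[of k a2 a1] by simp_all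
  then show ?thesis
    unfolding r(2) s(2) using p(1) r(1) s(1) \<open>k = p\<close> by (simp add: \<omega>_simps \<omega>_P)
qed

lemma dim_dual_3: "dim {p1, p2, p3} = 3"
proof -
  have f: "functional scale (\<lambda>x. B x a)" for a
    using form_bilinear by (simp add: bilinear_form_def)
  have "p1 \<noteq> 0"
    using triple_dual form_simps by auto
  moreover have "p2 \<notin> span {p1}"
    using functional_vanishes_on_span[OF f[of a2], of "{p1}" p2] triple_dual by auto
  moreover have "p3 \<notin> span {p2, p1}"
    using functional_vanishes_on_span[OF f[of a3], of "{p2, p1}" p3] triple_dual by auto
  ultimately have "dim {p3, p2, p1} = 3"
    by (simp add: dim_insert)
  then show ?thesis
    by (simp add: insert_commute)
qed

end

text \<open>If \<open>P q\<close> has dimension at most 3, it is spanned by the \<open>p\<^sub>i\<close>. Otherwise it has codimension at most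
  2 in \<open>q\<close>, hence contains a nonzero combination of the \<open>a\<^sub>i\<close>, and \<open>\<omega>\<close> is controlled because \<open>P q\<close> is abelian.\<close>

lemma triple_kernel:
  assumes core: "core q" and tr: "triple q a1 a2 a3 p1 p2 p3" and dim: "dim q \<le> 6"
    and k: "k \<in> q" "B p1 k = 0" "B p2 k = 0" "B p3 k = 0"
    and xy: "x \<in> A" "y \<in> A"
  shows "\<omega> k x y = 0"
proof -
  have q: "subspace q" and dec: "\<And>a. a \<in> A \<Longrightarrow> \<exists>y\<in>q. a - y \<in> Z" and qA: "q \<subseteq> A"
    using core by (auto simp: core_def)
  note P = subspace_P[OF q]
  show ?thesis
  proof (cases "dim (P q) \<le> 3")
    case True
    \<comment> \<open>It follows that k is orthogonal to \<open>P q\<close>, which contains a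
      representative of [x, y] modulo the center.\<close>
    have "span {p1, p2, p3} = P q"
      using True triple_P[OF core tr] dim_dual_3[OF core tr]
      by (intro subspace_dim_equal subspace_span P span_minimal) auto
    have f: "functional scale (B k)"
      using form_bilinear by (simp add: bilinear_form_def)
    have "B k p = 0" if "p \<in> P q" for p
      using functional_vanishes_on_span[OF f, of "{p1, p2, p3}" p] that k
      by (auto simp: \<open>span _ = P q\<close> form_sym[of k])
    moreover obtain p where p: "p \<in> q" "bracket x y - p \<in> Z"
      using dec bracket_mem_A by blast
    moreover have "p - bracket x y \<in> Z"
      using subspace_neg[OF subspace_Z p(2)] by simp
    then have "p \<in> P q"
      using p(1) bracket_mem_M[OF xy] by (auto simp: P_def)
    moreover have "B k (bracket x y - p) = 0"
      using p(2) k(1) qA form_A_Z by blast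
    ultimately show ?thesis
      by (simp add: form_simps form_bracket)
  next
    case False
    then have P4: "4 \<le> dim (P q)"
      by simp
    obtain x' y' where x': "x' \<in> q" "x - x' \<in> Z" "y' \<in> q" "y - y' \<in> Z"
      using dec xy by metis
    have spP: "span (P q) = P q"
      using P by (simp add: span_eq_iff)
    have "\<not> (a1 \<notin> span (P q) \<and> a2 \<notin> span (insert a1 (P q)) \<and> a3 \<notin> span (insert a2 (insert a1 (P q))))"
    proof
      assume "a1 \<notin> span (P q) \<and> a2 \<notin> span (insert a1 (P q)) \<and> a3 \<notin> span (insert a2 (insert a1 (P q)))"
      then have "dim (insert a3 (insert a2 (insert a1 (P q)))) = dim (P q) + 3"
        by (simp add: dim_insert)
      moreover have "dim (insert a3 (insert a2 (insert a1 (P q)))) \<le> dim q"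
        using triple_mem[OF core tr] by (intro dim_subset) (auto simp: P_def)
      ultimately show False
        using P4 dim by linarith
    qed
    \<comment> \<open>The dependence found has coefficient 1 on its last vector; rotating the triple
      moves that vector to the third place.\<close>
    then consider "a1 \<in> P q" | c where "a2 - scale c a1 \<in> P q" | c2 c1 where "a3 - scale c2 a2 - scale c1 a1 \<in> P q"
      by (auto simp: span_breakdown_eq spP)
    then have "\<omega> k x' y' = 0"
    proof cases
      case 1
      note tr' = triple_rotate[OF tr]
      show ?thesis
        by (rule triple_dim_aux[OF core tr', of 0 0 1]) (use 1 P4 dim k x' in auto)
    next
      case (2 c)
      note tr' = triple_rotate[OF triple_rotate[OF tr]]
      show ?thesis
        by (rule triple_dim_aux[OF core tr', of 0 "- c" 1]) (use 2 P4 dim k x' in auto)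
    next
      case (3 c2 c1)
      have "scale (- c1) a1 + scale (- c2) a2 + scale 1 a3 \<in> P q"
        using 3 by (simp add: algebra_simps)
      then show ?thesis
        by (rule triple_dim_aux[OF core tr]) (use P4 dim k x' in auto)
    qed
    then show ?thesis
      using \<omega>_cong_Z[of k k x x' y y'] x' subspace_0[OF subspace_Z] by simp
  qed
qed


definition wedge2 :: "('b \<Rightarrow> 'a) \<Rightarrow> ('b \<Rightarrow> 'a) \<Rightarrow> 'b \<Rightarrow> 'b \<Rightarrow> 'a" where
  "wedge2 \<phi> \<psi> x y = \<phi> x * \<psi> y - \<phi> y * \<psi> x"

text \<open>Modulo the center each vector of A is a combination of a1, a2, a3, with coefficients
  read off by the dual p's, plus a vector that \<open>triple_kernel\<close> places in the kernel of
  \<omega> on A. Hence \<omega> is decomposable on A.\<close>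

lemma triple_\<omega>_A:
  assumes core: "core q" and tr: "triple q a1 a2 a3 p1 p2 p3" and dim: "dim q \<le> 6"
    and xyw: "x \<in> A" "y \<in> A" "w \<in> A"
  shows "\<omega> x y w = wedge (B p1) (wedge2 (B p2) (B p3)) x y w"
proof -
  note mem = triple_mem[OF core tr] and dual = triple_dual[OF core tr]
  have q: "subspace q" and dec: "\<And>a. a \<in> A \<Longrightarrow> \<exists>y\<in>q. a - y \<in> Z" and qA: "q \<subseteq> A"
    using core by (auto simp: core_def)
  have dec2: "\<exists>k. k \<in> A \<and> (\<forall>x\<in>A. \<forall>y\<in>A. \<omega> k x y = 0) \<and>
      v - (scale (B p1 v) a1 + scale (B p2 v) a2 + scale (B p3 v) a3 + k) \<in> Z" if v: "v \<in> A" for v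
  proof -
    obtain v' where v': "v' \<in> q" "v - v' \<in> Z"
      using dec v by blast
    have "B p v = B p v'" if "p \<in> A" for p
      using form_A_Z[OF v'(2) that] by (simp add: form_simps)
    then have Bv: "B p1 v = B p1 v'" "B p2 v = B p2 v'" "B p3 v = B p3 v'"
      using mem by blast+
    define k where "k = v' - (scale (B p1 v) a1 + scale (B p2 v) a2 + scale (B p3 v) a3)"
    have k: "k \<in> q"
      unfolding k_def using v'(1) mem q by (simp add: subspace_add subspace_diff subspace_scale)
    have "B p1 k = 0" "B p2 k = 0" "B p3 k = 0"
      by (simp_all add: k_def form_simps dual Bv)
    then have "\<omega> k x y = 0" if "x \<in> A" "y \<in> A" for x y
      using triple_kernel[OF core tr dim k] that by blast
    moreover have "v - (scale (B p1 v) a1 + scale (B p2 v) a2 + scale (B p3 v) a3 + k) = v - v'"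
      by (simp add: k_def)
    ultimately show ?thesis
      using k qA v'(2) by (metis subsetD)
  qed
  obtain kx where kx: "kx \<in> A" "\<forall>x\<in>A. \<forall>y\<in>A. \<omega> kx x y = 0"
    and eqx: "x - (scale (B p1 x) a1 + scale (B p2 x) a2 + scale (B p3 x) a3 + kx) \<in> Z"
    using dec2[OF xyw(1)] by blast
  obtain ky where ky: "ky \<in> A" "\<forall>x\<in>A. \<forall>y\<in>A. \<omega> ky x y = 0"
    and eqy: "y - (scale (B p1 y) a1 + scale (B p2 y) a2 + scale (B p3 y) a3 + ky) \<in> Z"
    using dec2[OF xyw(2)] by blast
  obtain kw where kw: "kw \<in> A" "\<forall>x\<in>A. \<forall>y\<in>A. \<omega> kw x y = 0"
    and eqw: "w - (scale (B p1 w) a1 + scale (B p2 w) a2 + scale (B p3 w) a3 + kw) \<in> Z"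
    using dec2[OF xyw(3)] by blast
  have k2: "\<omega> x ky y = 0" if "x \<in> A" "y \<in> A" for x y
    using ky(2) that \<omega>_swap12[of x ky y] by simp
  have k3: "\<omega> x y kw = 0" if "x \<in> A" "y \<in> A" for x y
    using kw(2) that \<omega>_cyc[of x y kw] by simp
  show ?thesis
    unfolding \<omega>_cong_Z[OF eqx eqy eqw]
    by (simp add: \<omega>_simps kx ky kw k2 k3 mem triple_\<omega>[OF core tr] wedge_def wedge2_def algebra_simps)
qed

text \<open>For x and y in the abelian \<open>P q\<close> the decomposable form vanishes at (x, y,
  a_i); since the a's are dual to the p's, these three values are the minors.\<close>

lemma triple_gram_minors:
  assumes core: "core q" and tr: "triple q a1 a2 a3 p1 p2 p3" and dim: "dim q \<le> 6"
    and "x \<in> P q" "y \<in> P q"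
  shows "B p1 x * B p2 y = B p1 y * B p2 x" "B p2 x * B p3 y = B p2 y * B p3 x"
    "B p3 x * B p1 y = B p3 y * B p1 x"
proof -
  note mem = triple_mem[OF core tr] and dual = triple_dual[OF core tr]
  have xy: "x \<in> A" "y \<in> A"
    using assms(4,5) core by (auto simp: P_def core_def)
  have "wedge (B p1) (wedge2 (B p2) (B p3)) x y a = 0" if "a \<in> A" for a
    using triple_\<omega>_A[OF core tr dim xy that] \<omega>_P(1)[OF assms(4,5)] by simp
  from this[OF mem(7)] this[OF mem(8)] this[OF mem(9)]
  show "B p1 x * B p2 y = B p1 y * B p2 x" "B p2 x * B p3 y = B p2 y * B p3 x"
    "B p3 x * B p1 y = B p3 y * B p1 x"
    by (simp_all add: wedge_def wedge2_def dual algebra_simps)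
qed

text \<open>The dual vectors transform contragrediently: adding multiples of a2 and a3 to a1
  subtracts the same multiples of p1 from p2 and p3.\<close>

lemma triple_change:
  assumes core: "core q" and tr: "triple q a1 a2 a3 p1 p2 p3"
  shows "triple q (a1 + scale c a2 + scale d a3) a2 a3 p1 (p2 - scale c p1) (p3 - scale d p1)"
proof -
  note mem = triple_mem[OF core tr]
  have q: "subspace q"
    using core by (simp add: core_def)
  have z: "p1 - bracket a2 a3 \<in> Z" "p2 - bracket a3 a1 \<in> Z" "p3 - bracket a1 a2 \<in> Z"
    using tr by (auto simp: triple_def)
  have "(p2 - bracket a3 a1) - scale c (p1 - bracket a2 a3) \<in> Z"
    "(p3 - bracket a1 a2) - scale d (p1 - bracket a2 a3) \<in> Z"
    using z subspace_Z by (simp_all only: subspace_diff subspace_scale)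
  moreover have "p2 - scale c p1 - bracket a3 (a1 + scale c a2 + scale d a3) =
      (p2 - bracket a3 a1) - scale c (p1 - bracket a2 a3)"
    by (simp add: bracket_simps alternating bracket_skew[of a3 a2] scale_right_diff_distrib)
  moreover have "p3 - scale d p1 - bracket (a1 + scale c a2 + scale d a3) a2 =
      (p3 - bracket a1 a2) - scale d (p1 - bracket a2 a3)"
    by (simp add: bracket_simps alternating bracket_skew[of a3 a2] scale_right_diff_distrib)
  ultimately have "p2 - scale c p1 - bracket a3 (a1 + scale c a2 + scale d a3) \<in> Z"
    "p3 - scale d p1 - bracket (a1 + scale c a2 + scale d a3) a2 \<in> Z"
    by (simp_all only:)
  then show ?thesis
    using mem q z by (auto simp: triple_def \<omega>_simps triple_\<omega>[OF core tr] subspace_add subspace_diff subspace_scale)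
qed

text \<open>The only Gram entry left open is \<open>B p1 p1\<close>; whether it vanishes decides
  between the two normal forms below.\<close>

definition normal_triple :: "'b set \<Rightarrow> 'b \<Rightarrow> 'b \<Rightarrow> 'b \<Rightarrow> 'b \<Rightarrow> 'b \<Rightarrow> 'b \<Rightarrow> bool" where
  "normal_triple q a1 a2 a3 p1 p2 p3 \<longleftrightarrow> triple q a1 a2 a3 p1 p2 p3 \<and>
     B p1 p2 = 0 \<and> B p1 p3 = 0 \<and> B p2 p2 = 0 \<and> B p2 p3 = 0 \<and> B p3 p3 = 0"

text \<open>By the vanishing minors, the Gram matrix of the \<open>p\<^sub>i\<close> has rank at most one.\<close>

lemma normal_triple_exists:
  assumes core: "core q" and dim: "dim q \<le> 6" and tr: "triple q a1 a2 a3 p1 p2 p3"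
  obtains b1 b2 b3 r1 r2 r3 where "normal_triple q b1 b2 b3 r1 r2 r3"
proof -
  have main: "\<exists>b1 b2 b3 r1 r2 r3. normal_triple q b1 b2 b3 r1 r2 r3"
    if tr: "triple q a1 a2 a3 p1 p2 p3" and ne: "B p1 p1 \<noteq> 0" for a1 a2 a3 p1 p2 p3
  proof -
    \<comment> \<open>The Gram-Schmidt coefficients: they make p2 and p3 orthogonal to p1, and the
      vanishing minors then annihilate the remaining entries.\<close>
    let ?c = "B p1 p2 / B p1 p1" and ?d = "B p1 p3 / B p1 p1"
    note P = triple_P[OF core tr]
    have m: "B p1 p1 * B p2 p2 = B p1 p2 * B p1 p2" "B p1 p1 * B p3 p3 = B p1 p3 * B p1 p3"
      "B p1 p1 * B p2 p3 = B p1 p2 * B p1 p3"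
      using triple_gram_minors(1)[OF core tr dim P(1,2)] triple_gram_minors(3)[OF core tr dim P(1,3)]
        triple_gram_minors(1)[OF core tr dim P(1,3)]
      by (simp_all add: form_sym[of p2 p1] form_sym[of p3 p1] mult.commute)
    have "B p2 p2 = B p1 p2 * B p1 p2 / B p1 p1" "B p3 p3 = B p1 p3 * B p1 p3 / B p1 p1"
      "B p2 p3 = B p1 p2 * B p1 p3 / B p1 p1"
      using m ne by (simp_all add: eq_divide_eq mult.commute)
    then have "normal_triple q (a1 + scale ?c a2 + scale ?d a3) a2 a3 p1 (p2 - scale ?c p1) (p3 - scale ?d p1)"
      using triple_change[OF core tr] ne
      by (simp add: normal_triple_def form_simps form_sym[of p2 p1] form_sym[of p3 p1])
    then show ?thesis
      by blast
  qed
  consider "B p1 p1 \<noteq> 0" | "B p2 p2 \<noteq> 0" | "B p3 p3 \<noteq> 0" | "B p1 p1 = 0" "B p2 p2 = 0" "B p3 p3 = 0"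
    by blast
  then have "\<exists>b1 b2 b3 r1 r2 r3. normal_triple q b1 b2 b3 r1 r2 r3"
  proof cases
    case 1
    then show ?thesis by (rule main[OF tr])
  next
    case 2
    then show ?thesis by (rule main[OF triple_rotate[OF tr]])
  next
    case 3
    then show ?thesis by (rule main[OF triple_rotate[OF triple_rotate[OF tr]]])
  next
    case 4
    note P = triple_P[OF core tr]
    \<comment> \<open>With zero diagonal the principal minors are minus the squares of the
      off-diagonal entries.\<close>
    have "B p1 p2 * B p1 p2 = 0" "B p2 p3 * B p2 p3 = 0" "B p1 p3 * B p1 p3 = 0"
      using 4 triple_gram_minors(1)[OF core tr dim P(1,2)] triple_gram_minors(2)[OF core tr dim P(2,3)]
        triple_gram_minors(3)[OF core tr dim P(1,3)]
      by (simp_all add: form_sym[of p2 p1] form_sym[of p3 p1] form_sym[of p3 p2])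
    then have "normal_triple q a1 a2 a3 p1 p2 p3"
      using 4 tr by (simp add: normal_triple_def)
    then show ?thesis
      by blast
  qed
  then show thesis
    using that by blast
qed

text \<open>Written as nested hyperplane sections, so that each condition lowers the dimension by
  \<open>dim_perp_less\<close>.\<close>

definition K :: "'b set \<Rightarrow> 'b \<Rightarrow> 'b \<Rightarrow> 'b \<Rightarrow> 'b set" where
  "K q p1 p2 p3 = {y \<in> {y \<in> {y \<in> q. B p1 y = 0}. B p2 y = 0}. B p3 y = 0}"

lemma mem_K: "k \<in> K q p1 p2 p3 \<longleftrightarrow> k \<in> q \<and> B p1 k = 0 \<and> B p2 k = 0 \<and> B p3 k = 0"
  by (auto simp: K_def)

lemma subspace_K: "subspace q \<Longrightarrow> subspace (K q p1 p2 p3)"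
  unfolding K_def by (intro subspace_perp)

lemma dim_K:
  assumes core: "core q" and tr: "triple q a1 a2 a3 p1 p2 p3"
  shows "dim (K q p1 p2 p3) + 3 \<le> dim q"
proof -
  note mem = triple_mem[OF core tr] and dual = triple_dual[OF core tr]
  have q: "subspace q"
    using core by (simp add: core_def)
  have "dim {y \<in> q. B p1 y = 0} < dim q"
    using mem dual by (intro dim_perp_less[of _ a1] q) auto
  moreover have "dim {y \<in> {y \<in> q. B p1 y = 0}. B p2 y = 0} < dim {y \<in> q. B p1 y = 0}"
    using mem dual by (intro dim_perp_less[of _ a2] subspace_perp q) auto
  moreover have "dim (K q p1 p2 p3) < dim {y \<in> {y \<in> q. B p1 y = 0}. B p2 y = 0}"
    unfolding K_def using mem dual by (intro dim_perp_less[of _ a3] subspace_perp q) auto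
  ultimately show ?thesis
    by linarith
qed

text \<open>A normal triple would place the independent isotropic vectors p2 and p3 in
  \<open>K\<close>, whose dimension is at most 4 - 3.\<close>

lemma \<omega>_A_small:
  assumes core: "core q" and dim: "dim q \<le> 4" and abc: "a \<in> A" "b \<in> A" "c \<in> A"
  shows "\<omega> a b c = 0"
proof (rule ccontr)
  assume ne: "\<omega> a b c \<noteq> 0"
  obtain a1 a2 a3 p1 p2 p3 where "triple q a1 a2 a3 p1 p2 p3"
    by (rule triple_exists[OF core abc ne])
  moreover have dim6: "dim q \<le> 6"
    using dim by simp
  ultimately obtain a1 a2 a3 p1 p2 p3 where n: "normal_triple q a1 a2 a3 p1 p2 p3"
    using normal_triple_exists[OF core] by metis
  then have tr: "triple q a1 a2 a3 p1 p2 p3"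
    by (simp add: normal_triple_def)
  have "p2 \<in> K q p1 p2 p3" "p3 \<in> K q p1 p2 p3"
    using n triple_mem[OF core tr] by (auto simp: mem_K normal_triple_def form_sym[of p3 p2])
  then have "dim {p2, p3} \<le> dim (K q p1 p2 p3)"
    by (intro dim_subset) auto
  moreover have "dim {p1, p2, p3} \<le> dim {p2, p3} + 1"
    by (simp add: dim_insert)
  ultimately show False
    using dim_K[OF core tr] dim_dual_3[OF core tr] dim by linarith
qed

end

section \<open>Explicit primitives\<close>

context metric_3solvable
begin

lemma coboundary_cancel:
  assumes "c \<noteq> 0" "coboundary (\<lambda>x y w. c * \<eta> x y w)"
  shows "coboundary \<eta>"
  using coboundary_mult[OF assms(2), of "1 / c"] assms(1) by simp

text \<open>In the three lemmas below the primitive is read off from a grading for which \<open>\<omega>\<close> is homogeneous up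
  to terms \<open>z\<^sup>\<flat> \<and> \<iota>\<^sub>t\<omega>\<close>, which are coboundaries since \<open>z\<close> is central. The weights of \<open>u\<close> and \<open>x\<^sub>i\<close> are \<open>1\<close> and \<open>1/3\<close>
  in the first, \<open>1\<close> and \<open>1/2\<close> in the second lemma; those of \<open>u, v, a, a'\<close> are \<open>2/3, 2/3, 1/3, 0\<close> in the third.\<close>

lemma coboundary_isotropic:
  assumes z: "z \<in> Z"
    and F: "\<And>x y w. \<omega> x y w = wedge (B z) (\<omega> u) x y w + wedge (B p1) (wedge2 (B p2) (B p3)) x y w"
    and Fu: "\<And>y w. \<omega> u y w =
      X12 * wedge2 (B p1) (B p2) y w + X13 * wedge2 (B p1) (B p3) y w + X23 * wedge2 (B p2) (B p3) y w
      + Y11 * wedge2 (B p1) (B x1) y w + Y12 * wedge2 (B p1) (B x2) y w + Y13 * wedge2 (B p1) (B x3) y w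
      + Y21 * wedge2 (B p2) (B x1) y w + Y22 * wedge2 (B p2) (B x2) y w + Y23 * wedge2 (B p2) (B x3) y w
      + Y31 * wedge2 (B p3) (B x1) y w + Y32 * wedge2 (B p3) (B x2) y w + Y33 * wedge2 (B p3) (B x3) y w"
    and zx: "B z x1 = 0" "B z x2 = 0" "B z x3 = 0" "B z p1 = 0" "B z p2 = 0" "B z p3 = 0"
    and px: "B p1 x1 = 1" "B p1 x2 = 0" "B p1 x3 = 0" "B p2 x1 = 0" "B p2 x2 = 1" "B p2 x3 = 0"
      "B p3 x1 = 0" "B p3 x2 = 0" "B p3 x3 = 1"
    and pp: "B p1 p1 = 0" "B p1 p2 = 0" "B p1 p3 = 0" "B p2 p2 = 0" "B p2 p3 = 0" "B p3 p3 = 0"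
    and xx: "B x1 x1 = 0" "B x1 x2 = 0" "B x1 x3 = 0" "B x2 x2 = 0" "B x2 x3 = 0" "B x3 x3 = 0"
  shows "coboundary \<omega>"
proof -
  have sym: "B p2 p1 = 0" "B p3 p1 = 0" "B p3 p2 = 0" "B x2 x1 = 0" "B x3 x1 = 0" "B x3 x2 = 0"
    "B x1 p1 = 1" "B x1 p2 = 0" "B x1 p3 = 0" "B x2 p1 = 0" "B x2 p2 = 1" "B x2 p3 = 0"
    "B x3 p1 = 0" "B x3 p2 = 0" "B x3 p3 = 1"
    using px pp xx by (simp_all add: form_sym)
  note vals = zx px pp xx sym
  have x1: "\<omega> x1 y w = wedge2 (B p2) (B p3) y w - B z y * \<omega> u x1 w - B z w * \<omega> u y x1" for y w
    unfolding F[of x1] wedge_def by (simp add: vals wedge2_def \<omega>_swap23[of u x1])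
  have x2: "\<omega> x2 y w = wedge2 (B p3) (B p1) y w - B z y * \<omega> u x2 w - B z w * \<omega> u y x2" for y w
    unfolding F[of x2] wedge_def by (simp add: vals wedge2_def \<omega>_swap23[of u x2])
  have x3: "\<omega> x3 y w = wedge2 (B p1) (B p2) y w - B z y * \<omega> u x3 w - B z w * \<omega> u y x3" for y w
    unfolding F[of x3] wedge_def by (simp add: vals wedge2_def \<omega>_swap23[of u x3])
  have p: "\<omega> p y w = B z y * \<omega> u w p + B z w * \<omega> u p y" if "p \<in> {p1, p2, p3}" for p y w
    unfolding F[of p] wedge_def using that by (auto simp: vals wedge2_def)
  have p': "\<omega> p1 y w = B z y * \<omega> u w p1 + B z w * \<omega> u p1 y" "\<omega> p2 y w = B z y * \<omega> u w p2 + B z w * \<omega> u p2 y"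
    "\<omega> p3 y w = B z y * \<omega> u w p3 + B z w * \<omega> u p3 y" for y w
    using p by blast+
  \<comment> \<open>The rotations count factors p minus factors x: 3 on the decomposable term, 2 on
    the X terms, 0 on the Y terms. The X terms are removed by contractions with the x's, since
    contracting with x3 and wedging with \<open>B z\<close> gives the product of \<open>B z\<close>,
    \<open>B p1\<close>, \<open>B p2\<close>, and cyclically.\<close>
  have "3 * \<omega> x y w = 3 * wedge (B z) (\<omega> u) x y w + (cob p1 x1 x y w + cob p2 x2 x y w + cob p3 x3 x y w
      + (- 2 * X12) * wedge (B z) (\<omega> x3) x y w + (- 2 * X23) * wedge (B z) (\<omega> x1) x y w
      + (2 * X13) * wedge (B z) (\<omega> x2) x y w)" for x y w
    unfolding F[of x y w] cob_def wedge_def x1 x2 x3 p' Fu wedge2_def vals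
    by algebra
  then have eq: "(\<lambda>x y w. 3 * \<omega> x y w) = (\<lambda>x y w. 3 * wedge (B z) (\<omega> u) x y w +
      (cob p1 x1 x y w + cob p2 x2 x y w + cob p3 x3 x y w
      + (- 2 * X12) * wedge (B z) (\<omega> x3) x y w + (- 2 * X23) * wedge (B z) (\<omega> x1) x y w
      + (2 * X13) * wedge (B z) (\<omega> x2) x y w))"
    by (simp only:)
  show ?thesis
    by (rule coboundary_cancel[OF three], unfold eq)
      (intro coboundary_add coboundary_mult coboundary_cob coboundary_central z)
qed

lemma coboundary_anisotropic:
  assumes z: "z \<in> Z"
    and F: "\<And>x y w. \<omega> x y w = wedge (B z) (\<omega> u) x y w + wedge (B p1) (wedge2 (B p2) (B p3)) x y w"
    and Fu: "\<And>y w. \<omega> u y w = X * wedge2 (B p2) (B p3) y w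
      + Y22 * wedge2 (B p2) (B x2) y w + Y23 * wedge2 (B p2) (B x3) y w
      + Y32 * wedge2 (B p3) (B x2) y w + Y33 * wedge2 (B p3) (B x3) y w
      + E2 * wedge2 (B p2) (B p1) y w + E3 * wedge2 (B p3) (B p1) y w"
    and zx: "B z x2 = 0" "B z x3 = 0" "B z p1 = 0" "B z p2 = 0" "B z p3 = 0"
    and px: "B p1 x2 = 0" "B p1 x3 = 0" "B p2 x2 = 1" "B p2 x3 = 0" "B p3 x2 = 0" "B p3 x3 = 1"
    and pp: "B p1 p1 \<noteq> 0" "B p1 p2 = 0" "B p1 p3 = 0" "B p2 p2 = 0" "B p2 p3 = 0" "B p3 p3 = 0"
    and xx: "B x2 x2 = 0" "B x2 x3 = 0" "B x3 x3 = 0"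
  shows "coboundary \<omega>"
proof -
  have sym: "B p2 p1 = 0" "B p3 p1 = 0" "B p3 p2 = 0" "B x3 x2 = 0" "B x2 p1 = 0" "B x3 p1 = 0"
    "B x2 p2 = 1" "B x2 p3 = 0" "B x3 p2 = 0" "B x3 p3 = 1"
    using px pp xx by (simp_all add: form_sym)
  note vals = zx px pp(2-) xx sym
  have x2: "\<omega> x2 y w = wedge2 (B p3) (B p1) y w - B z y * \<omega> u x2 w - B z w * \<omega> u y x2" for y w
    unfolding F[of x2] wedge_def by (simp add: vals wedge2_def \<omega>_swap23[of u x2])
  have x3: "\<omega> x3 y w = wedge2 (B p1) (B p2) y w - B z y * \<omega> u x3 w - B z w * \<omega> u y x3" for y w
    unfolding F[of x3] wedge_def by (simp add: vals wedge2_def \<omega>_swap23[of u x3])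
  have p: "\<omega> p y w = B p1 p * wedge2 (B p2) (B p3) y w + B z y * \<omega> u w p + B z w * \<omega> u p y"
    if "p \<in> {p1, p2, p3}" for p y w
    unfolding F[of p] wedge_def using that by (auto simp: vals wedge2_def)
  have p': "\<omega> p1 y w = B p1 p1 * wedge2 (B p2) (B p3) y w + B z y * \<omega> u w p1 + B z w * \<omega> u p1 y"
    "\<omega> p2 y w = B z y * \<omega> u w p2 + B z w * \<omega> u p2 y"
    "\<omega> p3 y w = B z y * \<omega> u w p3 + B z w * \<omega> u p3 y" for y w
    using p[of p1 y w] p[of p2 y w] p[of p3 y w] by (simp_all add: vals)
  define \<epsilon> where "\<epsilon> = B p1 p1"
  \<comment> \<open>The two rotations together count 2 on the decomposable term and on the X term, 1
    on the E terms and 0 on the Y terms. Contractions with x3 and x2 remove the E terms; contraction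
    with p1 removes the X term at the price of the factor \<epsilon>.\<close>
  have "2 * \<epsilon> * \<omega> x y w = 2 * \<epsilon> * wedge (B z) (\<omega> u) x y w + (\<epsilon> * cob p2 x2 x y w + \<epsilon> * cob p3 x3 x y w
      + (\<epsilon> * E2) * wedge (B z) (\<omega> x3) x y w + (- (\<epsilon> * E3)) * wedge (B z) (\<omega> x2) x y w
      + (- 2 * X) * wedge (B z) (\<omega> p1) x y w)" for x y w
    unfolding F[of x y w] cob_def wedge_def x2 x3 p' Fu wedge2_def vals \<epsilon>_def[symmetric]
    by algebra
  then have eq: "(\<lambda>x y w. 2 * \<epsilon> * \<omega> x y w) = (\<lambda>x y w. 2 * \<epsilon> * wedge (B z) (\<omega> u) x y w +
      (\<epsilon> * cob p2 x2 x y w + \<epsilon> * cob p3 x3 x y w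
      + (\<epsilon> * E2) * wedge (B z) (\<omega> x3) x y w + (- (\<epsilon> * E3)) * wedge (B z) (\<omega> x2) x y w
      + (- 2 * X) * wedge (B z) (\<omega> p1) x y w))"
    by (simp only:)
  have "2 * \<epsilon> \<noteq> 0"
    using two pp(1) by (simp add: \<epsilon>_def)
  show ?thesis
    by (rule coboundary_cancel[OF \<open>2 * \<epsilon> \<noteq> 0\<close>], unfold eq)
      (intro coboundary_add coboundary_mult coboundary_cob coboundary_central z)
qed

lemma coboundary_rank_two:
  assumes zt: "z \<in> Z" "t \<in> Z"
    and F: "\<And>x y w. \<omega> x y w = wedge (B z) (wedge2 (B c) (B e)) x y w + wedge (B t) (wedge2 (B c) (B f)) x y w
      + k * wedge (B z) (wedge2 (B t) (B a)) x y w + b1 * wedge (B z) (wedge2 (B t) (B f)) x y w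
      + b2 * wedge (B z) (wedge2 (B t) (B e)) x y w + b3 * wedge (B z) (wedge2 (B t) (B c)) x y w"
    and u: "B z u = 1" "B t u = 0" "B c u = 0" "B e u = 0" "B f u = 0" "B a u = 0"
    and v: "B z v = 0" "B t v = 1" "B c v = 0" "B e v = 0" "B f v = 0" "B a v = 0"
    and a: "B z a = 0" "B t a = 0" "B c a = 1" "B e a = 0" "B f a = 0" "B a a = 0"
    and a': "B z a' = 0" "B t a' = 0" "B c a' = 0" "B e a' = 0" "B f a' = 1" "B a a' = 0"
    and c: "B z c = 0" "B t c = 0" "B c c = 0" "B e c = 0" "B f c = 0"
  shows "coboundary \<omega>"
proof -
  have ac: "B a c = 1"
    using a by (simp add: form_sym)
  note vals = u v a a' c ac
  \<comment> \<open>The terms with u and v count factors z and t with weight 2, the rotation counts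
    c minus a. The totals are 3 on the first three summands and 4, 4, 5 on the others; contractions
    with a and a' remove the excess 1, 1, 2.\<close>
  have eq: "3 * \<omega> x y w = 2 * wedge (B z) (\<omega> u) x y w + (2 * wedge (B t) (\<omega> v) x y w + (cob c a x y w
      + b1 * wedge (B z) (\<omega> a) x y w + (- b2) * wedge (B t) (\<omega> a) x y w
      + (- 2 * b3) * wedge (B z) (\<omega> a') x y w))" for x y w
    unfolding cob_def wedge_def F wedge2_def vals by algebra
  show ?thesis
    by (rule coboundary_cancel[OF three], unfold eq)
      (intro coboundary_add coboundary_mult coboundary_cob coboundary_central zt)
qed

end

section \<open>Isotropic center of dimension one\<close>

text \<open>The cross product of the two coefficient rows, unless its first component is zero. Then
  the rows without their first entries are proportional, and a solution with c0 = 0 exists.\<close>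

lemma two_equations_three_unknowns:
  fixes \<beta>0 \<beta>1 \<beta>2 \<gamma>0 \<gamma>1 \<gamma>2 :: "'k::field"
  obtains c0 c1 c2 where "c0 \<noteq> 0 \<or> c1 \<noteq> 0 \<or> c2 \<noteq> 0"
    "c0 * \<beta>0 + c1 * \<beta>1 + c2 * \<beta>2 = 0" "c0 * \<gamma>0 + c1 * \<gamma>1 + c2 * \<gamma>2 = 0"
proof (cases "\<beta>1 * \<gamma>2 - \<beta>2 * \<gamma>1 = 0")
  case False
  show thesis
    by (rule that[of "\<beta>1 * \<gamma>2 - \<beta>2 * \<gamma>1" "\<beta>2 * \<gamma>0 - \<beta>0 * \<gamma>2" "\<beta>0 * \<gamma>1 - \<beta>1 * \<gamma>0"])
      (use False in \<open>auto simp: algebra_simps\<close>)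
next
  case True
  consider "\<beta>1 \<noteq> 0 \<or> \<beta>2 \<noteq> 0" | "\<beta>1 = 0" "\<beta>2 = 0" "\<gamma>1 \<noteq> 0 \<or> \<gamma>2 \<noteq> 0"
    | "\<beta>1 = 0" "\<beta>2 = 0" "\<gamma>1 = 0" "\<gamma>2 = 0"
    by blast
  then show thesis
  proof cases
    case 1
    show thesis
      by (rule that[of 0 "\<beta>2" "- \<beta>1"]) (use 1 True in \<open>auto simp: algebra_simps\<close>)
  next
    case 2
    show thesis
      by (rule that[of 0 "\<gamma>2" "- \<gamma>1"]) (use 2 in \<open>auto simp: algebra_simps\<close>)
  next
    case 3
    show thesis
      by (rule that[of 0 1 0]) (use 3 in auto)
  qed
qed

context metric_3solvable
begin

text \<open>\<open>q\<close> represents all of A modulo the center, so x is orthogonal to A and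
  therefore central.\<close>

lemma core_nondegenerate:
  assumes "core q" "x \<in> q" "\<And>y. y \<in> q \<Longrightarrow> B x y = 0"
  shows "x = 0"
proof -
  have x: "x \<in> A"
    using assms(1,2) by (auto simp: core_def)
  have "x \<in> Z"
  proof (rule mem_ZI)
    fix a assume "a \<in> A"
    then obtain y where y: "y \<in> q" "a - y \<in> Z"
      using assms(1) by (auto simp: core_def)
    then show "B x a = 0"
      using assms(3)[OF y(1)] form_A_Z[OF y(2) x] by (simp add: form_simps)
  qed
  then show ?thesis
    using assms(1,2) by (auto simp: core_def)
qed

section \<open>One central vector \<open>z\<close>, a dual vector \<open>u\<close> and the
  complement \<open>q\<close>\<close>

context
  fixes q z u
  assumes core: "core q" and dim: "dim q \<le> 6"
    and z: "z \<in> Z" "z \<in> A" and zu: "B z u = 1"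
    and qu: "\<And>x. x \<in> q \<Longrightarrow> B x u = 0"
    and dec: "\<And>x. B z x = 0 \<Longrightarrow> \<exists>y\<in>q. x - y \<in> Z"
begin

lemma rank_one_A: "x \<in> q \<Longrightarrow> x \<in> A"
  using core by (auto simp: core_def)

lemma rank_one_subspace: "subspace q"
  using core by (simp add: core_def)

lemma rank_one_perp: "x \<in> q \<Longrightarrow> B z x = 0"
  using form_Z_A[OF z(1) rank_one_A] .

lemma rank_one_decompose:
  obtains y where "y \<in> q" "x - (scale (B z x) u + y) \<in> Z" "\<forall>p\<in>q. B p x = B p y"
proof -
  have "B z (x - scale (B z x) u) = 0"
    by (simp add: form_simps zu)
  then obtain y where y: "y \<in> q" "x - scale (B z x) u - y \<in> Z"
    using dec by blast
  have "B p x = B p y" if "p \<in> q" for p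
    using form_A_Z[OF y(2) rank_one_A[OF that]] qu[OF that] by (simp add: form_simps)
  then show thesis
    using that[of y] y by (simp add: diff_diff_eq)
qed

context
  fixes a1 a2 a3 p1 p2 p3
  assumes nt: "normal_triple q a1 a2 a3 p1 p2 p3"
begin

lemma normal_triple_imp_triple: "triple q a1 a2 a3 p1 p2 p3"
  using nt by (simp add: normal_triple_def)

lemmas normal_triple_mem = triple_mem[OF core normal_triple_imp_triple] and normal_triple_dual = triple_dual[OF core normal_triple_imp_triple]

lemma normal_triple_gram: "B p1 p2 = 0" "B p1 p3 = 0" "B p2 p2 = 0" "B p2 p3 = 0" "B p3 p3 = 0"
  "B p2 p1 = 0" "B p3 p1 = 0" "B p3 p2 = 0"
  using nt
  by (simp_all add: normal_triple_def form_sym[of p2 p1] form_sym[of p3 p1] form_sym[of p3 p2])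

text \<open>Modulo the center each argument is a multiple of u plus a vector of \<open>q\<close>.
  Values with two u's vanish, those with one give the first summand, and the rest is the
  decomposable restriction to A.\<close>

lemma \<omega>_formula:
  "\<omega> x y w = wedge (B z) (\<omega> u) x y w + wedge (B p1) (wedge2 (B p2) (B p3)) x y w"
proof -
  obtain x' where x': "x' \<in> q" "x - (scale (B z x) u + x') \<in> Z" "\<forall>p\<in>q. B p x = B p x'"
    by (rule rank_one_decompose[of x])
  obtain y' where y': "y' \<in> q" "y - (scale (B z y) u + y') \<in> Z" "\<forall>p\<in>q. B p y = B p y'"
    by (rule rank_one_decompose[of y])
  obtain w' where w': "w' \<in> q" "w - (scale (B z w) u + w') \<in> Z" "\<forall>p\<in>q. B p w = B p w'"
    by (rule rank_one_decompose[of w])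
  have D: "\<omega> x' y' w' = wedge (B p1) (wedge2 (B p2) (B p3)) x y w"
    by (simp add: triple_\<omega>_A[OF core normal_triple_imp_triple dim rank_one_A rank_one_A rank_one_A] x' y' w' wedge_def wedge2_def normal_triple_mem)
  have u: "\<omega> u a b = \<omega> u a' b'" if "a - (scale s u + a') \<in> Z" "b - (scale r u + b') \<in> Z" for a b a' b' s r
    by (subst \<omega>_cong_Z[OF _ that, of u u]) (simp_all add: \<omega>_simps subspace_0[OF subspace_Z])
  show ?thesis
    unfolding D[symmetric]
    unfolding wedge_def u[OF y'(2) w'(2)] u[OF w'(2) x'(2)] u[OF x'(2) y'(2)]
    by (subst \<omega>_cong_Z[OF x'(2) y'(2) w'(2)])
      (simp add: \<omega>_simps \<omega>_cyc[of u] \<omega>_cyc[of x' y' u])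
qed

lemma \<omega>_u_eq:
  assumes "y - (scale s u + y') \<in> Z" "w - (scale r u + w') \<in> Z"
  shows "\<omega> u y w = \<omega> u y' w'"
  by (subst \<omega>_cong_Z[OF _ assms, of u u]) (simp_all add: \<omega>_simps subspace_0[OF subspace_Z])

lemma K_\<omega>: "k \<in> K q p1 p2 p3 \<Longrightarrow> x \<in> A \<Longrightarrow> y \<in> A \<Longrightarrow> \<omega> k x y = 0"
  using triple_kernel[OF core normal_triple_imp_triple dim] by (simp add: mem_K)

lemma K_perp_M: "k \<in> K q p1 p2 p3 \<Longrightarrow> m \<in> M \<Longrightarrow> B k m = 0"
proof -
  assume k: "k \<in> K q p1 p2 p3" and m: "m \<in> M"
  have f: "functional scale (B k)"
    using form_bilinear by (simp add: bilinear_form_def)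
  show "B k m = 0"
    by (rule functional_vanishes_on_span[OF f _ m[unfolded M_def bracket_span_def]])
      (use K_\<omega>[OF k] in \<open>auto simp: form_bracket\<close>)
qed

text \<open>\<open>K\<close> is orthogonal to \<open>M\<close>, and brackets with u carry brackets
  of A into \<open>M\<close> by Jacobi. By invariance [u, k] is then orthogonal to p1, p2, p3, which
  lie in \<open>M\<close> modulo the center.\<close>

lemma K_invariant:
  assumes k: "k \<in> K q p1 p2 p3"
  obtains k' where "k' \<in> K q p1 p2 p3" "bracket u k - k' \<in> Z" "\<And>x. x \<in> A \<Longrightarrow> B k' x = \<omega> u k x"
proof -
  obtain k' where k': "k' \<in> q" "bracket u k - k' \<in> Z"
    using core bracket_mem_A[of u k] unfolding core_def by blast
  have Bk': "B k' x = \<omega> u k x" if "x \<in> A" for x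
    using form_Z_A[OF k'(2) that] by (simp add: form_simps \<omega>_def)
  have "\<omega> u k p = 0" if "p - bracket a b \<in> Z" "a \<in> A" "b \<in> A" for p a b
  proof -
    have "\<omega> u k p = \<omega> u k (bracket a b)"
      using \<omega>_cong_Z[OF _ _ that(1), of u u k k] subspace_0[OF subspace_Z] by simp
    also have "\<dots> = \<omega> k (bracket a b) u"
      using \<omega>_cyc[of k "bracket a b" u] by simp
    also have "\<dots> = B k (bracket (bracket a b) u)"
      by (simp add: \<omega>_def form_invariant)
    also have "bracket (bracket a b) u \<in> M"
      unfolding jacobi_right[of a b u] using that(2,3)
      by (intro subspace_diff[OF subspace_M] bracket_mem_M) simp_all
    then have "B k (bracket (bracket a b) u) = 0"
      by (rule K_perp_M[OF k])
    finally show ?thesis .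
  qed
  then have "\<omega> u k p1 = 0" "\<omega> u k p2 = 0" "\<omega> u k p3 = 0"
    using normal_triple_imp_triple normal_triple_mem unfolding triple_def by blast+
  then have "k' \<in> K q p1 p2 p3"
    using k' Bk' normal_triple_mem by (simp add: mem_K form_sym[of _ k'])
  then show thesis
    using that k'(2) Bk' by blast
qed

text \<open>Both summands of \<open>\<omega>_formula\<close> vanish when k is an argument, so k is
  central, and \<open>q\<close> meets the center only in 0.\<close>

lemma K_injective:
  assumes k: "k \<in> K q p1 p2 p3" and u: "\<And>x. x \<in> A \<Longrightarrow> \<omega> u k x = 0"
  shows "k = 0"
proof -
  have kq: "k \<in> q" "B p1 k = 0" "B p2 k = 0" "B p3 k = 0"
    using k by (auto simp: mem_K)
  have u': "\<omega> u k y = 0" for y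
  proof -
    obtain y' where y': "y' \<in> q" "y - (scale (B z y) u + y') \<in> Z"
      using rank_one_decompose by blast
    have "\<omega> u k y = \<omega> u k y'"
      by (rule \<omega>_u_eq[of _ 0, OF _ y'(2)]) (simp add: subspace_0[OF subspace_Z])
    then show ?thesis
      using u[OF rank_one_A[OF y'(1)]] by simp
  qed
  then have u'': "\<omega> u y k = 0" for y
    using \<omega>_swap23[of u y k] by simp
  have "\<omega> k y w = 0" for y w
    unfolding \<omega>_formula[of k] using kq rank_one_perp[OF kq(1)] by (simp add: wedge_def wedge2_def u' u'')
  then have "k \<in> Z"
    unfolding mem_Z_iff_\<omega> by blast
  then show ?thesis
    using kq(1) core by (auto simp: core_def)
qed

lemma \<omega>_u_pp: "p \<in> {p1, p2, p3} \<Longrightarrow> r \<in> {p1, p2, p3} \<Longrightarrow> \<omega> u p r = 0"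
  using \<omega>_P(3) triple_P[OF core normal_triple_imp_triple] by blast

lemma normal_triple_decompose:
  assumes "x \<in> q"
  shows "x - (scale (B p1 x) a1 + scale (B p2 x) a2 + scale (B p3 x) a3) \<in> K q p1 p2 p3"
  using assms normal_triple_mem rank_one_subspace
  by (auto simp: mem_K form_simps normal_triple_dual subspace_add subspace_diff subspace_scale)

text \<open>All p's are isotropic and mutually orthogonal, so they lie in \<open>K\<close> and span
  it, its dimension being at most 3. They complete to a hyperbolic basis of \<open>q\<close>. Since
  \<open>P q\<close> is abelian, u has no component on a product of two forms \<open>B x_i\<close>,
  as \<open>coboundary_isotropic\<close> requires.\<close>

lemma normal_triple_isotropic:
  assumes p11: "B p1 p1 = 0"
  shows "coboundary \<omega>"
proof -
  have "{p1, p2, p3} \<subseteq> K q p1 p2 p3"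
    using normal_triple_mem normal_triple_gram p11 by (auto simp: mem_K)
  then have spK: "span {p1, p2, p3} = K q p1 p2 p3"
    using dim_dual_3[OF core normal_triple_imp_triple] dim_K[OF core normal_triple_imp_triple] dim
    by (intro subspace_dim_equal subspace_span subspace_K rank_one_subspace span_minimal) simp_all
  define h where "h = (1/2 :: 'a)"
  have h: "h + h = 1"
    using two by (simp add: h_def flip: mult_2)
  \<comment> \<open>Subtracting half the Gram matrix of the a's in terms of the dual p's makes x1,
    x2, x3 isotropic and mutually orthogonal.\<close>
  define x1 where "x1 = a1 - scale (h * B a1 a1) p1 - scale (h * B a1 a2) p2 - scale (h * B a1 a3) p3"
  define x2 where "x2 = a2 - scale (h * B a1 a2) p1 - scale (h * B a2 a2) p2 - scale (h * B a2 a3) p3"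
  define x3 where "x3 = a3 - scale (h * B a1 a3) p1 - scale (h * B a2 a3) p2 - scale (h * B a3 a3) p3"
  have normal_triple_dual': "B a1 p1 = 1" "B a1 p2 = 0" "B a1 p3 = 0" "B a2 p1 = 0" "B a2 p2 = 1" "B a2 p3 = 0"
    "B a3 p1 = 0" "B a3 p2 = 0" "B a3 p3 = 1"
    using normal_triple_dual by (simp_all add: form_sym)
  have xq: "x1 \<in> q" "x2 \<in> q" "x3 \<in> q"
    unfolding x1_def x2_def x3_def using normal_triple_mem rank_one_subspace by (simp_all add: subspace_diff subspace_scale)
  have px: "B p1 x1 = 1" "B p1 x2 = 0" "B p1 x3 = 0" "B p2 x1 = 0" "B p2 x2 = 1" "B p2 x3 = 0"
      "B p3 x1 = 0" "B p3 x2 = 0" "B p3 x3 = 1"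
    unfolding x1_def x2_def x3_def by (simp_all add: form_simps normal_triple_dual normal_triple_gram p11)
  have hh: "c - h * c - h * c = 0" for c
    using h by (simp flip: diff_diff_eq2 distrib_right add: diff_diff_eq)
  have xx: "B x1 x1 = 0" "B x1 x2 = 0" "B x1 x3 = 0" "B x2 x2 = 0" "B x2 x3 = 0" "B x3 x3 = 0"
    unfolding x1_def x2_def x3_def
    by (simp_all add: form_simps normal_triple_dual normal_triple_dual' normal_triple_gram p11 form_sym[of a2 a1] form_sym[of a3 a1] form_sym[of a3 a2] hh)
  have xx': "B x2 x1 = 0" "B x3 x1 = 0" "B x3 x2 = 0"
    and px': "B x1 p1 = 1" "B x1 p2 = 0" "B x1 p3 = 0" "B x2 p1 = 0" "B x2 p2 = 1" "B x2 p3 = 0"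
    "B x3 p1 = 0" "B x3 p2 = 0" "B x3 p3 = 1"
    using xx px by (simp_all add: form_sym)
  have expand: "y = scale (B p1 y) x1 + scale (B p2 y) x2 + scale (B p3 y) x3 +
      (scale (B x1 y) p1 + scale (B x2 y) p2 + scale (B x3 y) p3)" if y: "y \<in> q" for y
  proof -
    let ?r = "y - (scale (B p1 y) x1 + scale (B p2 y) x2 + scale (B p3 y) x3)"
    have "?r \<in> K q p1 p2 p3"
      using y xq rank_one_subspace by (simp add: mem_K form_simps px subspace_diff subspace_add subspace_scale)
    then have "?r \<in> span {p3, p2, p1}"
      by (simp add: spK[symmetric] insert_commute)
    then obtain c3 c2 c1 where "?r - scale c3 p3 - scale c2 p2 - scale c1 p1 = 0"
      by (auto simp: span_breakdown_eq)
    then have r: "?r = scale c1 p1 + scale c2 p2 + scale c3 p3"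
      by (simp add: diff_eq_eq add.commute)
    have "B x1 ?r = c1" "B x2 ?r = c2" "B x3 ?r = c3"
      unfolding r by (simp_all add: form_simps px')
    then have "c1 = B x1 y" "c2 = B x2 y" "c3 = B x3 y"
      by (simp_all add: form_simps xx xx')
    with r show ?thesis
      by (simp add: diff_eq_eq add.commute)
  qed
  have Fu: "\<omega> u y w =
      \<omega> u x1 x2 * wedge2 (B p1) (B p2) y w + \<omega> u x1 x3 * wedge2 (B p1) (B p3) y w
      + \<omega> u x2 x3 * wedge2 (B p2) (B p3) y w
      + \<omega> u x1 p1 * wedge2 (B p1) (B x1) y w + \<omega> u x1 p2 * wedge2 (B p1) (B x2) y w
      + \<omega> u x1 p3 * wedge2 (B p1) (B x3) y w
      + \<omega> u x2 p1 * wedge2 (B p2) (B x1) y w + \<omega> u x2 p2 * wedge2 (B p2) (B x2) y w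
      + \<omega> u x2 p3 * wedge2 (B p2) (B x3) y w
      + \<omega> u x3 p1 * wedge2 (B p3) (B x1) y w + \<omega> u x3 p2 * wedge2 (B p3) (B x2) y w
      + \<omega> u x3 p3 * wedge2 (B p3) (B x3) y w" for y w
  proof -
    obtain y' where y': "y' \<in> q" "y - (scale (B z y) u + y') \<in> Z" "\<forall>p\<in>q. B p y = B p y'"
      by (rule rank_one_decompose[of y])
    obtain w' where w': "w' \<in> q" "w - (scale (B z w) u + w') \<in> Z" "\<forall>p\<in>q. B p w = B p w'"
      by (rule rank_one_decompose[of w])
    have sw: "\<omega> u x2 x1 = - \<omega> u x1 x2" "\<omega> u x3 x1 = - \<omega> u x1 x3" "\<omega> u x3 x2 = - \<omega> u x2 x3"
      by (rule \<omega>_swap23)+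
    have sp: "\<omega> u p x1 = - \<omega> u x1 p" "\<omega> u p x2 = - \<omega> u x2 p" "\<omega> u p x3 = - \<omega> u x3 p" for p
      by (rule \<omega>_swap23)+
    show ?thesis
      unfolding \<omega>_u_eq[OF y'(2) w'(2)] wedge2_def y'(3)[rule_format, OF normal_triple_mem(4)] y'(3)[rule_format, OF normal_triple_mem(5)] y'(3)[rule_format, OF normal_triple_mem(6)]
        w'(3)[rule_format, OF normal_triple_mem(4)] w'(3)[rule_format, OF normal_triple_mem(5)] w'(3)[rule_format, OF normal_triple_mem(6)] y'(3)[rule_format, OF xq(1)] y'(3)[rule_format, OF xq(2)] y'(3)[rule_format, OF xq(3)]
        w'(3)[rule_format, OF xq(1)] w'(3)[rule_format, OF xq(2)] w'(3)[rule_format, OF xq(3)]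
      by (subst arg_cong2[OF expand[OF y'(1)] expand[OF w'(1)], of "\<omega> u"])
        (simp add: \<omega>_simps \<omega>_u_pp sw sp[of p1] sp[of p2] sp[of p3], algebra)
  qed
  show ?thesis
    by (rule coboundary_isotropic[OF z(1) \<omega>_formula Fu])
      (use px xx normal_triple_gram p11 rank_one_perp xq normal_triple_mem in simp_all)
qed

text \<open>Otherwise \<open>K\<close> is three-dimensional, and the action of \<open>u\<close> maps it injectively into the
  plane spanned by \<open>p\<^sub>2\<close> and \<open>p\<^sub>3\<close>.\<close>

lemma K_anisotropic:
  assumes p11: "B p1 p1 \<noteq> 0"
  shows "K q p1 p2 p3 = span {p2, p3}"
proof (rule ccontr)
  assume ne: "K q p1 p2 p3 \<noteq> span {p2, p3}"
  note K = subspace_K[OF rank_one_subspace, of p1 p2 p3]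
  have pK: "p2 \<in> K q p1 p2 p3" "p3 \<in> K q p1 p2 p3"
    using normal_triple_mem normal_triple_gram by (auto simp: mem_K)
  then have "span {p2, p3} \<subseteq> K q p1 p2 p3"
    by (intro span_minimal K) auto
  then obtain w where w: "w \<in> K q p1 p2 p3" "w \<notin> span {p2, p3}"
    using ne by blast
  have "dim {p1, p2, p3} \<le> dim {p2, p3} + 1"
    by (simp add: dim_insert)
  then have "dim {w, p2, p3} \<ge> 3"
    using dim_dual_3[OF core normal_triple_imp_triple] w(2) dim_insert[of w "{p2, p3}"] by simp
  then have spK: "span {w, p2, p3} = K q p1 p2 p3"
    using w(1) pK dim_K[OF core normal_triple_imp_triple] dim
    by (intro subspace_dim_equal subspace_span K span_minimal) simp_all
  have KE: "\<exists>\<alpha> \<beta> \<gamma>. k = scale \<alpha> w + scale \<beta> p2 + scale \<gamma> p3" if "k \<in> K q p1 p2 p3" for k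
  proof -
    have "k \<in> span {p3, p2, w}"
      using that by (simp add: spK[symmetric] insert_commute)
    then obtain \<alpha> \<beta> \<gamma> where "k - scale \<gamma> p3 - scale \<beta> p2 - scale \<alpha> w = 0"
      by (auto simp: span_breakdown_eq)
    then have "k = scale \<alpha> w + scale \<beta> p2 + scale \<gamma> p3"
      by (simp add: diff_eq_eq add.commute)
    then show ?thesis
      by blast
  qed
  have pw: "B p1 w = 0" "B p2 w = 0" "B p3 w = 0" "w \<in> q"
    using w(1) by (auto simp: mem_K)
  then have wp: "B w p1 = 0" "B w p2 = 0" "B w p3 = 0"
    by (simp_all add: form_sym[of w])
  \<comment> \<open>If w were isotropic, nondegeneracy on \<open>q\<close> would make it a
    combination of p1, p2, p3. Orthogonality to p1 excludes p1, contradicting the choice of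
    w.\<close>
  have ww: "B w w \<noteq> 0"
  proof
    assume ww: "B w w = 0"
    let ?w = "w - (scale (B a1 w) p1 + scale (B a2 w) p2 + scale (B a3 w) p3)"
    have "?w = 0"
    proof (rule core_nondegenerate[OF core])
      show "?w \<in> q"
        using pw(4) normal_triple_mem rank_one_subspace by (simp add: subspace_diff subspace_add subspace_scale)
      fix y assume y: "y \<in> q"
      obtain k where k: "k \<in> K q p1 p2 p3" "y = scale (B p1 y) a1 + scale (B p2 y) a2 + scale (B p3 y) a3 + k"
        using normal_triple_decompose[OF y] by (metis diff_add_cancel add.commute)
      obtain \<alpha> \<beta> \<gamma> where "k = scale \<alpha> w + scale \<beta> p2 + scale \<gamma> p3"
        using KE[OF k(1)] by blast
      then have "B ?w k = 0"
        by (simp add: form_simps ww wp pw normal_triple_gram)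
      moreover have "B ?w a1 = 0" "B ?w a2 = 0" "B ?w a3 = 0"
        by (simp_all add: form_simps normal_triple_dual form_sym[of w])
      ultimately show "B ?w y = 0"
        by (subst k(2)) (simp only: form_simps, simp)
    qed
    then have eq: "w = scale (B a1 w) p1 + scale (B a2 w) p2 + scale (B a3 w) p3"
      by simp
    have "B a1 w * B p1 p1 = 0"
      using pw(1) by (subst (asm) eq) (simp add: form_simps normal_triple_gram)
    then have "w = scale (B a2 w) p2 + scale (B a3 w) p3"
      using p11 eq by simp
    then show False
      using w(2) by (metis span_add span_scale span_base insertCI)
  qed
  \<comment> \<open>As w is anisotropic and orthogonal to the p's, \<omega>(u, k, w) detects the w
    component of [u, k].\<close>
  have image: "\<exists>\<beta> \<gamma>. \<forall>x\<in>A. \<omega> u k x = \<beta> * B p2 x + \<gamma> * B p3 x"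
    if k: "k \<in> K q p1 p2 p3" "\<omega> u k w = 0" for k
  proof -
    obtain k' where k': "k' \<in> K q p1 p2 p3" "\<And>x. x \<in> A \<Longrightarrow> B k' x = \<omega> u k x"
      using K_invariant[OF k(1)] by metis
    obtain \<alpha> \<beta> \<gamma> where abc: "k' = scale \<alpha> w + scale \<beta> p2 + scale \<gamma> p3"
      using KE[OF k'(1)] by blast
    have "B k' w = 0"
      using k'(2)[OF rank_one_A[OF pw(4)]] k(2) by simp
    then have "\<alpha> = 0"
      using ww pw by (simp add: abc form_simps)
    then have "\<omega> u k x = \<beta> * B p2 x + \<gamma> * B p3 x" if "x \<in> A" for x
      using k'(2)[OF that] by (simp add: abc form_simps)
    then show ?thesis
      by blast
  qed
  obtain \<beta>0 \<gamma>0 where i0: "\<forall>x\<in>A. \<omega> u w x = \<beta>0 * B p2 x + \<gamma>0 * B p3 x"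
    using image[OF w(1)] by auto
  then have uw: "\<omega> u w p2 = 0" "\<omega> u w p3 = 0"
    using normal_triple_mem normal_triple_gram by simp_all
  then have "\<omega> u p2 w = 0" "\<omega> u p3 w = 0"
    using \<omega>_swap23[of u p2 w] \<omega>_swap23[of u p3 w] by simp_all
  then obtain \<beta>1 \<gamma>1 \<beta>2 \<gamma>2 where i1: "\<forall>x\<in>A. \<omega> u p2 x = \<beta>1 * B p2 x + \<gamma>1 * B p3 x"
    and i2: "\<forall>x\<in>A. \<omega> u p3 x = \<beta>2 * B p2 x + \<gamma>2 * B p3 x"
    using image[OF pK(1)] image[OF pK(2)] by blast
  obtain c0 c1 c2 where c: "c0 \<noteq> 0 \<or> c1 \<noteq> 0 \<or> c2 \<noteq> 0"
    "c0 * \<beta>0 + c1 * \<beta>1 + c2 * \<beta>2 = 0" "c0 * \<gamma>0 + c1 * \<gamma>1 + c2 * \<gamma>2 = 0"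
    by (rule two_equations_three_unknowns[of \<beta>0 \<beta>1 \<beta>2 \<gamma>0 \<gamma>1 \<gamma>2])
  let ?k = "scale c0 w + scale c1 p2 + scale c2 p3"
  have "?k = 0"
  proof (rule K_injective)
    show "?k \<in> K q p1 p2 p3"
      using w(1) pK K by (simp add: subspace_add subspace_scale)
    fix x assume x: "x \<in> A"
    have "\<omega> u ?k x = (c0 * \<beta>0 + c1 * \<beta>1 + c2 * \<beta>2) * B p2 x + (c0 * \<gamma>0 + c1 * \<gamma>1 + c2 * \<gamma>2) * B p3 x"
      using i0 i1 i2 x by (simp add: \<omega>_simps algebra_simps)
    then show "\<omega> u ?k x = 0"
      using c(2,3) by simp
  qed
  then have "B ?k w = 0" "B ?k a2 = 0" "B ?k a3 = 0"
    by (simp_all add: form_simps)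
  then have "c0 = 0" "c0 * B w a2 + c1 = 0" "c0 * B w a3 + c2 = 0"
    using ww by (simp_all add: form_simps pw normal_triple_dual)
  then show False
    using c(1) by auto
qed

text \<open>Here p1 takes the place of x1: it is anisotropic and orthogonal to the other basis
  vectors, and with \<open>K_anisotropic\<close> the vectors p1, x2, x3, p2, p3 span
  \<open>q\<close>.\<close>

lemma normal_triple_anisotropic:
  assumes p11: "B p1 p1 \<noteq> 0"
  shows "coboundary \<omega>"
proof -
  define h where "h = (1/2 :: 'a)"
  have h: "h + h = 1"
    using two by (simp add: h_def flip: mult_2)
  define x2 where "x2 = a2 - scale (h * B a2 a2) p2 - scale (h * B a2 a3) p3"
  define x3 where "x3 = a3 - scale (h * B a2 a3) p2 - scale (h * B a3 a3) p3"
  have normal_triple_dual': "B a2 p2 = 1" "B a2 p3 = 0" "B a3 p2 = 0" "B a3 p3 = 1"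
    using normal_triple_dual by (simp_all add: form_sym)
  have xq: "x2 \<in> q" "x3 \<in> q"
    unfolding x2_def x3_def using normal_triple_mem rank_one_subspace by (simp_all add: subspace_diff subspace_scale)
  have px: "B p1 x2 = 0" "B p1 x3 = 0" "B p2 x2 = 1" "B p2 x3 = 0" "B p3 x2 = 0" "B p3 x3 = 1"
    unfolding x2_def x3_def by (simp_all add: form_simps normal_triple_dual normal_triple_gram)
  have hh: "c - h * c - h * c = 0" for c
    using h by (simp flip: diff_diff_eq2 distrib_right add: diff_diff_eq)
  have xx: "B x2 x2 = 0" "B x2 x3 = 0" "B x3 x3 = 0"
    unfolding x2_def x3_def
    by (simp_all add: form_simps normal_triple_dual normal_triple_dual' normal_triple_gram form_sym[of a3 a2] hh)
  have xx': "B x3 x2 = 0"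
    and px': "B x2 p1 = 0" "B x2 p2 = 1" "B x2 p3 = 0" "B x3 p1 = 0" "B x3 p2 = 0" "B x3 p3 = 1"
    using xx px by (simp_all add: form_sym)
  have expand: "y = scale (B p1 y / B p1 p1) p1 + scale (B p2 y) x2 + scale (B p3 y) x3 +
      (scale (B x2 y) p2 + scale (B x3 y) p3)" if y: "y \<in> q" for y
  proof -
    let ?r = "y - (scale (B p1 y / B p1 p1) p1 + scale (B p2 y) x2 + scale (B p3 y) x3)"
    have "?r \<in> K q p1 p2 p3"
      using y xq normal_triple_mem rank_one_subspace p11
      by (simp add: mem_K form_simps px normal_triple_gram subspace_diff subspace_add subspace_scale)
    then have "?r \<in> span {p3, p2}"
      by (simp add: K_anisotropic[OF p11] insert_commute)
    then obtain c3 c2 where "?r - scale c3 p3 - scale c2 p2 = 0"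
      by (auto simp: span_breakdown_eq)
    then have r: "?r = scale c2 p2 + scale c3 p3"
      by (simp add: diff_eq_eq add.commute)
    have "B x2 ?r = c2" "B x3 ?r = c3"
      unfolding r by (simp_all add: form_simps px')
    then have "c2 = B x2 y" "c3 = B x3 y"
      by (simp_all add: form_simps xx xx' px')
    with r show ?thesis
      by (simp add: diff_eq_eq add.commute)
  qed
  have Fu: "\<omega> u y w = \<omega> u x2 x3 * wedge2 (B p2) (B p3) y w
      + \<omega> u x2 p2 * wedge2 (B p2) (B x2) y w + \<omega> u x2 p3 * wedge2 (B p2) (B x3) y w
      + \<omega> u x3 p2 * wedge2 (B p3) (B x2) y w + \<omega> u x3 p3 * wedge2 (B p3) (B x3) y w
      + (\<omega> u x2 p1 / B p1 p1) * wedge2 (B p2) (B p1) y w + (\<omega> u x3 p1 / B p1 p1) * wedge2 (B p3) (B p1) y w"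
    for y w
  proof -
    obtain y' where y': "y' \<in> q" "y - (scale (B z y) u + y') \<in> Z" "\<forall>p\<in>q. B p y = B p y'"
      by (rule rank_one_decompose[of y])
    obtain w' where w': "w' \<in> q" "w - (scale (B z w) u + w') \<in> Z" "\<forall>p\<in>q. B p w = B p w'"
      by (rule rank_one_decompose[of w])
    have sw: "\<omega> u x3 x2 = - \<omega> u x2 x3"
      by (rule \<omega>_swap23)
    have sp: "\<omega> u p x2 = - \<omega> u x2 p" "\<omega> u p x3 = - \<omega> u x3 p" for p
      by (rule \<omega>_swap23)+
    define \<delta> where "\<delta> = 1 / B p1 p1"
    have \<delta>: "c / B p1 p1 = c * \<delta>" for c
      by (simp add: \<delta>_def)
    show ?thesis
      unfolding \<omega>_u_eq[OF y'(2) w'(2)] wedge2_def y'(3)[rule_format, OF normal_triple_mem(4)]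
        y'(3)[rule_format, OF normal_triple_mem(5)] y'(3)[rule_format, OF normal_triple_mem(6)]
        w'(3)[rule_format, OF normal_triple_mem(4)] w'(3)[rule_format, OF normal_triple_mem(5)] w'(3)[rule_format, OF normal_triple_mem(6)]
        y'(3)[rule_format, OF xq(1)] y'(3)[rule_format, OF xq(2)]
        w'(3)[rule_format, OF xq(1)] w'(3)[rule_format, OF xq(2)]
      by (subst arg_cong2[OF expand[OF y'(1)] expand[OF w'(1)], of "\<omega> u"], unfold \<delta>)
        (simp add: \<omega>_simps \<omega>_u_pp sw sp[of p1] sp[of p2] sp[of p3], algebra)
  qed
  show ?thesis
    by (rule coboundary_anisotropic[OF z(1) \<omega>_formula Fu])
      (use px xx normal_triple_gram p11 rank_one_perp xq normal_triple_mem in simp_all)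
qed

end

text \<open>If \<omega> vanishes on A, it vanishes on the hyperplane orthogonal to z, whose vectors
  lie in \<open>q\<close> modulo the center. Otherwise a normal triple exists.\<close>

lemma coboundary_frame1: "coboundary \<omega>"
proof (cases "\<forall>a\<in>A. \<forall>b\<in>A. \<forall>c\<in>A. \<omega> a b c = 0")
  case True
  show ?thesis
  proof (rule coboundary_\<omega>_decomposable[OF z(1)])
    show "z \<noteq> 0"
      using zu by (auto simp: form_simps)
    fix x y w assume "B z x = 0" "B z y = 0" "B z w = 0"
    then obtain x' y' w' where "x' \<in> q" "x - x' \<in> Z" "y' \<in> q" "y - y' \<in> Z" "w' \<in> q" "w - w' \<in> Z"
      using dec by meson
    then show "\<omega> x y w = 0"
      using \<omega>_cong_Z[of x x' y y' w w'] True rank_one_A by simp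
  qed
next
  case False
  then obtain a b c where abc: "a \<in> A" "b \<in> A" "c \<in> A" "\<omega> a b c \<noteq> 0"
    by blast
  obtain a1 a2 a3 p1 p2 p3 where "triple q a1 a2 a3 p1 p2 p3"
    by (rule triple_exists[OF core abc])
  then obtain a1 a2 a3 p1 p2 p3 where "normal_triple q a1 a2 a3 p1 p2 p3"
    by (rule normal_triple_exists[OF core dim])
  then show ?thesis
    using normal_triple_isotropic normal_triple_anisotropic by blast
qed

end
end

section \<open>Isotropic center of dimension two\<close>

context metric_3solvable
begin

definition frame2 :: "'b set \<Rightarrow> 'b \<Rightarrow> 'b \<Rightarrow> 'b \<Rightarrow> 'b \<Rightarrow> bool" where
  "frame2 q z t u v \<longleftrightarrow> core q \<and> z \<in> Z \<and> t \<in> Z \<and> z \<in> A \<and> t \<in> A \<and>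
     B z u = 1 \<and> B z v = 0 \<and> B t u = 0 \<and> B t v = 1 \<and> (\<forall>x\<in>q. B x u = 0 \<and> B x v = 0) \<and>
     (\<forall>x. B z x = 0 \<longrightarrow> B t x = 0 \<longrightarrow> (\<exists>y\<in>q. x - y \<in> Z))"

lemma frame2_swap: "frame2 q z t u v \<Longrightarrow> frame2 q t z v u"
  unfolding frame2_def by blast

text \<open>Changing t compensates the change of u and keeps the pairs dual. This lets a multiple of
  v be removed from u.\<close>

lemma frame2_shear:
  assumes f: "frame2 q z t u v"
  shows "frame2 q z (t + scale s z) (u - scale s v) v"
proof -
  have dec: "\<exists>y\<in>q. x - y \<in> Z" if "B z x = 0" "B (t + scale s z) x = 0" for x
  proof -
    have "B t x = 0"
      using that by (simp add: form_simps)
    then show ?thesis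
      using f that(1) unfolding frame2_def by blast
  qed
  have "t + scale s z \<in> Z" "t + scale s z \<in> A"
    using f subspace_Z subspace_A by (auto simp: frame2_def subspace_add subspace_scale)
  moreover have "B z (u - scale s v) = 1" "B (t + scale s z) (u - scale s v) = 0" "B (t + scale s z) v = 1"
    "\<forall>x\<in>q. B x (u - scale s v) = 0"
    using f by (simp_all add: frame2_def form_simps)
  ultimately show ?thesis
    using f dec by (simp add: frame2_def)
qed

section \<open>Expansions relative to two dual pairs\<close>

context
  fixes q z t u v
  assumes fr: "frame2 q z t u v" and dim: "dim q \<le> 4"
begin

lemma frame2_core: "core q"
  using fr by (simp add: frame2_def)

lemma frame2_A: "x \<in> q \<Longrightarrow> x \<in> A"
  using frame2_core by (auto simp: core_def)

lemma frame2_subspace: "subspace q"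
  using frame2_core by (simp add: core_def)

lemma frame2_values: "z \<in> Z" "t \<in> Z" "z \<in> A" "t \<in> A" "B z u = 1" "B z v = 0" "B t u = 0" "B t v = 1"
  using fr by (auto simp: frame2_def)

lemma frame2_perp: "x \<in> q \<Longrightarrow> B x u = 0" "x \<in> q \<Longrightarrow> B x v = 0" "x \<in> q \<Longrightarrow> B z x = 0" "x \<in> q \<Longrightarrow> B t x = 0"
  using fr form_Z_A[OF frame2_values(1) frame2_A] form_Z_A[OF frame2_values(2) frame2_A]
  by (auto simp: frame2_def)

lemma frame2_\<omega>_A: "a \<in> A \<Longrightarrow> b \<in> A \<Longrightarrow> c \<in> A \<Longrightarrow> \<omega> a b c = 0"
  by (rule \<omega>_A_small[OF frame2_core dim])

lemma frame2_decompose: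
  obtains y where "y \<in> q" "x - (scale (B z x) u + scale (B t x) v + y) \<in> Z" "\<forall>p\<in>q. B p x = B p y"
proof -
  let ?x = "x - (scale (B z x) u + scale (B t x) v)"
  have "B z ?x = 0" "B t ?x = 0"
    by (simp_all add: form_simps frame2_values)
  then obtain y where y: "y \<in> q" "?x - y \<in> Z"
    using fr unfolding frame2_def by blast
  have "B p x = B p y" if "p \<in> q" for p
    using form_A_Z[OF y(2) frame2_A[OF that]] frame2_perp(1,2)[OF that] by (simp add: form_simps)
  then show thesis
    using that[of y] y by (simp add: diff_diff_eq)
qed

text \<open>Modulo the center the vectors orthogonal to z are combinations of v and
  \<open>q\<close>. As \<omega> vanishes on A and v acts trivially there, \<omega> vanishes on this
  hyperplane.\<close>

lemma frame2_divisible: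
  assumes "\<And>a b. a \<in> A \<Longrightarrow> b \<in> A \<Longrightarrow> \<omega> v a b = 0"
  shows "coboundary \<omega>"
proof (rule coboundary_\<omega>_decomposable[OF frame2_values(1)])
  show "z \<noteq> 0"
    using frame2_values(5) by (auto simp: form_simps)
  fix x y w assume z0: "B z x = 0" "B z y = 0" "B z w = 0"
  obtain x' where x': "x' \<in> q" "x - (scale (B z x) u + scale (B t x) v + x') \<in> Z"
    by (rule frame2_decompose[of x])
  obtain y' where y': "y' \<in> q" "y - (scale (B z y) u + scale (B t y) v + y') \<in> Z"
    by (rule frame2_decompose[of y])
  obtain w' where w': "w' \<in> q" "w - (scale (B z w) u + scale (B t w) v + w') \<in> Z"
    by (rule frame2_decompose[of w])
  have "\<omega> a v b = 0" "\<omega> a b v = 0" if "a \<in> A" "b \<in> A" for a b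
    using assms[OF that] \<omega>_swap12[of a v b] \<omega>_cyc[of a b v] by simp_all
  then show "\<omega> x y w = 0"
    by (subst \<omega>_cong_Z[OF x'(2) y'(2) w'(2)])
      (simp add: z0 \<omega>_simps assms frame2_\<omega>_A frame2_A x' y' w')
qed

text \<open>As \<omega> vanishes on A, at least one other argument must contribute u or v; the last
  term undoes the double count of the pair u, v.\<close>

lemma frame2_\<omega>_c:
  assumes c: "c \<in> A"
  shows "\<omega> c y w = wedge2 (B z) (\<omega> c u) y w + wedge2 (B t) (\<omega> c v) y w - \<omega> c u v * wedge2 (B z) (B t) y w"
proof -
  obtain y' where y': "y' \<in> q" "y - (scale (B z y) u + scale (B t y) v + y') \<in> Z"
    by (rule frame2_decompose[of y])
  obtain w' where w': "w' \<in> q" "w - (scale (B z w) u + scale (B t w) v + w') \<in> Z"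
    by (rule frame2_decompose[of w])
  have 1: "\<omega> c a y = B z y * \<omega> c a u + B t y * \<omega> c a v + \<omega> c a y'"
    "\<omega> c a w = B z w * \<omega> c a u + B t w * \<omega> c a v + \<omega> c a w'" for a
    by (subst \<omega>_cong_Z[OF _ _ y'(2), of c c a a] \<omega>_cong_Z[OF _ _ w'(2), of c c a a];
        simp add: subspace_0[OF subspace_Z] \<omega>_simps)+
  have 2: "\<omega> c y w = \<omega> c (scale (B z y) u + scale (B t y) v + y') (scale (B z w) u + scale (B t w) v + w')"
    by (rule \<omega>_cong_Z[OF _ y'(2) w'(2)]) (simp add: subspace_0[OF subspace_Z])
  have 3: "\<omega> c v u = - \<omega> c u v" "\<omega> c y' u = - \<omega> c u y'" "\<omega> c y' v = - \<omega> c v y'"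
    by (rule \<omega>_swap23)+
  have 4: "\<omega> c y' w' = 0"
    by (simp add: frame2_\<omega>_A c frame2_A y' w')
  show ?thesis
    unfolding 2 wedge2_def 1[of u] 1[of v] by (simp add: \<omega>_simps 3 4, algebra)
qed

text \<open>Wedging the expansion of the contraction by c with \<open>B z\<close> or
  \<open>B t\<close> leaves precisely these forms up to sign, and z and t are central.\<close>

lemma frame2_coboundary_brackets:
  assumes c: "c \<in> A"
  shows "coboundary (wedge (B z) (wedge2 (B t) (B (bracket c u))))"
    "coboundary (wedge (B z) (wedge2 (B t) (B (bracket c v))))"
proof -
  have e: "B (bracket c x) = \<omega> c x" for x
    by (simp add: fun_eq_iff \<omega>_def)
  have "wedge (B z) (wedge2 (B t) (\<omega> c v)) = wedge (B z) (\<omega> c)"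
  proof (intro ext)
    show "wedge (B z) (wedge2 (B t) (\<omega> c v)) x y w = wedge (B z) (\<omega> c) x y w" for x y w
      unfolding wedge_def frame2_\<omega>_c[OF c, of x y] frame2_\<omega>_c[OF c, of y w] frame2_\<omega>_c[OF c, of w x] wedge2_def
      by algebra
  qed
  then show "coboundary (wedge (B z) (wedge2 (B t) (B (bracket c v))))"
    unfolding e using coboundary_central[OF frame2_values(1)] by simp
  have "wedge (B z) (wedge2 (B t) (\<omega> c u)) = (\<lambda>x y w. - 1 * wedge (B t) (\<omega> c) x y w)"
  proof (intro ext)
    show "wedge (B z) (wedge2 (B t) (\<omega> c u)) x y w = - 1 * wedge (B t) (\<omega> c) x y w" for x y w
      unfolding wedge_def frame2_\<omega>_c[OF c, of x y] frame2_\<omega>_c[OF c, of y w] frame2_\<omega>_c[OF c, of w x] wedge2_def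
      by algebra
  qed
  then show "coboundary (wedge (B z) (wedge2 (B t) (B (bracket c u))))"
    unfolding e using coboundary_mult[OF coboundary_central[OF frame2_values(2)], of "- 1"] by metis
qed

text \<open>[u, v] lies in A, where \<omega> vanishes, so the Jacobi identity makes the two actions
  on A commute.\<close>

lemma frame2_commute:
  assumes "x \<in> A" "y \<in> A"
  shows "\<omega> u (bracket v x) y = \<omega> v (bracket u x) y"
proof -
  have "\<omega> (bracket u v) x y = 0"
    using assms by (simp add: frame2_\<omega>_A)
  then show ?thesis
    unfolding \<omega>_def jacobi_right[of u v x] by (simp add: form_simps)
qed

lemma frame2_projection:
  obtains p where "p \<in> q" "bracket x y - p \<in> Z" "\<forall>a\<in>A. B p a = \<omega> x y a"
proof -
  obtain p where p: "p \<in> q" "bracket x y - p \<in> Z"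
    using frame2_core bracket_mem_A[of x y] unfolding core_def by blast
  have "B p a = \<omega> x y a" if "a \<in> A" for a
    using form_Z_A[OF p(2) that] by (simp add: form_simps \<omega>_def)
  then show thesis
    using that p by blast
qed

text \<open>The operators \<open>[u, \<cdot>]\<close> and \<open>[v, \<cdot>]\<close> commute modulo the center. This forces the vector \<open>e0\<close> representing both
  \<open>[b, v]\<close> and \<open>[d, u]\<close> to be an isotropic multiple of \<open>c\<close>, so that \<open>u\<close> and \<open>v\<close> act as \<open>e0 \<and> e\<close> and \<open>e0 \<and> f\<close>.\<close>

lemma frame2_normal_form:
  assumes c: "c \<in> q" "\<And>x. x \<in> A \<Longrightarrow> \<omega> u c x = 0" "\<And>x. x \<in> A \<Longrightarrow> \<omega> v c x = 0" "\<omega> u v c \<noteq> 0"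
    and q: "a \<in> q" "b \<in> q" "d \<in> q"
    and val: "\<omega> v a b = 1" "\<omega> u a b = 0" "\<omega> u a d = 1" "\<omega> u b d = 0" "\<omega> v a d = 0" "\<omega> v b d = 0"
    and span: "\<And>x. x \<in> q \<Longrightarrow> \<exists>\<alpha> \<beta> \<gamma> \<delta>. x = scale \<alpha> a + scale \<beta> b + scale \<gamma> d + scale \<delta> c"
  shows "coboundary \<omega>"
proof -
  have c': "\<omega> u x c = 0" "\<omega> v x c = 0" if "x \<in> A" for x
    using c(2,3)[OF that] \<omega>_swap23[of u x c] \<omega>_swap23[of v x c] by simp_all
  have val': "\<omega> v b a = - 1" "\<omega> u b a = 0" "\<omega> u d a = - 1" "\<omega> u d b = 0" "\<omega> v d a = 0" "\<omega> v d b = 0"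
    using val \<omega>_swap23[of v b a] \<omega>_swap23[of u b a] \<omega>_swap23[of u d a] \<omega>_swap23[of u d b]
      \<omega>_swap23[of v d a] \<omega>_swap23[of v d b] by simp_all
  note qA = frame2_A[OF q(1)] frame2_A[OF q(2)] frame2_A[OF q(3)] frame2_A[OF c(1)]
  note sq = frame2_subspace
  have spanA: "\<exists>\<alpha> \<beta> \<gamma> \<delta>. x - (scale \<alpha> a + scale \<beta> b + scale \<gamma> d + scale \<delta> c) \<in> Z" if "x \<in> A" for x
    using that frame2_core span unfolding core_def by metis
  have eqI: "\<omega> x y w = \<omega> x' y' w" if w: "w \<in> A" and "\<omega> x y a = \<omega> x' y' a" "\<omega> x y b = \<omega> x' y' b"
    "\<omega> x y d = \<omega> x' y' d" "\<omega> x y c = \<omega> x' y' c" for x y w x' y'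
  proof -
    obtain \<alpha> \<beta> \<gamma> \<delta> where w': "w - (scale \<alpha> a + scale \<beta> b + scale \<gamma> d + scale \<delta> c) \<in> Z"
      using spanA[OF w] by blast
    have z0: "x - x \<in> Z" for x
      by (simp add: subspace_0[OF subspace_Z])
    show ?thesis
      unfolding \<omega>_cong_Z[OF z0 z0 w'] by (simp add: \<omega>_simps that)
  qed
  have Z_A: "bracket x y \<in> Z" if "\<And>w. w \<in> A \<Longrightarrow> \<omega> x y w = 0" for x y
    by (rule mem_ZI) (use that in \<open>simp add: form_bracket\<close>)
  have zero: "\<omega> 0 0 w = 0" for w
    by (simp add: \<omega>_simps)
  have vd: "\<omega> v d w = 0" and ub: "\<omega> u b w = 0" if "w \<in> A" for w
    using eqI[OF that, of v d 0 0] eqI[OF that, of u b 0 0] val val' c' qA by (simp_all add: zero)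
  \<comment> \<open>Both [b, v] and [d, u] pair to 1 with a and to 0 with b, c and d.\<close>
  have bv: "\<omega> b v w = \<omega> d u w" if "w \<in> A" for w
    by (rule eqI[OF that]) (use val val' c' qA in \<open>simp_all add: \<omega>_swap12[of b v] \<omega>_swap12[of d u]\<close>)
  obtain e0 where e0: "e0 \<in> q" "bracket b v - e0 \<in> Z" "\<forall>x\<in>A. B e0 x = \<omega> b v x"
    by (rule frame2_projection)
  have z0: "x - x \<in> Z" for x
    by (simp add: subspace_0[OF subspace_Z])
  have "bracket b v - bracket d u \<in> Z"
    by (rule mem_ZI) (simp add: form_simps form_bracket bv)
  then have "e0 - bracket d u \<in> Z"
    using subspace_diff[OF subspace_Z, of "bracket b v - bracket d u" "bracket b v - e0"] e0(2) by simp
  \<comment> \<open>For v the vector e0 is read as [d, u], for u as [b, v]; commuting then leads to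
    the central brackets [v, d] and [u, b].\<close>
  have ve: "\<omega> v e0 x = 0" if x: "x \<in> A" for x
  proof -
    have "\<omega> v e0 x = \<omega> v (bracket d u) x"
      by (rule \<omega>_cong_Z[OF z0 \<open>e0 - bracket d u \<in> Z\<close> z0])
    also have "\<dots> = - \<omega> u (bracket v d) x"
      using frame2_commute[OF qA(3) x] bracket_skew[of d u] by (simp add: \<omega>_simps)
    also have "\<dots> = 0"
      using Z_A[OF vd] by simp
    finally show ?thesis .
  qed
  have ue: "\<omega> u e0 x = 0" if x: "x \<in> A" for x
  proof -
    have "e0 - bracket b v \<in> Z"
      using subspace_neg[OF subspace_Z e0(2)] by simp
    then have "\<omega> u e0 x = \<omega> u (bracket b v) x"
      by (rule \<omega>_cong_Z[OF z0 _ z0])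
    also have "\<dots> = - \<omega> v (bracket u b) x"
      using frame2_commute[OF qA(2) x] bracket_skew[of b v] by (simp add: \<omega>_simps)
    also have "\<dots> = 0"
      using Z_A[OF ub] by simp
    finally show ?thesis .
  qed
  obtain \<alpha> \<beta> \<gamma> \<delta> where abc: "e0 = scale \<alpha> a + scale \<beta> b + scale \<gamma> d + scale \<delta> c"
    using span[OF e0(1)] by blast
  \<comment> \<open>Trivial action of u and v on e0 kills its components along a, b and d.\<close>
  have "\<omega> v e0 b = \<alpha>" "\<omega> v e0 a = - \<beta>" "\<omega> u e0 a = - \<gamma> + \<beta> * \<omega> u b a"
    unfolding abc by (simp_all add: \<omega>_simps val val' c qA)
  then have e0c: "e0 = scale \<delta> c"
    using ve[OF qA(2)] ve[OF qA(1)] ue[OF qA(1)] abc by simp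
  have e0v: "B e0 a = 1" "B e0 b = 0" "B e0 d = 0" "B e0 c = 0"
    using e0(3) qA val val' c' by (simp_all add: \<omega>_swap12[of b v])
  then have "\<delta> \<noteq> 0"
    using e0c by (auto simp: form_simps)
  have e0e: "B e0 e0 = 0"
    using e0v(4) by (subst (2) e0c) (simp add: form_simps)
  have av: "B a e0 = 1" "B b e0 = 0" "B d e0 = 0"
    using e0v by (simp_all add: form_sym)
  define h where "h = (1/2 :: 'a)"
  have h: "h + h = 1"
    using two by (simp add: h_def flip: mult_2)
  have hh: "x - h * x - h * x = 0" for x
    using h by (simp flip: diff_diff_eq2 distrib_right add: diff_diff_eq)
  \<comment> \<open>Corrections by multiples of e0 make a1 isotropic and orthogonal to b1 and d1;
    since u and v act trivially on e0, their values on the basis are unchanged.\<close>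
  define a1 where "a1 = a - scale (h * B a a) e0"
  define b1 where "b1 = b - scale (B a b) e0"
  define d1 where "d1 = d - scale (B a d) e0"
  have q1: "a1 \<in> q" "b1 \<in> q" "d1 \<in> q"
    using q e0(1) sq by (simp_all add: a1_def b1_def d1_def subspace_diff subspace_scale)
  note q1A = frame2_A[OF q1(1)] frame2_A[OF q1(2)] frame2_A[OF q1(3)] frame2_A[OF e0(1)]
  have ve': "\<omega> v x e0 = 0" "\<omega> u x e0 = 0" if "x \<in> A" for x
    using ve[OF that] ue[OF that] \<omega>_swap23[of v x e0] \<omega>_swap23[of u x e0] by simp_all
  have w1: "\<omega> v a1 b1 = 1" "\<omega> u a1 b1 = 0" "\<omega> u a1 d1 = 1" "\<omega> u b1 d1 = 0" "\<omega> v a1 d1 = 0" "\<omega> v b1 d1 = 0"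
    by (simp_all add: a1_def b1_def d1_def \<omega>_simps val ve ue ve' qA q1A)
  have w1': "\<omega> v b1 a1 = - 1" "\<omega> u b1 a1 = 0" "\<omega> u d1 a1 = - 1" "\<omega> u d1 b1 = 0" "\<omega> v d1 a1 = 0" "\<omega> v d1 b1 = 0"
    using w1 \<omega>_swap23[of v b1 a1] \<omega>_swap23[of u b1 a1] \<omega>_swap23[of u d1 a1] \<omega>_swap23[of u d1 b1]
      \<omega>_swap23[of v d1 a1] \<omega>_swap23[of v d1 b1] by simp_all
  obtain f where f: "f \<in> q" "\<forall>x\<in>A. B f x = \<omega> v a1 x"
    by (rule frame2_projection)
  obtain e where e: "e \<in> q" "\<forall>x\<in>A. B e x = \<omega> u a1 x"
    by (rule frame2_projection)
  have a1v: "B a1 a1 = 0" "B a1 b1 = 0" "B a1 d1 = 0" "B a1 e0 = 1"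
    by (simp_all add: a1_def b1_def d1_def form_simps av e0v e0e hh)
  have e0v1: "B e0 a1 = 1" "B e0 b1 = 0" "B e0 d1 = 0"
    by (simp_all add: a1_def b1_def d1_def form_simps e0v e0e)
  have fe: "B f a1 = 0" "B f b1 = 1" "B f d1 = 0" "B f e0 = 0" "B e a1 = 0" "B e b1 = 0" "B e d1 = 1" "B e e0 = 0"
    using f(2) e(2) q1A w1 ve' by simp_all
  have expand: "y = scale (B e0 y) a1 + scale (B f y) b1 + scale (B e y) d1 + scale (B a1 y) e0" if y: "y \<in> q" for y
  proof -
    obtain \<alpha> \<beta> \<gamma> \<epsilon> where "y = scale \<alpha> a + scale \<beta> b + scale \<gamma> d + scale \<epsilon> c"
      using span[OF y] by blast
    moreover have "c = scale (1 / \<delta>) e0"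
      using \<open>\<delta> \<noteq> 0\<close> by (simp add: e0c)
    ultimately have "y = scale \<alpha> a1 + scale \<beta> b1 + scale \<gamma> d1 +
        scale (\<alpha> * (h * B a a) + \<beta> * B a b + \<gamma> * B a d + \<epsilon> / \<delta>) e0"
      by (simp add: a1_def b1_def d1_def scale_right_diff_distrib scale_left_distrib)
    then obtain \<epsilon>' where y': "y = scale \<alpha> a1 + scale \<beta> b1 + scale \<gamma> d1 + scale \<epsilon>' e0"
      by blast
    have "B e0 y = \<alpha>" "B f y = \<beta>" "B e y = \<gamma>" "B a1 y = \<epsilon>'"
      unfolding y' by (simp_all add: form_simps a1v e0v1 fe e0e)
    then show ?thesis
      using y' by simp
  qed
  \<comment> \<open>The forms of e0, f, e, a1 are the coordinates along a1, b1, d1, e0; u is nonzero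
    only on the pair a1, d1 and v only on a1, b1.\<close>
  have Uq: "\<omega> u y w = wedge2 (B e0) (B e) y w" "\<omega> v y w = wedge2 (B e0) (B f) y w"
    if yw: "y \<in> q" "w \<in> q" for y w
    unfolding wedge2_def
    by (subst arg_cong2[OF expand[OF yw(1)] expand[OF yw(2)], of "\<omega> u"],
        simp add: \<omega>_simps w1 w1' ve ue ve' q1A)
      (subst arg_cong2[OF expand[OF yw(1)] expand[OF yw(2)], of "\<omega> v"],
        simp add: \<omega>_simps w1 w1' ve ue ve' q1A)
  define \<kappa> \<kappa>1 \<kappa>2 \<kappa>3 where \<kappa>: "\<kappa> = \<omega> u v e0" "\<kappa>1 = \<omega> u v b1" "\<kappa>2 = \<omega> u v d1" "\<kappa>3 = \<omega> u v a1"
  have UVq: "\<omega> u v w = \<kappa> * B a1 w + \<kappa>1 * B f w + \<kappa>2 * B e w + \<kappa>3 * B e0 w"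
    if "w \<in> q" for w
    unfolding \<kappa> by (subst arg_cong[OF expand[OF that], of "\<omega> u v"]) (simp add: \<omega>_simps)
  have F: "\<omega> x y w = wedge (B z) (wedge2 (B e0) (B e)) x y w + wedge (B t) (wedge2 (B e0) (B f)) x y w
      + \<kappa> * wedge (B z) (wedge2 (B t) (B a1)) x y w + \<kappa>1 * wedge (B z) (wedge2 (B t) (B f)) x y w
      + \<kappa>2 * wedge (B z) (wedge2 (B t) (B e)) x y w + \<kappa>3 * wedge (B z) (wedge2 (B t) (B e0)) x y w"
    for x y w
  proof -
    obtain x' where x': "x' \<in> q" "x - (scale (B z x) u + scale (B t x) v + x') \<in> Z" "\<forall>p\<in>q. B p x = B p x'"
      by (rule frame2_decompose[of x])
    obtain y' where y': "y' \<in> q" "y - (scale (B z y) u + scale (B t y) v + y') \<in> Z" "\<forall>p\<in>q. B p y = B p y'"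
      by (rule frame2_decompose[of y])
    obtain w' where w': "w' \<in> q" "w - (scale (B z w) u + scale (B t w) v + w') \<in> Z" "\<forall>p\<in>q. B p w = B p w'"
      by (rule frame2_decompose[of w])
    have sw: "\<omega> a u b = - \<omega> u a b" "\<omega> a v b = - \<omega> v a b" "\<omega> a b u = \<omega> u a b" "\<omega> a b v = \<omega> v a b"
      "\<omega> v u a = - \<omega> u v a" "\<omega> u a v = - \<omega> u v a" "\<omega> v a u = \<omega> u v a"
      for a b
      using \<omega>_swap12[of a u b] \<omega>_swap12[of a v b] \<omega>_cyc[of a b u] \<omega>_cyc[of a b v]
        \<omega>_swap12[of v u a] \<omega>_swap23[of u a v] \<omega>_cyc[of v a u] by simp_all
    have pts: "B p x = B p x'" "B p y = B p y'" "B p w = B p w'" if "p \<in> {e0, e, f, a1}" for p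
      using x'(3) y'(3) w'(3) that e0(1) e(1) f(1) q1(1) by auto
    show ?thesis
      unfolding wedge_def wedge2_def pts[of e0, simplified] pts[of e, simplified] pts[of f, simplified] pts[of a1, simplified]
      by (subst \<omega>_cong_Z[OF x'(2) y'(2) w'(2)])
        (simp add: \<omega>_simps sw[of x'] sw[of y'] sw[of w'] frame2_\<omega>_A frame2_A x'(1) y'(1) w'(1) Uq UVq wedge2_def, algebra)
  qed
  show ?thesis
    by (rule coboundary_rank_two[OF frame2_values(1,2) F, where a' = b1 and u = u and v = v])
      (use frame2_values frame2_perp e0(1) e(1) f(1) q1 a1v e0v1 fe e0e in simp_all)
qed

text \<open>Inclusion-exclusion over the components along u and v. The part containing neither is a
  value of \<omega> on A, hence zero, and terms containing both would be counted twice.\<close>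

lemma frame2_\<omega>_formula:
  "\<omega> x y w = wedge (B z) (\<omega> u) x y w + (wedge (B t) (\<omega> v) x y w
     + - 1 * wedge (B z) (wedge2 (B t) (B (bracket u v))) x y w)"
proof -
  obtain x' where x': "x' \<in> q" "x - (scale (B z x) u + scale (B t x) v + x') \<in> Z"
    by (rule frame2_decompose[of x])
  obtain y' where y': "y' \<in> q" "y - (scale (B z y) u + scale (B t y) v + y') \<in> Z"
    by (rule frame2_decompose[of y])
  obtain w' where w': "w' \<in> q" "w - (scale (B z w) u + scale (B t w) v + w') \<in> Z"
    by (rule frame2_decompose[of w])
  have 0: "\<omega> x' y' w' = 0"
    by (simp add: frame2_\<omega>_A frame2_A x' y' w')
  have "\<omega> x' y' w' = \<omega> (x - (scale (B z x) u + scale (B t x) v))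
      (y - (scale (B z y) u + scale (B t y) v)) (w - (scale (B z w) u + scale (B t w) v))"
  proof (rule \<omega>_cong_Z)
    have "a' - (a - s) \<in> Z" if "a - (s + a') \<in> Z" for a a' s
      using subspace_neg[OF subspace_Z that] by (simp add: algebra_simps)
    then show "x' - (x - (scale (B z x) u + scale (B t x) v)) \<in> Z"
      "y' - (y - (scale (B z y) u + scale (B t y) v)) \<in> Z"
      "w' - (w - (scale (B z w) u + scale (B t w) v)) \<in> Z"
      using x'(2) y'(2) w'(2) by blast+
  qed
  moreover have "\<omega> (x - (scale (B z x) u + scale (B t x) v))
      (y - (scale (B z y) u + scale (B t y) v)) (w - (scale (B z w) u + scale (B t w) v)) =
    \<omega> x y w - (wedge (B z) (\<omega> u) x y w + (wedge (B t) (\<omega> v) x y w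
     + - 1 * wedge (B z) (wedge2 (B t) (B (bracket u v))) x y w))"
  proof -
    have sw: "\<omega> a u b = - \<omega> u a b" "\<omega> a v b = - \<omega> v a b" "\<omega> a b u = \<omega> u a b" "\<omega> a b v = \<omega> v a b"
      for a b
      using \<omega>_swap12[of a u b] \<omega>_swap12[of a v b] \<omega>_cyc[of a b u] \<omega>_cyc[of a b v] by simp_all
    have uv: "\<omega> v u a = - \<omega> u v a" "\<omega> u a v = - \<omega> u v a" "\<omega> v a u = \<omega> u v a" for a
      using \<omega>_swap12[of v u a] \<omega>_swap23[of u a v] \<omega>_cyc[of v a u] by simp_all
    have xw: "\<omega> u w x = - \<omega> u x w" "\<omega> v w x = - \<omega> v x w"
      by (rule \<omega>_swap23)+
    have br: "B (bracket u v) a = \<omega> u v a" for a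
      by (simp add: \<omega>_def)
    show ?thesis
      unfolding wedge_def wedge2_def br xw
      by (simp only: \<omega>_simps sw[of x] sw[of y] sw[of w] uv[of x] uv[of y] uv[of w] \<omega>_alt) algebra
  qed
  ultimately show ?thesis
    using 0 by (simp only: eq_iff_diff_eq_0[of "\<omega> x y w"])
qed

text \<open>\<open>\<omega>\<close> is a coboundary as soon as \<open>[u, v]\<close> lies in this subspace, which contains \<open>[A, u]\<close> and \<open>[A, v]\<close>.\<close>

definition exact_directions :: "'b set" where
  "exact_directions = {x. coboundary (wedge (B z) (wedge2 (B t) (B x)))}"

lemma subspace_exact_directions: "subspace exact_directions"
proof (rule subspaceI)
  have "wedge (B z) (wedge2 (B t) (B 0)) = (\<lambda>x y w. 0)"
    by (simp add: fun_eq_iff wedge_def wedge2_def form_simps)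
  then show "0 \<in> exact_directions"
    by (simp add: exact_directions_def coboundary_zero)
  have "wedge (B z) (wedge2 (B t) (B (a + b))) =
      (\<lambda>x y w. wedge (B z) (wedge2 (B t) (B a)) x y w + wedge (B z) (wedge2 (B t) (B b)) x y w)" for a b
    by (simp add: fun_eq_iff wedge_def wedge2_def form_simps algebra_simps)
  then show "a + b \<in> exact_directions" if "a \<in> exact_directions" "b \<in> exact_directions" for a b
    using that coboundary_add by (simp add: exact_directions_def)
  have "wedge (B z) (wedge2 (B t) (B (scale c a))) =
      (\<lambda>x y w. c * wedge (B z) (wedge2 (B t) (B a)) x y w)" for c a
    by (simp add: fun_eq_iff wedge_def wedge2_def form_simps algebra_simps)
  then show "scale c a \<in> exact_directions" if "a \<in> exact_directions" for c a
    using that coboundary_mult by (simp add: exact_directions_def)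
qed

text \<open>c0 separates [u, v] from the exact directions. These contain z and t, so c0 agrees with
  some c in \<open>q\<close> modulo the center; they contain [A, u] and [A, v], so u and v act
  trivially on c.\<close>

lemma frame2_obstruction:
  assumes ne: "\<not> coboundary \<omega>"
  obtains c where "c \<in> q" "\<And>x. x \<in> A \<Longrightarrow> \<omega> u c x = 0" "\<And>x. x \<in> A \<Longrightarrow> \<omega> v c x = 0" "\<omega> u v c = 1"
proof -
  have "bracket u v \<notin> exact_directions"
  proof
    assume "bracket u v \<in> exact_directions"
    then have "coboundary (wedge (B z) (wedge2 (B t) (B (bracket u v))))"
      by (simp add: exact_directions_def)
    then have "coboundary (\<lambda>x y w. wedge (B z) (\<omega> u) x y w + (wedge (B t) (\<omega> v) x y w
        + - 1 * wedge (B z) (wedge2 (B t) (B (bracket u v))) x y w))"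
      using frame2_values by (intro coboundary_add coboundary_mult coboundary_central)
    then show False
      using ne by (simp only: frame2_\<omega>_formula[symmetric])
  qed
  then obtain c0 where c0: "\<forall>s\<in>exact_directions. B c0 s = 0" "B c0 (bracket u v) = 1"
    by (rule separating_vector[OF subspace_exact_directions])
  have "wedge (B z) (wedge2 (B t) (B z)) = (\<lambda>x y w. 0)" "wedge (B z) (wedge2 (B t) (B t)) = (\<lambda>x y w. 0)"
    by (simp_all add: fun_eq_iff wedge_def wedge2_def algebra_simps)
  then have "z \<in> exact_directions" "t \<in> exact_directions"
    by (simp_all add: exact_directions_def coboundary_zero)
  then have "B z c0 = 0" "B t c0 = 0"
    using c0(1) by (simp_all add: form_sym[of _ c0])
  then obtain c where c: "c \<in> q" "c0 - c \<in> Z"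
    using fr unfolding frame2_def by blast
  have Bc: "B c0 a = B c a" if "a \<in> A" for a
    using form_Z_A[OF c(2) that] by (simp add: form_simps)
  have 0: "\<omega> x u c = 0" "\<omega> x v c = 0" if "x \<in> A" for x
  proof -
    have "bracket x u \<in> exact_directions" "bracket x v \<in> exact_directions"
      using frame2_coboundary_brackets[OF that] by (simp_all add: exact_directions_def)
    then have "B c (bracket x u) = 0" "B c (bracket x v) = 0"
      using c0(1) by (simp_all flip: Bc)
    then show "\<omega> x u c = 0" "\<omega> x v c = 0"
      by (simp_all add: \<omega>_def form_sym[of _ c])
  qed
  have "\<omega> u c x = 0" "\<omega> v c x = 0" if "x \<in> A" for x
    using 0[OF that] \<omega>_cyc[of x u c] \<omega>_cyc[of x v c] \<omega>_cyc[of u c x] \<omega>_cyc[of v c x] by simp_all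
  moreover have "\<omega> u v c = 1"
    using c0(2) Bc[of "bracket u v"] by (simp add: \<omega>_def form_sym[of _ c])
  ultimately show thesis
    using that c(1) by blast
qed

end

text \<open>Since u0 and v act trivially on the obstruction c, they act through alternating forms on
  \<open>q\<close> modulo c, of dimension at most three. There two alternating forms have a common
  linear factor, and a vector on which it is 1 becomes the a of the normal form.\<close>

lemma coboundary_frame2:
  assumes fr0: "frame2 q z t u0 v" and dim: "dim q \<le> 4"
  shows "coboundary \<omega>"
proof (rule ccontr)
  assume ne: "\<not> coboundary \<omega>"
  obtain c where c: "c \<in> q" "\<And>x. x \<in> A \<Longrightarrow> \<omega> u0 c x = 0" "\<And>x. x \<in> A \<Longrightarrow> \<omega> v c x = 0" "\<omega> u0 v c = 1"
    using frame2_obstruction[OF fr0 dim ne] by blast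
  note core = frame2_core[OF fr0 dim] and sq = frame2_subspace[OF fr0 dim]
  have qA: "x \<in> A" if "x \<in> q" for x
    by (rule frame2_A[OF fr0 dim that])
  obtain a0 b0 where a0: "a0 \<in> A" "b0 \<in> A" "\<omega> v a0 b0 \<noteq> 0"
    using frame2_divisible[OF fr0 dim] ne by blast
  have z0: "x - x \<in> Z" for x
    by (simp add: subspace_0[OF subspace_Z])
  obtain a1 b where ab1: "a1 \<in> q" "a0 - a1 \<in> Z" "b \<in> q" "b0 - b \<in> Z"
    using core a0 unfolding core_def by blast
  then have ne1: "\<omega> v a1 b \<noteq> 0"
    using a0(3) \<omega>_cong_Z[OF z0 ab1(2,4)] by simp
  define a where "a = scale (1 / \<omega> v a1 b) a1"
  have ab: "a \<in> q" "b \<in> q" "\<omega> v a b = 1"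
    using ab1 ne1 sq by (simp_all add: a_def \<omega>_simps subspace_scale)
  \<comment> \<open>The multiple of v is chosen so that \<open>\<omega> u a b = 0\<close>.\<close>
  define u where "u = u0 - scale (\<omega> u0 a b) v"
  define t' where "t' = t + scale (\<omega> u0 a b) z"
  have fr: "frame2 q z t' u v"
    unfolding u_def t'_def by (rule frame2_shear[OF fr0])
  have uc: "\<omega> u c x = 0" if "x \<in> A" for x
    using c(2,3)[OF that] by (simp add: u_def \<omega>_simps)
  have uvc: "\<omega> u v c \<noteq> 0"
    using c(4) by (simp add: u_def \<omega>_simps)
  have uab: "\<omega> u a b = 0"
    using ab(3) by (simp add: u_def \<omega>_simps)
  have vba: "\<omega> v b a = - 1" "\<omega> u b a = 0"
    using ab(3) uab \<omega>_swap23[of v b a] \<omega>_swap23[of u b a] by simp_all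
  obtain y1 where y1: "y1 \<in> q" "\<forall>x\<in>A. B y1 x = \<omega> v a x"
    by (rule frame2_projection[OF fr dim])
  obtain y2 where y2: "y2 \<in> q" "\<forall>x\<in>A. B y2 x = \<omega> v b x"
    by (rule frame2_projection[OF fr dim])
  note abA = qA[OF ab(1)] qA[OF ab(2)] qA[OF c(1)]
  \<comment> \<open>The vectors of \<open>q\<close> that v pairs to zero with both a and b. This
    space contains c and has dimension at most two, so one further vector d spans it together with
    c.\<close>
  define L where "L = {x \<in> {x \<in> q. B y1 x = 0}. B y2 x = 0}"
  have subL: "subspace L"
    unfolding L_def by (intro subspace_perp sq)
  have "dim {x \<in> q. B y1 x = 0} < dim q"
    using ab y1 abA by (intro dim_perp_less[OF sq, of b]) auto
  moreover have "dim L < dim {x \<in> q. B y1 x = 0}"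
    unfolding L_def using ab y1 y2 abA vba by (intro dim_perp_less[OF subspace_perp[OF sq], of a]) auto
  ultimately have dimL: "dim L \<le> 2"
    using dim by simp
  have c': "\<omega> u x c = 0" "\<omega> v x c = 0" if "x \<in> A" for x
    using uc[OF that] c(3)[OF that] \<omega>_swap23[of u x c] \<omega>_swap23[of v x c] by simp_all
  have cL: "c \<in> L"
    using c(1) y1(2) y2(2) abA c' by (simp add: L_def)
  have "c \<noteq> 0"
    using c(4) by (auto simp: \<omega>_simps)
  obtain d where d: "d \<in> L" "L \<subseteq> span {d, c}"
  proof (cases "L \<subseteq> span {c}")
    \<comment> \<open>If only multiples of c are left, d = 0 serves; u then vanishes on both pairs
      with d, which leads to the last case below.\<close>
    case True
    then show ?thesis
      using that[of 0] subspace_0[OF subL] span_mono[of "{c}" "{0, c}"] by auto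
  next
    case False
    then obtain d where d: "d \<in> L" "d \<notin> span {c}"
      by blast
    then have "dim {d, c} = 2"
      using \<open>c \<noteq> 0\<close> by (simp add: dim_insert)
    then have "span {d, c} = L"
      using d(1) cL dimL by (intro subspace_dim_equal subspace_span subL span_minimal) simp_all
    then show ?thesis
      using that d(1) by blast
  qed
  have dq: "d \<in> q"
    using d(1) by (simp add: L_def)
  have vd: "\<omega> v a d = 0" "\<omega> v b d = 0"
    using d(1) y1(2) y2(2) qA[OF dq] by (simp_all add: L_def)
  have span: "\<exists>\<alpha> \<beta> \<gamma> \<delta>. x = scale \<alpha> a + scale \<beta> b + scale \<gamma> d + scale \<delta> c" if x: "x \<in> q" for x
  proof -
    let ?r = "x - (scale (- B y2 x) a + scale (B y1 x) b)"
    have "?r \<in> q"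
      using x ab sq by (simp only: subspace_diff subspace_add subspace_scale)
    moreover have "B y1 ?r = 0" "B y2 ?r = 0"
      using y1(2) y2(2) abA ab vba by (simp_all add: form_simps)
    ultimately have "?r \<in> span {d, c}"
      using d(2) by (auto simp: L_def)
    then obtain \<gamma> \<delta> where "?r - scale \<gamma> d - scale \<delta> c = 0"
      by (auto simp: span_breakdown_eq)
    then have "x = scale (- B y2 x) a + scale (B y1 x) b + scale \<gamma> d + scale \<delta> c"
      by (simp add: algebra_simps)
    then show ?thesis
      by blast
  qed
  note nf = frame2_normal_form[OF fr dim c(1) uc c(3) uvc]
  show False
  \<comment> \<open>If \<open>\<omega> u a d\<close> is nonzero, b is corrected by a multiple of a.
    If only \<open>\<omega> u b d\<close> is nonzero, b and -a take the roles of a and b. If both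
    vanish, u acts trivially and \<omega> is divisible by the other central form.\<close>
  proof (cases "\<omega> u a d = 0")
    case False
    let ?\<xi> = "\<omega> u a d" and ?\<xi>' = "\<omega> u b d"
    have "coboundary \<omega>"
    proof (rule nf[of a "b - scale (?\<xi>' / ?\<xi>) a" "scale (1 / ?\<xi>) d"])
      fix x assume "x \<in> q"
      then obtain \<alpha> \<beta> \<gamma> \<delta> where "x = scale \<alpha> a + scale \<beta> b + scale \<gamma> d + scale \<delta> c"
        using span by blast
      then have "x = scale (\<alpha> + \<beta> * (?\<xi>' / ?\<xi>)) a + scale \<beta> (b - scale (?\<xi>' / ?\<xi>) a)
          + scale (\<gamma> * ?\<xi>) (scale (1 / ?\<xi>) d) + scale \<delta> c"
        using False by (simp add: scale_left_distrib scale_right_diff_distrib)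
      then show "\<exists>\<alpha> \<beta> \<gamma> \<delta>. x = scale \<alpha> a + scale \<beta> (b - scale (?\<xi>' / ?\<xi>) a)
          + scale \<gamma> (scale (1 / ?\<xi>) d) + scale \<delta> c"
        by blast
    qed (use ab dq sq vd uab False in \<open>simp_all add: \<omega>_simps subspace_diff subspace_scale\<close>)
    then show False
      using ne by blast
  next
    case True
    note uad = this
    show False
    proof (cases "\<omega> u b d = 0")
      case False
      let ?\<xi>' = "\<omega> u b d"
      have "coboundary \<omega>"
      proof (rule nf[of b "- a" "scale (1 / ?\<xi>') d"])
        fix x assume "x \<in> q"
        then obtain \<alpha> \<beta> \<gamma> \<delta> where "x = scale \<alpha> a + scale \<beta> b + scale \<gamma> d + scale \<delta> c"
          using span by blast
        then have "x = scale \<beta> b + scale (- \<alpha>) (- a) + scale (\<gamma> * ?\<xi>') (scale (1 / ?\<xi>') d) + scale \<delta> c"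
          using False by (simp add: add.commute)
        then show "\<exists>\<alpha> \<beta> \<gamma> \<delta>. x = scale \<alpha> b + scale \<beta> (- a) + scale \<gamma> (scale (1 / ?\<xi>') d) + scale \<delta> c"
          by blast
      qed (use ab dq sq vd uab uad vba False in \<open>simp_all add: \<omega>_simps subspace_neg subspace_scale\<close>)
      then show False
        using ne by blast
    next
      case True
      have d': "\<omega> u d a = 0" "\<omega> u d b = 0"
        using True uad \<omega>_swap23[of u d a] \<omega>_swap23[of u d b] by simp_all
      have "\<omega> u x y = 0" if xy: "x \<in> A" "y \<in> A" for x y
      proof -
        obtain x' y' where x': "x' \<in> q" "x - x' \<in> Z" "y' \<in> q" "y - y' \<in> Z"
          using core xy unfolding core_def by blast
        obtain \<alpha> \<beta> \<gamma> \<delta> where x'': "x' = scale \<alpha> a + scale \<beta> b + scale \<gamma> d + scale \<delta> c"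
          using span[OF x'(1)] by blast
        obtain \<alpha>' \<beta>' \<gamma>' \<delta>' where y'': "y' = scale \<alpha>' a + scale \<beta>' b + scale \<gamma>' d + scale \<delta>' c"
          using span[OF x'(3)] by blast
        show ?thesis
          unfolding \<omega>_cong_Z[OF z0 x'(2,4)] x'' y''
          by (simp add: \<omega>_simps uab vba uad True d' uc c' abA qA[OF dq])
      qed
      then show False
        using frame2_divisible[OF frame2_swap[OF fr] dim] ne by blast
    qed
  qed
qed

end

section \<open>Isotropic center of dimension three\<close>

context metric_3solvable
begin

definition frame3 :: "'b set \<Rightarrow> 'b \<Rightarrow> 'b \<Rightarrow> 'b \<Rightarrow> 'b \<Rightarrow> 'b \<Rightarrow> 'b \<Rightarrow> bool" where
  "frame3 q z1 z2 z3 u1 u2 u3 \<longleftrightarrow> core q \<and> {z1, z2, z3} \<subseteq> Z \<and>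
     B z1 u1 = 1 \<and> B z1 u2 = 0 \<and> B z1 u3 = 0 \<and> B z2 u1 = 0 \<and> B z2 u2 = 1 \<and> B z2 u3 = 0 \<and>
     B z3 u1 = 0 \<and> B z3 u2 = 0 \<and> B z3 u3 = 1 \<and>
     (\<forall>x. B z1 x = 0 \<longrightarrow> B z2 x = 0 \<longrightarrow> B z3 x = 0 \<longrightarrow> (\<exists>y\<in>q. x - y \<in> Z))"

lemma frame3_rotate: "frame3 q z1 z2 z3 u1 u2 u3 \<Longrightarrow> frame3 q z2 z3 z1 u2 u3 u1"
  unfolding frame3_def by blast

context
  fixes q z1 z2 z3 u1 u2 u3
  assumes fr: "frame3 q z1 z2 z3 u1 u2 u3" and dim: "dim q \<le> 2"
begin

lemma frame3_core: "core q" "subspace q" "x \<in> q \<Longrightarrow> x \<in> A"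
  using fr by (auto simp: frame3_def core_def)

lemma frame3_values: "z1 \<in> Z" "z2 \<in> Z" "z3 \<in> Z"
  "B z1 u1 = 1" "B z1 u2 = 0" "B z1 u3 = 0" "B z2 u1 = 0" "B z2 u2 = 1" "B z2 u3 = 0"
  "B z3 u1 = 0" "B z3 u2 = 0" "B z3 u3 = 1"
  using fr by (auto simp: frame3_def)

lemma frame3_\<omega>_A: "a \<in> A \<Longrightarrow> b \<in> A \<Longrightarrow> c \<in> A \<Longrightarrow> \<omega> a b c = 0"
  using \<omega>_A_small[OF frame3_core(1)] dim by simp

lemma frame3_decompose:
  obtains y where "y \<in> q" "x - (scale (B z1 x) u1 + scale (B z2 x) u2 + scale (B z3 x) u3 + y) \<in> Z"
proof -
  let ?x = "x - (scale (B z1 x) u1 + scale (B z2 x) u2 + scale (B z3 x) u3)"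
  have "B z1 ?x = 0" "B z2 ?x = 0" "B z3 ?x = 0"
    by (simp_all add: form_simps frame3_values)
  then obtain y where "y \<in> q" "?x - y \<in> Z"
    using fr unfolding frame3_def by blast
  then show thesis
    using that[of y] by (simp add: diff_diff_eq)
qed

lemma Z_refl: "x - x \<in> Z"
  by (simp add: subspace_0[OF subspace_Z])

text \<open>The contraction of \<omega> by a vector of A involves only products of two of the forms
  \<open>B z_i\<close>. If all these contractions vanish, A is central; otherwise wedging one with
  some \<open>B z_i\<close> shows that the product D of all three is a coboundary. Summing over i
  the contraction by u_i wedged with \<open>B z_i\<close> counts \<omega> twice, except that its D
  component is counted three times.\<close>

lemma frame3_trivial_action:
  assumes triv: "\<And>a b. a \<in> A \<Longrightarrow> b \<in> A \<Longrightarrow> \<omega> u1 a b = 0" "\<And>a b. a \<in> A \<Longrightarrow> b \<in> A \<Longrightarrow> \<omega> u2 a b = 0"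
    "\<And>a b. a \<in> A \<Longrightarrow> b \<in> A \<Longrightarrow> \<omega> u3 a b = 0"
  shows "coboundary \<omega>"
proof -
  have sw: "\<omega> a u b = - \<omega> u a b" "\<omega> a b u = \<omega> u a b" for a b u
    using \<omega>_swap12[of a u b] \<omega>_cyc[of a b u] by simp_all
  have \<omega>c: "\<omega> c y w = \<omega> c u1 u2 * wedge2 (B z1) (B z2) y w + \<omega> c u1 u3 * wedge2 (B z1) (B z3) y w
      + \<omega> c u2 u3 * wedge2 (B z2) (B z3) y w" if c: "c \<in> A" for c y w
  proof -
    obtain y' where y': "y' \<in> q" "y - (scale (B z1 y) u1 + scale (B z2 y) u2 + scale (B z3 y) u3 + y') \<in> Z"
      by (rule frame3_decompose)
    obtain w' where w': "w' \<in> q" "w - (scale (B z1 w) u1 + scale (B z2 w) u2 + scale (B z3 w) u3 + w') \<in> Z"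
      by (rule frame3_decompose)
    have 0: "\<omega> c u1 x = 0" "\<omega> c u2 x = 0" "\<omega> c u3 x = 0" "\<omega> c x u1 = 0" "\<omega> c x u2 = 0" "\<omega> c x u3 = 0"
      if "x \<in> A" for x
      using triv[OF c that] by (simp_all add: sw(1)[of c u1] sw(1)[of c u2] sw(1)[of c u3] sw(2)[of c x])
    have 1: "\<omega> c u2 u1 = - \<omega> c u1 u2" "\<omega> c u3 u1 = - \<omega> c u1 u3" "\<omega> c u3 u2 = - \<omega> c u2 u3"
      by (rule \<omega>_swap23)+
    show ?thesis
      unfolding wedge2_def
      by (subst \<omega>_cong_Z[OF Z_refl y'(2) w'(2)])
        (simp add: \<omega>_simps 0 1 frame3_core(3)[OF y'(1)] frame3_core(3)[OF w'(1)] frame3_\<omega>_A c, algebra)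
  qed
  let ?D = "wedge (B z1) (wedge2 (B z2) (B z3))"
  show ?thesis
  proof (cases "\<forall>c\<in>A. \<omega> c u1 u2 = 0 \<and> \<omega> c u1 u3 = 0 \<and> \<omega> c u2 u3 = 0")
    case True
    have "c \<in> Z" if "c \<in> A" for c
      unfolding mem_Z_iff_\<omega> using \<omega>c[OF that] True that by simp
    then show ?thesis
      by (intro coboundary_\<omega>_two_step) blast
  next
    case False
    then obtain c where c: "c \<in> A" "\<omega> c u1 u2 \<noteq> 0 \<or> \<omega> c u1 u3 \<noteq> 0 \<or> \<omega> c u2 u3 \<noteq> 0"
      by blast
    have e': "wedge (B z3) (\<omega> c) x y w = \<omega> c u1 u2 * ?D x y w"
      "wedge (B z2) (\<omega> c) x y w = (- \<omega> c u1 u3) * ?D x y w"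
      "wedge (B z1) (\<omega> c) x y w = \<omega> c u2 u3 * ?D x y w" for x y w
      unfolding wedge_def \<omega>c[OF c(1), of x y] \<omega>c[OF c(1), of y w] \<omega>c[OF c(1), of w x] wedge2_def
      by algebra+
    have e: "wedge (B z3) (\<omega> c) = (\<lambda>x y w. \<omega> c u1 u2 * ?D x y w)"
      "wedge (B z2) (\<omega> c) = (\<lambda>x y w. (- \<omega> c u1 u3) * ?D x y w)"
      "wedge (B z1) (\<omega> c) = (\<lambda>x y w. \<omega> c u2 u3 * ?D x y w)"
      by (intro ext e')+
    have D: "coboundary ?D"
      using c(2) coboundary_cancel[of "\<omega> c u1 u2" ?D] coboundary_cancel[of "- \<omega> c u1 u3" ?D]
        coboundary_cancel[of "\<omega> c u2 u3" ?D] coboundary_central[OF frame3_values(1), of c]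
        coboundary_central[OF frame3_values(2), of c] coboundary_central[OF frame3_values(3), of c]
      unfolding e by auto
    have "2 * \<omega> x y w = wedge (B z1) (\<omega> u1) x y w + (wedge (B z2) (\<omega> u2) x y w + (wedge (B z3) (\<omega> u3) x y w
        + (- \<omega> u1 u2 u3) * ?D x y w))" for x y w
    proof -
      obtain x' where x': "x' \<in> q" "x - (scale (B z1 x) u1 + scale (B z2 x) u2 + scale (B z3 x) u3 + x') \<in> Z"
        by (rule frame3_decompose)
      obtain y' where y': "y' \<in> q" "y - (scale (B z1 y) u1 + scale (B z2 y) u2 + scale (B z3 y) u3 + y') \<in> Z"
        by (rule frame3_decompose)
      obtain w' where w': "w' \<in> q" "w - (scale (B z1 w) u1 + scale (B z2 w) u2 + scale (B z3 w) u3 + w') \<in> Z"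
        by (rule frame3_decompose)
      note A' = frame3_core(3)[OF x'(1)] frame3_core(3)[OF y'(1)] frame3_core(3)[OF w'(1)]
      have 0: "\<omega> x' u1 a = 0" "\<omega> x' u2 a = 0" "\<omega> x' u3 a = 0" "\<omega> x' a u1 = 0" "\<omega> x' a u2 = 0" "\<omega> x' a u3 = 0"
        if "a \<in> A" for a
        using triv[OF A'(1) that] by (simp_all add: sw(1)[of x' u1] sw(1)[of x' u2] sw(1)[of x' u3] sw(2)[of x' a])
      have 1: "\<omega> u2 u1 a = - \<omega> u1 u2 a" "\<omega> u3 u1 a = - \<omega> u1 u3 a" "\<omega> u3 u2 a = - \<omega> u2 u3 a" for a
        by (rule \<omega>_swap12)+
      have 2: "\<omega> u1 a u2 = - \<omega> u1 u2 a" "\<omega> u1 a u3 = - \<omega> u1 u3 a" "\<omega> u2 a u3 = - \<omega> u2 u3 a"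
        "\<omega> u2 a u1 = \<omega> u1 u2 a" "\<omega> u3 a u1 = \<omega> u1 u3 a" "\<omega> u3 a u2 = \<omega> u2 u3 a" for a
        using \<omega>_swap23[of u1 a u2] \<omega>_swap23[of u1 a u3] \<omega>_swap23[of u2 a u3]
          \<omega>_cyc[of u2 a u1] \<omega>_cyc[of u3 a u1] \<omega>_cyc[of u3 a u2] by simp_all
      have 3: "\<omega> x' u1 u2 = \<omega> u1 u2 x'" "\<omega> x' u1 u3 = \<omega> u1 u3 x'" "\<omega> x' u2 u3 = \<omega> u2 u3 x'"
        "\<omega> x' u2 u1 = - \<omega> u1 u2 x'" "\<omega> x' u3 u1 = - \<omega> u1 u3 x'" "\<omega> x' u3 u2 = - \<omega> u2 u3 x'"
        using \<omega>_cyc[of u1 u2 x'] \<omega>_cyc[of u1 u3 x'] \<omega>_cyc[of u2 u3 x'] \<omega>_swap23[of x' u2 u1]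
          \<omega>_swap23[of x' u3 u1] \<omega>_swap23[of x' u3 u2] by simp_all
      have 4: "\<omega> u1 u3 u2 = - \<omega> u1 u2 u3" "\<omega> u2 u3 u1 = \<omega> u1 u2 u3"
        using \<omega>_swap23[of u1 u3 u2] \<omega>_cyc[of u2 u3 u1] by simp_all
      note simps = \<omega>_simps 0 1 2[of x'] 2[of y'] 2[of w'] 3 4 triv A' frame3_\<omega>_A
      have u: "\<omega> u y w = \<omega> u (scale (B z1 y) u1 + scale (B z2 y) u2 + scale (B z3 y) u3 + y')
          (scale (B z1 w) u1 + scale (B z2 w) u2 + scale (B z3 w) u3 + w')"
        "\<omega> u w x = \<omega> u (scale (B z1 w) u1 + scale (B z2 w) u2 + scale (B z3 w) u3 + w')
          (scale (B z1 x) u1 + scale (B z2 x) u2 + scale (B z3 x) u3 + x')"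
        "\<omega> u x y = \<omega> u (scale (B z1 x) u1 + scale (B z2 x) u2 + scale (B z3 x) u3 + x')
          (scale (B z1 y) u1 + scale (B z2 y) u2 + scale (B z3 y) u3 + y')" for u
        by (rule \<omega>_cong_Z[OF Z_refl y'(2) w'(2)] \<omega>_cong_Z[OF Z_refl w'(2) x'(2)] \<omega>_cong_Z[OF Z_refl x'(2) y'(2)])+
      show ?thesis
        unfolding wedge_def wedge2_def u[of u1] u[of u2] u[of u3] \<omega>_cong_Z[OF x'(2) y'(2) w'(2)]
        by (simp add: simps, algebra)
    qed
    then have eq: "(\<lambda>x y w. 2 * \<omega> x y w) = (\<lambda>x y w. wedge (B z1) (\<omega> u1) x y w +
        (wedge (B z2) (\<omega> u2) x y w + (wedge (B z3) (\<omega> u3) x y w + (- \<omega> u1 u2 u3) * ?D x y w)))"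
      by (simp only:)
    show ?thesis
      by (rule coboundary_cancel[OF two], unfold eq)
        (intro coboundary_add coboundary_mult coboundary_central D frame3_values)
  qed
qed

text \<open>A nontrivial action forces \<open>q\<close> to be the plane of a and b, on which all
  actions are proportional. Hence u2 and u3 can be corrected by u1 to act trivially on A, and
  \<omega> turns out to be divisible by a single central form.\<close>

lemma frame3_nontrivial_action:
  assumes ab0: "a0 \<in> A" "b0 \<in> A" "\<omega> u1 a0 b0 \<noteq> 0"
  shows "coboundary \<omega>"
proof -
  obtain a1 b where ab1: "a1 \<in> q" "a0 - a1 \<in> Z" "b \<in> q" "b0 - b \<in> Z"
    using frame3_core(1) ab0 unfolding core_def by blast
  then have ne1: "\<omega> u1 a1 b \<noteq> 0"
    using ab0(3) \<omega>_cong_Z[OF Z_refl ab1(2,4)] by simp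
  define a where "a = scale (1 / \<omega> u1 a1 b) a1"
  have ab: "a \<in> q" "b \<in> q" "\<omega> u1 a b = 1"
    using ab1 ne1 frame3_core(2) by (simp_all add: a_def \<omega>_simps subspace_scale)
  note abA = frame3_core(3)[OF ab(1)] frame3_core(3)[OF ab(2)]
  have "a \<noteq> 0"
    using ab(3) by (auto simp: \<omega>_simps)
  moreover have "b \<notin> span {a}"
    using ab(3) by (auto simp: \<omega>_simps span_singleton)
  ultimately have "dim {b, a} = 2"
    by (simp add: dim_insert)
  then have sp: "span {b, a} = q"
    using ab dim frame3_core(2) by (intro subspace_dim_equal subspace_span span_minimal) simp_all
  have span: "\<exists>\<alpha> \<beta>. x - (scale \<alpha> a + scale \<beta> b) \<in> Z" if x: "x \<in> A" for x
  proof -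
    obtain y where y: "y \<in> q" "x - y \<in> Z"
      using frame3_core(1) x unfolding core_def by blast
    obtain \<alpha> \<beta> where "y - scale \<beta> b - scale \<alpha> a = 0"
      using y(1) by (auto simp: sp[symmetric] span_breakdown_eq)
    then have "y = scale \<alpha> a + scale \<beta> b"
      by (simp add: algebra_simps)
    then show ?thesis
      using y(2) by blast
  qed
  have uba: "\<omega> u b a = - \<omega> u a b" for u
    by (rule \<omega>_swap23)
  \<comment> \<open>z is the combination of the central vectors that is orthogonal to v2 and v3 and
    pairs to 1 with u1.\<close>
  define v2 where "v2 = u2 - scale (\<omega> u2 a b) u1"
  define v3 where "v3 = u3 - scale (\<omega> u3 a b) u1"
  define z where "z = z1 + scale (\<omega> u2 a b) z2 + scale (\<omega> u3 a b) z3"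
  have "z \<in> Z"
    unfolding z_def using frame3_values by (intro subspace_add subspace_scale subspace_Z)
  have triv: "\<omega> v x y = 0" if xy: "x \<in> A" "y \<in> A" and v: "\<omega> v a b = 0" for v x y
  proof -
    obtain \<alpha> \<beta> where x': "x - (scale \<alpha> a + scale \<beta> b) \<in> Z"
      using span[OF xy(1)] by blast
    obtain \<alpha>' \<beta>' where y': "y - (scale \<alpha>' a + scale \<beta>' b) \<in> Z"
      using span[OF xy(2)] by blast
    show ?thesis
      by (subst \<omega>_cong_Z[OF Z_refl x' y']) (simp add: \<omega>_simps uba v)
  qed
  have v0: "\<omega> v2 a b = 0" "\<omega> v3 a b = 0"
    by (simp_all add: v2_def v3_def \<omega>_simps ab)
  \<comment> \<open>By Jacobi u1 acts trivially on [v2, v3], because v2 and v3 act trivially on A.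
    As u1 is invertible on the plane \<open>q\<close>, this makes [v2, v3] central.\<close>
  have u1e: "\<omega> u1 (bracket v2 v3) c = 0" if c: "c \<in> A" for c
  proof -
    have "bracket u1 (bracket v2 v3) = bracket (bracket u1 v2) v3 + bracket v2 (bracket u1 v3)"
      using jacobi_right[of u1 v2 v3] by simp
    then have "\<omega> u1 (bracket v2 v3) c = - \<omega> v3 (bracket u1 v2) c + \<omega> v2 (bracket u1 v3) c"
      using bracket_skew[of "bracket u1 v2" v3] by (simp add: \<omega>_def form_simps)
    then show ?thesis
      using triv[OF _ c v0(1)] triv[OF _ c v0(2)] by simp
  qed
  obtain \<alpha> \<beta> where e: "bracket v2 v3 - (scale \<alpha> a + scale \<beta> b) \<in> Z"
    using span[OF bracket_mem_A] by blast
  have "\<omega> u1 (scale \<alpha> a + scale \<beta> b) c = 0" if "c \<in> A" for c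
    using u1e[OF that] \<omega>_cong_Z[OF Z_refl e Z_refl] by metis
  from this[OF abA(1)] this[OF abA(2)] have "\<alpha> = 0" "\<beta> = 0"
    by (simp_all add: \<omega>_simps ab uba)
  then have eZ: "bracket v2 v3 \<in> Z"
    using e by simp
  have vv: "\<omega> v2 v3 c = 0" if "c \<in> A" for c
    unfolding \<omega>_def by (rule form_Z_A[OF eZ that])
  show ?thesis
  proof (rule coboundary_\<omega>_decomposable[OF \<open>z \<in> Z\<close>])
    have "B z u1 = 1"
      by (simp add: z_def form_simps frame3_values)
    then show "z \<noteq> 0"
      by (auto simp: form_simps)
    have dec: "\<exists>s r. \<exists>y\<in>A. x - (scale s v2 + scale r v3 + y) \<in> Z" if "B z x = 0" for x
    proof -
      obtain y where y: "y \<in> q" "x - (scale (B z1 x) u1 + scale (B z2 x) u2 + scale (B z3 x) u3 + y) \<in> Z"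
        by (rule frame3_decompose)
      have "B z1 x + (\<omega> u2 a b * B z2 x + \<omega> u3 a b * B z3 x) = 0"
        using that by (simp add: z_def form_simps add.assoc)
      then have "B z1 x = - (\<omega> u2 a b * B z2 x + \<omega> u3 a b * B z3 x)"
        by (simp only: eq_neg_iff_add_eq_0)
      then have "scale (B z1 x) u1 + scale (B z2 x) u2 + scale (B z3 x) u3 + y =
          scale (B z2 x) v2 + scale (B z3 x) v3 + y"
        by (simp add: v2_def v3_def scale_right_diff_distrib scale_left_distrib scale_left_diff_distrib mult.commute)
      then show ?thesis
        using y frame3_core(3) by metis
    qed
    fix x y w assume "B z x = 0" "B z y = 0" "B z w = 0"
    then obtain s r x' s' r' y' s'' r'' w' where x': "x' \<in> A" "x - (scale s v2 + scale r v3 + x') \<in> Z"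
      and y': "y' \<in> A" "y - (scale s' v2 + scale r' v3 + y') \<in> Z"
      and w': "w' \<in> A" "w - (scale s'' v2 + scale r'' v3 + w') \<in> Z"
      using dec by meson
    have 0: "\<omega> v2 c d = 0" "\<omega> v3 c d = 0" "\<omega> c v2 d = 0" "\<omega> c v3 d = 0" "\<omega> c d v2 = 0" "\<omega> c d v3 = 0"
      if "c \<in> A" "d \<in> A" for c d
      using triv[OF that v0(1)] triv[OF that v0(2)] \<omega>_swap12[of c v2 d] \<omega>_swap12[of c v3 d]
        \<omega>_cyc[of c d v2] \<omega>_cyc[of c d v3] by simp_all
    have 1: "\<omega> v2 v3 c = 0" "\<omega> v3 v2 c = 0" "\<omega> v2 c v3 = 0" "\<omega> v3 c v2 = 0" "\<omega> c v2 v3 = 0" "\<omega> c v3 v2 = 0"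
      if "c \<in> A" for c
      using vv[OF that] \<omega>_swap12[of v3 v2 c] \<omega>_swap23[of v2 c v3] \<omega>_cyc[of v2 v3 c] \<omega>_cyc[of v3 c v2]
        \<omega>_swap23[of c v3 v2] by simp_all
    show "\<omega> x y w = 0"
      by (subst \<omega>_cong_Z[OF x'(2) y'(2) w'(2)]) (simp add: \<omega>_simps 0 1 x' y' w' frame3_\<omega>_A)
  qed
qed

end

lemma coboundary_frame3:
  assumes fr: "frame3 q z1 z2 z3 u1 u2 u3" and dim: "dim q \<le> 2"
  shows "coboundary \<omega>"
proof -
  note fr2 = frame3_rotate[OF fr]
  note fr3 = frame3_rotate[OF fr2]
  show ?thesis
    using frame3_trivial_action[OF fr dim] frame3_nontrivial_action[OF fr dim]
      frame3_nontrivial_action[OF fr2 dim] frame3_nontrivial_action[OF fr3 dim] by blast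
qed

section \<open>Splitting off hyperbolic planes\<close>

text \<open>The invariant of the splitting process: V is what remains after removing hyperbolic
  planes, T collects their isotropic central vectors, and A lies in V + span T.\<close>

definition chain :: "'b set \<Rightarrow> 'b set \<Rightarrow> bool" where
  "chain V T \<longleftrightarrow> nondeg_on V \<and> T \<subseteq> A \<inter> Z \<and> (\<forall>a\<in>A. \<exists>y\<in>V. a - y \<in> span T)"

lemma span_isotropic_center: "T \<subseteq> A \<inter> Z \<Longrightarrow> span T \<subseteq> A \<inter> Z"
  by (rule span_minimal[OF _ subspace_inter[OF subspace_A subspace_Z]])

lemma chain_step:
  assumes ch: "chain V T" and z: "z \<in> V" "z \<in> A" "z \<in> Z" "z \<noteq> 0"
  obtains u where "u \<in> V" "B z u = 1" "chain {y \<in> V. B z y = 0 \<and> B u y = 0} (insert z T)"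
    "dim {y \<in> V. B z y = 0 \<and> B u y = 0} + 2 \<le> dim V"
proof -
  have V: "nondeg_on V" and T: "T \<subseteq> A \<inter> Z"
    using ch by (auto simp: chain_def)
  have zz: "B z z = 0"
    by (rule form_Z_A[OF z(3,2)])
  obtain u where u: "u \<in> V" "B z u = 1" "B u u = 0"
    "nondeg_on {y \<in> V. B z y = 0 \<and> B u y = 0}" "dim {y \<in> V. B z y = 0 \<and> B u y = 0} + 2 \<le> dim V"
    by (rule hyperbolic_complement[OF V z(1,4) zz])
  have "\<exists>y\<in>{y \<in> V. B z y = 0 \<and> B u y = 0}. a - y \<in> span (insert z T)" if a: "a \<in> A" for a
  proof -
    obtain y where y: "y \<in> V" "a - y \<in> span T"
      using ch a by (auto simp: chain_def)
    have "a - (a - y) \<in> A"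
      by (rule subspace_diff[OF subspace_A a]) (use y(2) span_isotropic_center[OF T] in auto)
    then have "B z y = 0"
      using form_Z_A[OF z(3)] by simp
    \<comment> \<open>y lies in A and is thus orthogonal to the central z, so a multiple of z
      suffices to make it orthogonal to u as well.\<close>
    then have "y - scale (B u y) z \<in> {y \<in> V. B z y = 0 \<and> B u y = 0}"
      using y(1) z(1) V u(2) zz by (auto simp: form_simps form_sym[of u z] nondeg_on_def subspace_diff subspace_scale)
    moreover have "(a - y) + scale (B u y) z \<in> span (insert z T)"
      using y(2) span_mono[of T "insert z T"] by (intro span_add span_scale) (auto intro: span_base)
    then have "a - (y - scale (B u y) z) \<in> span (insert z T)"
      by (simp add: algebra_simps)
    ultimately show ?thesis
      by blast
  qed
  then have "chain {y \<in> V. B z y = 0 \<and> B u y = 0} (insert z T)"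
    using u(4) T z by (auto simp: chain_def)
  then show thesis
    using that u by blast
qed

text \<open>Once V has no isotropic center, A \<inter> Z lies in span T. Hence A \<inter> V is a
  core, and orthogonality to T already puts a vector into A + Z.\<close>

lemma chain_core:
  assumes ch: "chain V T" and V: "A \<inter> Z \<inter> V \<subseteq> {0}"
  shows "core (A \<inter> V)" "\<And>x. (\<And>z. z \<in> T \<Longrightarrow> B z x = 0) \<Longrightarrow> \<exists>y\<in>A \<inter> V. x - y \<in> Z"
proof -
  have T: "T \<subseteq> A \<inter> Z" and sV: "subspace V"
    using ch by (auto simp: chain_def nondeg_on_def)
  have dec: "\<exists>y\<in>A \<inter> V. a - y \<in> span T" if a: "a \<in> A" for a
  proof -
    obtain y where y: "y \<in> V" "a - y \<in> span T"
      using ch a by (auto simp: chain_def)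
    have "a - (a - y) \<in> A"
      by (rule subspace_diff[OF subspace_A a]) (use y(2) span_isotropic_center[OF T] in auto)
    then show ?thesis
      using y by auto
  qed
  show "core (A \<inter> V)"
    unfolding core_def
    using dec span_isotropic_center[OF T] V subspace_inter[OF subspace_A sV] by blast
  show "\<exists>y\<in>A \<inter> V. x - y \<in> Z" if x: "\<And>z. z \<in> T \<Longrightarrow> B z x = 0" for x
  proof -
    have f: "functional scale (\<lambda>z. B z x)"
      using form_bilinear by (simp add: bilinear_form_def)
    have "B z x = 0" if z: "z \<in> Z" "z \<in> A" for z
    proof -
      obtain y where y: "y \<in> A \<inter> V" "z - y \<in> span T"
        using dec[OF z(2)] by blast
      have "z - (z - y) \<in> Z"
        by (rule subspace_diff[OF subspace_Z z(1)]) (use y(2) span_isotropic_center[OF T] in auto)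
      then have "y = 0"
        using y(1) V by auto
      then show ?thesis
        using functional_vanishes_on_span[OF f x] y(2) by simp
    qed
    then obtain a where a: "a \<in> A" "x - a \<in> Z"
      using mem_A_plus_Z by blast
    obtain y where y: "y \<in> A \<inter> V" "a - y \<in> span T"
      using dec[OF a(1)] by blast
    have "(x - a) + (a - y) \<in> Z"
      by (rule subspace_add[OF subspace_Z a(2)]) (use y(2) span_isotropic_center[OF T] in auto)
    then show ?thesis
      using y(1) by auto
  qed
qed

text \<open>After one, two or three planes the remainder has dimension at most 6, 4 or 2; if it
  contains no isotropic central vector, the matching frame lemma applies. A fourth plane exhausts
  the space, and then A lies in the span of central vectors.\<close>

theorem coboundary_\<omega>_dim_le_8:
  assumes dim: "dim (UNIV :: 'b set) \<le> 8"
  shows "coboundary \<omega>"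
proof (rule ccontr)
  assume ne: "\<not> coboundary \<omega>"
  then have nAZ: "\<not> A \<subseteq> Z"
    using coboundary_\<omega>_two_step by blast
  have ch0: "chain UNIV {}"
    by (auto simp: chain_def nondeg_on_def form_simps intro!: exI[of _ "x" for x])
  have get: "\<exists>z. z \<in> V \<and> z \<in> A \<and> z \<in> Z \<and> z \<noteq> 0" if "\<not> A \<inter> Z \<inter> V \<subseteq> {0}" for V
    using that by blast
  obtain z1 where z1: "z1 \<in> A" "z1 \<in> Z" "z1 \<noteq> 0"
    using A_subset_Z_if_no_isotropic_center nAZ by blast
  obtain u1 where u1: "B z1 u1 = 1" "chain {y \<in> UNIV. B z1 y = 0 \<and> B u1 y = 0} {z1}"
    "dim {y \<in> UNIV. B z1 y = 0 \<and> B u1 y = 0} + 2 \<le> dim (UNIV :: 'b set)"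
    by (rule chain_step[OF ch0 UNIV_I z1])
  define V1 where "V1 = {y \<in> UNIV. B z1 y = 0 \<and> B u1 y = 0}"
  note u1 = u1[folded V1_def]
  have "\<not> A \<inter> Z \<inter> V1 \<subseteq> {0}"
  proof
    assume V: "A \<inter> Z \<inter> V1 \<subseteq> {0}"
    have "dim (A \<inter> V1) \<le> 6"
      using u1(3) dim dim_subset[of "A \<inter> V1" V1] by auto
    moreover have "B x u1 = 0" if "x \<in> A \<inter> V1" for x
      using that by (simp add: V1_def form_sym[of x])
    ultimately show False
      using coboundary_frame1[OF chain_core(1)[OF u1(2) V] _ z1(2,1) u1(1)] chain_core(2)[OF u1(2) V] ne
      by blast
  qed
  then obtain z2 where z2: "z2 \<in> V1" "z2 \<in> A" "z2 \<in> Z" "z2 \<noteq> 0"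
    using get by blast
  obtain u2 where u2: "u2 \<in> V1" "B z2 u2 = 1" "chain {y \<in> V1. B z2 y = 0 \<and> B u2 y = 0} {z2, z1}"
    "dim {y \<in> V1. B z2 y = 0 \<and> B u2 y = 0} + 2 \<le> dim V1"
    by (rule chain_step[OF u1(2) z2])
  define V2 where "V2 = {y \<in> V1. B z2 y = 0 \<and> B u2 y = 0}"
  note u2 = u2[folded V2_def]
  have v12: "B z1 u2 = 0" "B z2 u1 = 0"
    using u2(1) z2(1) by (auto simp: V1_def form_sym[of z2 u1])
  have "\<not> A \<inter> Z \<inter> V2 \<subseteq> {0}"
  proof
    assume V: "A \<inter> Z \<inter> V2 \<subseteq> {0}"
    have "dim (A \<inter> V2) \<le> 4"
      using u1(3) u2(4) dim dim_subset[of "A \<inter> V2" V2] by auto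
    moreover have "frame2 (A \<inter> V2) z1 z2 u1 u2"
      unfolding frame2_def
      using z1 z2 u1(1) u2(2) v12 chain_core[OF u2(3) V]
      by (auto simp: V2_def V1_def form_sym[of _ u1] form_sym[of _ u2])
    ultimately show False
      using coboundary_frame2 ne by blast
  qed
  then obtain z3 where z3: "z3 \<in> V2" "z3 \<in> A" "z3 \<in> Z" "z3 \<noteq> 0"
    using get by blast
  obtain u3 where u3: "u3 \<in> V2" "B z3 u3 = 1" "chain {y \<in> V2. B z3 y = 0 \<and> B u3 y = 0} {z3, z2, z1}"
    "dim {y \<in> V2. B z3 y = 0 \<and> B u3 y = 0} + 2 \<le> dim V2"
    by (rule chain_step[OF u2(3) z3])
  define V3 where "V3 = {y \<in> V2. B z3 y = 0 \<and> B u3 y = 0}"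
  note u3 = u3[folded V3_def]
  have v3: "B z1 u3 = 0" "B z2 u3 = 0" "B z3 u1 = 0" "B z3 u2 = 0"
    using u3(1) z3(1) by (auto simp: V1_def V2_def form_sym[of z3])
  have "\<not> A \<inter> Z \<inter> V3 \<subseteq> {0}"
  proof
    assume V: "A \<inter> Z \<inter> V3 \<subseteq> {0}"
    have "dim (A \<inter> V3) \<le> 2"
      using u1(3) u2(4) u3(4) dim dim_subset[of "A \<inter> V3" V3] by auto
    moreover have "frame3 (A \<inter> V3) z1 z2 z3 u1 u2 u3"
      unfolding frame3_def
      using z1 z2 z3 u1(1) u2(2) u3(2) v12 v3 chain_core[OF u3(3) V] by auto
    ultimately show False
      using coboundary_frame3 ne by blast
  qed
  then obtain z4 where z4: "z4 \<in> V3" "z4 \<in> A" "z4 \<in> Z" "z4 \<noteq> 0"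
    using get by blast
  obtain u4 where u4: "chain {y \<in> V3. B z4 y = 0 \<and> B u4 y = 0} {z4, z3, z2, z1}"
    "dim {y \<in> V3. B z4 y = 0 \<and> B u4 y = 0} + 2 \<le> dim V3"
    by (rule chain_step[OF u3(3) z4])
  define V4 where "V4 = {y \<in> V3. B z4 y = 0 \<and> B u4 y = 0}"
  note u4 = u4[folded V4_def]
  have "dim V4 = 0"
    using u1(3) u2(4) u3(4) u4(2) dim by linarith
  then have "V4 \<subseteq> {0}"
    by simp
  then have "a \<in> span {z4, z3, z2, z1}" if "a \<in> A" for a
    using u4(1) that by (fastforce simp: chain_def)
  moreover have "span {z4, z3, z2, z1} \<subseteq> Z"
    using z1 z2 z3 z4 span_isotropic_center[of "{z4, z3, z2, z1}"] by blast
  ultimately show False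
    using nAZ by blast
qed

end

section \<open>Reduction to nondegenerate forms\<close>

context lie_algebra
begin

lemma bracket_mem_derived: "x \<in> derived i \<Longrightarrow> y \<in> derived i \<Longrightarrow> bracket x y \<in> derived (Suc i)"
  unfolding derived.simps bracket_span_def by (rule span_base) blast

lemma three_solvable_identity:
  assumes three_solvable
  shows "bracket (bracket (bracket a b) (bracket c d)) (bracket (bracket e f) (bracket g h)) = 0"
proof -
  have "bracket x y \<in> derived 1" for x y
    using bracket_mem_derived[of x 0 y] by simp
  then have "bracket (bracket x y) (bracket z w) \<in> derived 2" for x y z w
    using bracket_mem_derived[of _ 1] by (simp add: numeral_2_eq_2)
  then have "bracket (bracket (bracket a b) (bracket c d)) (bracket (bracket e f) (bracket g h)) \<in> derived 3"
    using bracket_mem_derived[of _ 2] by (simp add: numeral_3_eq_3 numeral_2_eq_2)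
  then show ?thesis
    using assms by (simp add: three_solvable_def)
qed

text \<open>With \<open>p\<close> a projection along the radical of \<open>B\<close>, the quotient by the radical is realised on the same type
  by the bracket \<open>p [x, y]\<close>, and \<open>B\<close> is completed by a nondegenerate form on the radical, now a central summand.\<close>

theorem coboundary_dim_le_8:
  assumes fd: "finite_dimensional_vector_space scale Bs" and dim: "vector_space.dim scale UNIV \<le> 8"
    and char: "(2::'k) \<noteq> 0" "(3::'k) \<noteq> 0" and solv: three_solvable and B: "invariant_form B"
  shows "coboundary (\<lambda>x y z. B (bracket x y) z)"
proof -
  interpret fd: finite_dimensional_vector_space scale Bs
    by (rule fd)
  have bil: "bilinear_form scale B" and sym: "B x y = B y x"
    and inv: "B (bracket x y) z = B x (bracket y z)" for x y z
    using B unfolding invariant_form_def by blast+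
  note bs = bilinear_formD[OF bil]
  define R where "R = {x. \<forall>y. B x y = 0}"
  have R: "subspace R"
    unfolding R_def by (rule subspaceI) (simp_all add: bs)
  have BR: "B x y = 0" "B y x = 0" if "x \<in> R" for x y
    using that sym[of y x] by (simp_all add: R_def)
  have ideal: "bracket x y \<in> R" "bracket y x \<in> R" if "x \<in> R" for x y
  proof -
    show "bracket x y \<in> R"
      using BR[OF that] by (simp add: R_def inv)
    then show "bracket y x \<in> R"
      using subspace_neg[OF R] bracket_skew[of y x] by simp
  qed
  obtain p where p_add: "\<And>x y. p (x + y) = p x + p y" and p_scale: "\<And>c x. p (scale c x) = scale c (p x)"
    and p_R: "\<And>r. r \<in> R \<Longrightarrow> p r = 0" and p_diff: "\<And>x. x - p x \<in> R"
    using complement_projection[OF R] by blast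
  have p_eq: "p x = p y" if "x - y \<in> R" for x y
    using p_add[of "x - y" y] p_R[OF that] by simp
  have p_zero: "p 0 = 0"
    by (rule p_R[OF subspace_0[OF R]])
  have p_p [simp]: "p (p x) = p x" for x
    using p_eq[OF p_diff] by simp
  have Bp [simp]: "B (p x) y = B x y" "B x (p y) = B x y" for x y
    using BR(1)[OF p_diff, of x y] BR(2)[OF p_diff, of x y] by (simp_all add: bs)
  \<comment> \<open>The radical is an ideal, so the projected bracket depends on its arguments only
    modulo R; this gives the Jacobi identity for \<open>br\<close>.\<close>
  have pl [simp]: "p (bracket (p x) y) = p (bracket x y)" for x y
    using p_eq[of "bracket x y" "bracket (p x) y"] ideal(1)[OF p_diff, of x y] by (simp add: bracket_simps)
  have pr [simp]: "p (bracket x (p y)) = p (bracket x y)" for x y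
    using p_eq[of "bracket x y" "bracket x (p y)"] ideal(2)[OF p_diff, of x y] by (simp add: bracket_simps)
  define br where "br x y = p (bracket x y)" for x y
  obtain E where E: "finite E" "independent E" "span E = R"
    using fd.basis_subspace_exists[OF R] by metis
  let ?rep = "\<lambda>x. representation E (x - p x)"
  have rE: "x - p x \<in> span E" for x
    using p_diff E by simp
  have rep_add: "?rep (x + y) b = ?rep x b + ?rep y b" for x y b
    using representation_add[OF E(2) rE[of y] rE[of x]] by (simp add: p_add algebra_simps)
  have rep_scale: "?rep (scale c x) b = c * ?rep x b" for c x b
    using representation_scale[OF E(2) rE[of x], of c] by (simp add: p_scale scale_right_diff_distrib)
  \<comment> \<open>On the radical the added form has the identity as Gram matrix in the basis
    \<open>E\<close>, which is nondegenerate over every field.\<close>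
  define B' where "B' x y = B x y + (\<Sum>b\<in>E. ?rep x b * ?rep y b)" for x y
  have B'p: "B' (p x) y = B x y" "B' x (p y) = B x y" for x y
    by (simp_all add: B'_def representation_zero)
  interpret L: lie_algebra scale br
  proof (rule lie_algebra.intro[OF vector_space_axioms lie_algebra_axioms.intro])
    show "Vector_Spaces.linear scale scale (\<lambda>x. br x y)" "Vector_Spaces.linear scale scale (br x)" for x y
      unfolding Vector_Spaces.linear_iff br_def using vector_space_axioms
      by (auto simp: bracket_simps p_add p_scale)
    show "br x x = 0" for x
      by (simp add: br_def alternating p_zero)
    show "br x (br y z) + br y (br z x) + br z (br x y) = 0" for x y z
      using jacobi[of x y z] by (simp add: br_def p_zero flip: p_add)
  qed
  interpret S: metric_3solvable scale br Bs B'
  proof unfold_locales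
    show "L.invariant_form B'"
      unfolding L.invariant_form_def
    proof (intro conjI allI)
      show "bilinear_form scale B'"
        unfolding bilinear_form_def functional_def B'_def
        by (simp only: bs rep_add rep_scale) (simp add: algebra_simps sum.distrib sum_distrib_left)
      show "B' x y = B' y x" for x y
        by (simp add: B'_def sym[of x y] mult.commute)
      show "B' (br x y) z = B' x (br y z)" for x y z
        by (simp add: br_def B'p inv)
    qed
    show "x = 0" if x: "\<And>y. B' x y = 0" for x
    proof -
      have "?rep x b = 0" if b: "b \<in> E" for b
      proof -
        have bR: "b \<in> R"
          using b E(3) span_base by blast
        have "?rep b = (\<lambda>c. if c = b then 1 else 0)"
          using representation_basis[OF E(2) b] p_R[OF bR] by simp
        then have "B' x b = ?rep x b"
          using b E(1) BR(2)[OF bR] by (simp add: B'_def if_distrib[of "\<lambda>c. _ * c"] cong: if_cong)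
        then show ?thesis
          using x by simp
      qed
      then have "x - p x = 0"
        using sum_representation_eq[OF E(2) rE[of x] E(1) order_refl] by simp
      then have "B x y = 0" for y
        using x[of y] by (simp add: B'_def representation_zero)
      then have "x \<in> R"
        by (simp add: R_def)
      then show "x = 0"
        using p_R[of x] \<open>x - p x = 0\<close> by simp
    qed
    show "br (br (br a b) (br c d)) (br (br e f) (br g h)) = 0" for a b c d e f g h
      by (simp add: br_def three_solvable_identity[OF solv] p_zero)
  qed (use char in auto)
  have "L.coboundary S.\<omega>"
    by (rule S.coboundary_\<omega>_dim_le_8[OF dim])
  then obtain \<alpha> where \<alpha>: "bilinear_form scale \<alpha>" "\<And>x. \<alpha> x x = 0"
    "\<And>x y z. S.\<omega> x y z = \<alpha> (br x y) z + \<alpha> (br y z) x + \<alpha> (br z x) y"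
    unfolding L.coboundary_def by blast
  show ?thesis
    unfolding coboundary_def
  \<comment> \<open>The primitive for the quotient is pulled back along p. B and \<open>B'\<close>
    agree as soon as one argument is projected, so no trace of the added form remains.\<close>
  proof (intro exI[of _ "\<lambda>x y. \<alpha> (p x) (p y)"] conjI allI)
    show "bilinear_form scale (\<lambda>x y. \<alpha> (p x) (p y))"
      unfolding bilinear_form_def functional_def by (simp add: p_add p_scale bilinear_formD[OF \<alpha>(1)])
    show "\<alpha> (p x) (p x) = 0" for x
      by (rule \<alpha>)
    show "B (bracket x y) z = \<alpha> (p (bracket x y)) (p z) + \<alpha> (p (bracket y z)) (p x) + \<alpha> (p (bracket z x)) (p y)"
      for x y z
      using \<alpha>(3)[of "p x" "p y" "p z"] inv[of "p x" "p y" "p z"] inv[of x y "p z"] sym[of "bracket x y" z]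
        inv[of x "p y" z] 
      by (simp add: S.\<omega>_def br_def B'p inv)
  qed
qed

end

theorem theorem1p9:
  shows "(\<exists>br :: 'k::field ^ 9 \<Rightarrow> 'k ^ 9 \<Rightarrow> 'k ^ 9.
            lie_algebra (*s) br \<and>
            vector_space.dim ((*s) :: 'k \<Rightarrow> 'k ^ 9 \<Rightarrow> 'k ^ 9) UNIV = 9 \<and>
            lie_algebra.three_solvable (*s) br \<and>
            lie_algebra.center_by_metabelian (*s) br \<and>
            lie_algebra.reduced_koszul_nonzero (*s) br) \<and>
         (CHAR('k) = 0 \<longrightarrow>
           (\<forall>(sc :: 'k \<Rightarrow> 'g::ab_group_add \<Rightarrow> 'g) br.
              lie_algebra sc br \<longrightarrow>
              lie_algebra.finite_dim sc \<longrightarrow>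
              lie_algebra.three_solvable sc br \<longrightarrow>
              lie_algebra.reduced_koszul_nonzero sc br \<longrightarrow>
              9 \<le> vector_space.dim sc UNIV))"
proof (intro conjI impI allI)
  have "vec.dim (UNIV :: ('k ^ 9) set) = 9"
    by (simp add: vec.dim_UNIV card_cart_basis)
  then show "\<exists>br :: 'k ^ 9 \<Rightarrow> 'k ^ 9 \<Rightarrow> 'k ^ 9.
            lie_algebra (*s) br \<and>
            vector_space.dim ((*s) :: 'k \<Rightarrow> 'k ^ 9 \<Rightarrow> 'k ^ 9) UNIV = 9 \<and>
            lie_algebra.three_solvable (*s) br \<and>
            lie_algebra.center_by_metabelian (*s) br \<and>
            lie_algebra.reduced_koszul_nonzero (*s) br"
    using ex.lie_algebra_axioms ex_three_solvable ex_center_by_metabelian ex_reduced_koszul_nonzero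
    by blast
next
  fix sc :: "'k \<Rightarrow> 'g::ab_group_add \<Rightarrow> 'g" and br
  assume char: "CHAR('k) = 0" and lie: "lie_algebra sc br" and fd: "lie_algebra.finite_dim sc"
    and solv: "lie_algebra.three_solvable sc br" and ne: "lie_algebra.reduced_koszul_nonzero sc br"
  interpret lie_algebra sc br
    by (rule lie)
  obtain Bs where Bs: "finite_dimensional_vector_space sc Bs"
    using fd unfolding finite_dim_def by blast
  have "(2::'k) \<noteq> 0" "(3::'k) \<noteq> 0"
    using of_nat_eq_0_iff_char_dvd[of 2, where ?'a = 'k] of_nat_eq_0_iff_char_dvd[of 3, where ?'a = 'k] char
    by simp_all
  note char23 = this
  show "9 \<le> vector_space.dim sc UNIV"
  proof (rule ccontr)
    assume "\<not> 9 \<le> vector_space.dim sc UNIV"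
    then have "vector_space.dim sc UNIV \<le> 8"
      by simp
    then show False
      using reduced_koszul_nonzeroD[OF ne] coboundary_dim_le_8[OF Bs _ char23 solv] by metis
  qed
qed

end
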